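(* Let $\Delta$ be the Cantor set and $C(\Delta)$ the Banach space of continuous functions $\Delta\to\mathbb{C}$ with the supremum norm. 1. Every Borel field $(W_y)_{y \in Y}$ of separable Banach spaces is isomorphic with a Borel field of the form $V_\gamma$ for some Borel map $\gamma : Y \to S(C(\Delta))$. 2. Consider the standard Borel space $X = [0,1] \times S(C(\Delta))$. The tautological Borel field $V_{\widetilde{\gamma}}$ given by $\widetilde{\gamma} : X \to S(C(\Delta)) : \widetilde{\gamma}(t,A) = A$ is a universal Borel field of separable Banach spaces.
   Context: Conventions. A standard Borel space is a measurable space isomorphic to a Borel subset of a Polish space. Product spaces carry the product $\sigma$-algebra and subsets the restricted $\sigma$-algebra. For a family of sets $V = (V_x)_{x\in X}$, the symbol $V$ also denotes the disjoint union of the $V_x$, and $\pi : V \to X$ is the map with $\pi(v) = x$ for $v \in V_x$. $V \times_\pi V = \{(v,w) \in V \times V \mid \pi(v)=\pi(w)\}$. A section is a map $\varphi : X \to V$ with $\varphi(x)\in V_x$ for all $x$. A sequence of Borel sections $\varphi_n : X \to V$ is dense if $\{\varphi_n(x) \mid n\in\mathbb{N}\}$ is dense in $V_x$ for every $x\in X$. A Borel field of separable Banach spaces (complex scalars) consists of a standard Borel space $X$, a family $V=(V_x)_{x\in X}$ of separable Banach spaces and a standard Borel structure on $V$ such that $\pi : V\to X$, the norm $V\to[0,+\infty)$, the addition $V\times_\pi V\to V$ and the scalar multiplication $\mathbb{C}\times V\to V$ are Borel, and there is a (norm) dense sequence of Borel sections $X\to V$. For a separable Banach space $E$, $S(E)$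 is the set of closed linear subspaces of $E$ with the Effros Borel structure, i.e. the smallest $\sigma$-algebra for which $\{K\in S(E)\mid K\cap\mathcal{O}\neq\emptyset\}$ is measurable for every open $\mathcal{O}\subset E$; this is a standard Borel space. For a standard Borel space $Y$ and a Borel map $\gamma : Y\to S(E)$, $V_\gamma=(\gamma(y))_{y\in Y}$ is the Borel field of separable Banach spaces whose standard Borel structure is given by viewing $V_\gamma=\{(y,u)\mid u\in\gamma(y)\}$ as a Borel subset of $Y\times E$. Two Borel fields $V=(V_x)_{x\in X}$ and $W=(W_y)_{y\in Y}$ of separable Banach spaces are isomorphic if there are bijective Borel maps $\psi : X\to Y$ and $\theta : V\to W$ such that $\pi\circ\theta=\psi\circ\pi$ and for every $x\in X$ the restriction $\theta_x : V_x\to W_{\psi(x)}$ is an isometric linear isomorphism. A Borel field $V=(V_x)_{x\in X}$ of separable Banach spaces is universal if every Borel field of separable Banach spaces is isomorphic with $(V_x)_{x\in X_0}$ for some Borel set $X_0\subset X$. *)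

theory Defs
  imports "HOL-Analysis.Analysis"
begin

section \<open>Standard Borel spaces\<close>

definition borel_of :: "'a topology \<Rightarrow> 'a measure" where
  "borel_of T = sigma (topspace T) {U. openin T U}"

(* A Polish space has at most continuum many points, so it is homeomorphic to one whose set
   of points is a subset of the type real (with a topology unrelated to the usual one).
   Quantifying over real topology therefore covers all Polish spaces, up to homeomorphism.
   Of a measure, only the set and the sigma-algebra are used, never its values. *)
definition standard_borel :: "'a measure \<Rightarrow> bool" where
  "standard_borel M \<longleftrightarrow>
     (\<exists>(P :: real topology) B f g.
        completely_metrizable_space P \<and> second_countable P \<and> B \<in> sets (borel_of P) \<and>
        f \<in> M \<rightarrow>\<^sub>M restrict_space (borel_of P) B \<and>
        g \<in> restrict_space (borel_of P) B \<rightarrow>\<^sub>M M \<and>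
        (\<forall>x\<in>space M. g (f x) = x) \<and>
        (\<forall>y\<in>space (restrict_space (borel_of P) B). f (g y) = y))"


section \<open>Separable complex Banach spaces on a carrier set\<close>

record 'a normed_struct =
  carrier :: "'a set"
  plus :: "'a \<Rightarrow> 'a \<Rightarrow> 'a"
  zero :: 'a
  scale :: "complex \<Rightarrow> 'a \<Rightarrow> 'a"
  nrm :: "'a \<Rightarrow> real"

definition complex_vector_space :: "'a normed_struct \<Rightarrow> bool" where
  "complex_vector_space E \<longleftrightarrow>
     zero E \<in> carrier E \<and>
     (\<forall>u\<in>carrier E. \<forall>v\<in>carrier E. plus E u v \<in> carrier E) \<and>
     (\<forall>a. \<forall>u\<in>carrier E. scale E a u \<in> carrier E) \<and>
     (\<forall>u\<in>carrier E. \<forall>v\<in>carrier E. \<forall>w\<in>carrier E.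
        plus E (plus E u v) w = plus E u (plus E v w)) \<and>
     (\<forall>u\<in>carrier E. \<forall>v\<in>carrier E. plus E u v = plus E v u) \<and>
     (\<forall>u\<in>carrier E. plus E (zero E) u = u) \<and>
     (\<forall>u\<in>carrier E. \<exists>v\<in>carrier E. plus E u v = zero E) \<and>
     (\<forall>a. \<forall>u\<in>carrier E. \<forall>v\<in>carrier E.
        scale E a (plus E u v) = plus E (scale E a u) (scale E a v)) \<and>
     (\<forall>a b. \<forall>u\<in>carrier E. scale E (a + b) u = plus E (scale E a u) (scale E b u)) \<and>
     (\<forall>a b. \<forall>u\<in>carrier E. scale E (a * b) u = scale E a (scale E b u)) \<and>
     (\<forall>u\<in>carrier E. scale E 1 u = u)"

definition complex_normed_space :: "'a normed_struct \<Rightarrow> bool" where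
  "complex_normed_space E \<longleftrightarrow>
     complex_vector_space E \<and>
     (\<forall>u\<in>carrier E. 0 \<le> nrm E u) \<and>
     (\<forall>u\<in>carrier E. nrm E u = 0 \<longleftrightarrow> u = zero E) \<and>
     (\<forall>a. \<forall>u\<in>carrier E. nrm E (scale E a u) = cmod a * nrm E u) \<and>
     (\<forall>u\<in>carrier E. \<forall>v\<in>carrier E. nrm E (plus E u v) \<le> nrm E u + nrm E v)"

(* Metric_space demands nonnegativity and symmetry on the whole type, hence the value 0
   outside the carrier. *)
definition norm_dist :: "'a normed_struct \<Rightarrow> 'a \<Rightarrow> 'a \<Rightarrow> real" where
  "norm_dist E u v =
     (if u \<in> carrier E \<and> v \<in> carrier E then nrm E (plus E u (scale E (- 1) v)) else 0)"

definition norm_topology :: "'a normed_struct \<Rightarrow> 'a topology" where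
  "norm_topology E = Metric_space.mtopology (carrier E) (norm_dist E)"

definition separable_banach_space :: "'a normed_struct \<Rightarrow> bool" where
  "separable_banach_space E \<longleftrightarrow>
     complex_normed_space E \<and>
     Metric_space.mcomplete (carrier E) (norm_dist E) \<and>
     separable_space (norm_topology E)"

definition isometric_linear_iso ::
  "'a normed_struct \<Rightarrow> 'b normed_struct \<Rightarrow> ('a \<Rightarrow> 'b) \<Rightarrow> bool" where
  "isometric_linear_iso E F T \<longleftrightarrow>
     bij_betw T (carrier E) (carrier F) \<and>
     (\<forall>u\<in>carrier E. \<forall>v\<in>carrier E. T (plus E u v) = plus F (T u) (T v)) \<and>
     (\<forall>a. \<forall>u\<in>carrier E. T (scale E a u) = scale F a (T u)) \<and>
     (\<forall>u\<in>carrier E. nrm F (T u) = nrm E u)"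


section \<open>Borel fields of separable Banach spaces\<close>

(* total_space is the disjoint union of the fibres, that is, the set of pairs (x, v) with v in
   the fibre over x, together with a sigma-algebra; the projection to the base is fst. *)
record ('x, 'v) banach_field =
  base :: "'x measure"
  fibre :: "'x \<Rightarrow> 'v normed_struct"
  total_space :: "('x \<times> 'v) measure"

definition fibre_product ::
  "('x, 'v) banach_field \<Rightarrow> (('x \<times> 'v) \<times> ('x \<times> 'v)) measure" where
  "fibre_product V =
     restrict_space (total_space V \<Otimes>\<^sub>M total_space V) {(p, q). fst p = fst q}"

definition borel_section :: "('x, 'v) banach_field \<Rightarrow> ('x \<Rightarrow> 'x \<times> 'v) \<Rightarrow> bool" where
  "borel_section V \<phi> \<longleftrightarrow>
     \<phi> \<in> base V \<rightarrow>\<^sub>M total_space V \<and> (\<forall>x\<in>space (base V). fst (\<phi> x) = x)"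

definition dense_sections :: "('x, 'v) banach_field \<Rightarrow> (nat \<Rightarrow> 'x \<Rightarrow> 'x \<times> 'v) \<Rightarrow> bool" where
  "dense_sections V \<phi> \<longleftrightarrow>
     (\<forall>n. borel_section V (\<phi> n)) \<and>
     (\<forall>x\<in>space (base V).
        norm_topology (fibre V x) closure_of range (\<lambda>n. snd (\<phi> n x)) = carrier (fibre V x))"

definition borel_banach_field :: "('x, 'v) banach_field \<Rightarrow> bool" where
  "borel_banach_field V \<longleftrightarrow>
     standard_borel (base V) \<and>
     (\<forall>x\<in>space (base V). separable_banach_space (fibre V x)) \<and>
     space (total_space V) = Sigma (space (base V)) (\<lambda>x. carrier (fibre V x)) \<and>
     standard_borel (total_space V) \<and>
     fst \<in> total_space V \<rightarrow>\<^sub>M base V \<and>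
     (\<lambda>(x, v). nrm (fibre V x) v) \<in> total_space V \<rightarrow>\<^sub>M restrict_space borel {0..} \<and>
     (\<lambda>((x, v), (y, w)). (x, plus (fibre V x) v w)) \<in> fibre_product V \<rightarrow>\<^sub>M total_space V \<and>
     (\<lambda>(a, (x, v)). (x, scale (fibre V x) a v))
        \<in> (borel :: complex measure) \<Otimes>\<^sub>M total_space V \<rightarrow>\<^sub>M total_space V \<and>
     (\<exists>\<phi>. dense_sections V \<phi>)"

definition field_isomorphic ::
  "('x, 'v) banach_field \<Rightarrow> ('y, 'w) banach_field \<Rightarrow> bool" where
  "field_isomorphic V W \<longleftrightarrow>
     (\<exists>\<psi> \<theta>.
        \<psi> \<in> base V \<rightarrow>\<^sub>M base W \<and> bij_betw \<psi> (space (base V)) (space (base W)) \<and>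
        \<theta> \<in> total_space V \<rightarrow>\<^sub>M total_space W \<and>
        bij_betw \<theta> (space (total_space V)) (space (total_space W)) \<and>
        (\<forall>p\<in>space (total_space V). fst (\<theta> p) = \<psi> (fst p)) \<and>
        (\<forall>x\<in>space (base V).
           isometric_linear_iso (fibre V x) (fibre W (\<psi> x)) (\<lambda>v. snd (\<theta> (x, v)))))"

definition restrict_field :: "('x, 'v) banach_field \<Rightarrow> 'x set \<Rightarrow> ('x, 'v) banach_field" where
  "restrict_field V X0 =
     \<lparr>base = restrict_space (base V) X0,
      fibre = fibre V,
      total_space = restrict_space (total_space V) {p. fst p \<in> X0}\<rparr>"

(* HOL cannot quantify over types inside a formula, so the types of the competing fields W are
   a parameter; a theorem in which 'y and 'w are free covers all of them. *)
definition universal_banach_field ::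
  "('y, 'w) banach_field itself \<Rightarrow> ('x, 'v) banach_field \<Rightarrow> bool" where
  "universal_banach_field _ V \<longleftrightarrow>
     borel_banach_field V \<and>
     (\<forall>W :: ('y, 'w) banach_field. borel_banach_field W \<longrightarrow>
        (\<exists>X0\<in>sets (base V). field_isomorphic W (restrict_field V X0)))"


section \<open>The Effros Borel space and fields of subspaces\<close>

definition closed_subspaces :: "'e normed_struct \<Rightarrow> 'e set set" where
  "closed_subspaces E =
     {K. closedin (norm_topology E) K \<and> zero E \<in> K \<and>
         (\<forall>u\<in>K. \<forall>v\<in>K. plus E u v \<in> K) \<and> (\<forall>a. \<forall>u\<in>K. scale E a u \<in> K)}"

definition effros :: "'e normed_struct \<Rightarrow> 'e set measure" where
  "effros E =
     sigma (closed_subspaces E)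
       {{K \<in> closed_subspaces E. K \<inter> U \<noteq> {}} | U. openin (norm_topology E) U}"

definition subspace_field ::
  "'e normed_struct \<Rightarrow> 'y measure \<Rightarrow> ('y \<Rightarrow> 'e set) \<Rightarrow> ('y, 'e) banach_field" where
  "subspace_field E Y \<gamma> =
     \<lparr>base = Y,
      fibre = (\<lambda>y. E\<lparr>carrier := \<gamma> y\<rparr>),
      total_space = restrict_space (Y \<Otimes>\<^sub>M borel_of (norm_topology E)) {(y, u). u \<in> \<gamma> y}\<rparr>"


section \<open>Continuous functions on the Cantor set\<close>

(* The Cantor set as the product space {0,1}^N; see cantor_homeomorphic for its realisation
   inside the real line. *)
type_synonym cantor = "nat \<Rightarrow> bool"

(* On the compact space cantor, bounded continuous functions are all continuous functions. The
   norm of the library type is the supremum norm. *)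
definition C_cantor :: "(cantor \<Rightarrow>\<^sub>C complex) normed_struct" where
  "C_cantor =
     \<lparr>carrier = UNIV,
      plus = (+),
      zero = 0,
      scale = (\<lambda>a f. Bcontfun (\<lambda>x. a * apply_bcontfun f x)),
      nrm = norm\<rparr>"

lemma apply_scale_C_cantor:
  "apply_bcontfun (scale C_cantor a f) x = a * apply_bcontfun f x"
proof -
  have "bounded (range (\<lambda>x. a * apply_bcontfun f x))"
    using bounded_linear_image[OF bounded_apply_bcontfun[of f] bounded_linear_mult_right[of a]]
    by (simp add: image_image)
  then have "(\<lambda>x. a * apply_bcontfun f x) \<in> bcontfun"
    by (auto simp: bcontfun_def intro!: continuous_intros)
  then show ?thesis
    by (simp add: C_cantor_def Bcontfun_inverse)
qed

lemma compact_UNIV_cantor: "compact (UNIV :: cantor set)"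
proof -
  have "compact_space (euclidean :: bool topology)"
    by (simp add: compact_space_def finite_imp_compact)
  then have "compact_space (product_topology (\<lambda>_::nat. euclidean :: bool topology) UNIV)"
    by (simp add: compact_space_product_topology)
  then show ?thesis
    by (simp add: euclidean_product_topology compact_space_def)
qed

lemma range_apply_bcontfun_cantor:
  "range apply_bcontfun = {f :: cantor \<Rightarrow> complex. continuous_on UNIV f}"
proof -
  have "f \<in> bcontfun" if "continuous_on UNIV f" for f :: "cantor \<Rightarrow> complex"
    using that compact_continuous_image[OF that compact_UNIV_cantor]
    by (simp add: bcontfun_def compact_imp_bounded)
  then show ?thesis
    by (metis (no_types, lifting) Collect_cong bcontfun_def mem_Collect_eq
        type_definition.Rep_range type_definition_bcontfun)
qed

(* The right-hand side is the middle-thirds set: the numbers in [0,1] that have a ternary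
   expansion with digits 0 and 2 only. *)
lemma cantor_homeomorphic:
  "(UNIV :: cantor set) homeomorphic range (\<lambda>b. \<Sum>n. 2 * of_bool (b n) / 3 ^ Suc n :: real)"
proof -
  define t :: "nat \<Rightarrow> cantor \<Rightarrow> real" where "t n b = 2 * of_bool (b n) / 3 ^ Suc n" for n b
  define f :: "cantor \<Rightarrow> real" where "f b = (\<Sum>n. t n b)" for b
  have M_sums: "(\<lambda>n. 2 / 3 ^ Suc n :: real) sums 1"
    using sums_mult[OF geometric_sums[of "1/3 :: real"], of "2/3"]
    by (simp add: power_divide)
  have t_le: "0 \<le> t n b" "t n b \<le> 2 / 3 ^ Suc n" for n b
    by (auto simp: t_def)
  have summ: "summable (\<lambda>n. t n b)" for b
    by (rule summable_comparison_test'[OF sums_summable[OF M_sums], of 0]) (use t_le in auto)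
  have cont: "continuous_on UNIV f"
  proof (rule uniform_limit_theorem)
    show "uniform_limit UNIV (\<lambda>n b. \<Sum>i<n. t i b) f sequentially"
      unfolding f_def
      by (rule Weierstrass_m_test[OF _ sums_summable[OF M_sums]]) (use t_le in auto)
    have "continuous_on UNIV (\<lambda>b :: cantor. of_bool (b i) :: real)" for i
      using continuous_on_compose2[of UNIV "of_bool :: bool \<Rightarrow> real" UNIV "\<lambda>b :: cantor. b i"]
      by (simp add: continuous_on_discrete continuous_on_product_coordinates)
    then show "\<forall>\<^sub>F n in sequentially. continuous_on UNIV (\<lambda>b. \<Sum>i<n. t i b)"
      unfolding t_def by (intro always_eventually allI continuous_intros) auto
  qed simp
  have range01: "0 \<le> f b" "f b \<le> 1" for b
    unfolding f_def using suminf_nonneg[OF summ, of b] t_le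
      suminf_le[OF _ summ sums_summable[OF M_sums], of b] sums_unique[OF M_sums]
    by auto
  have step: "f b = 2 * of_bool (b 0) / 3 + f (\<lambda>n. b (Suc n)) / 3" for b
  proof -
    have "f b = t 0 b + (\<Sum>n. t (Suc n) b)"
      unfolding f_def using suminf_split_head[OF summ, of b] by simp
    also have "(\<lambda>n. t (Suc n) b) = (\<lambda>n. t n (\<lambda>n. b (Suc n)) / 3)"
      by (auto simp: t_def)
    also have "(\<Sum>n. t n (\<lambda>n. b (Suc n)) / 3) = f (\<lambda>n. b (Suc n)) / 3"
      unfolding f_def by (rule suminf_divide[OF summ])
    finally show ?thesis by (simp add: t_def)
  qed
  have "b n = c n" if "f b = f c" for b c n
    using that
  proof (induction n arbitrary: b c)
    case 0
    then show ?case
      using step[of b] step[of c] range01[of "\<lambda>n. b (Suc n)"] range01[of "\<lambda>n. c (Suc n)"]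
      by (cases "b 0"; cases "c 0") auto
  next
    case (Suc n)
    then have "f (\<lambda>n. b (Suc n)) = f (\<lambda>n. c (Suc n))"
      using step[of b] step[of c] range01[of "\<lambda>n. b (Suc n)"] range01[of "\<lambda>n. c (Suc n)"]
      by (cases "b 0"; cases "c 0") auto
    from Suc.IH[OF this] show ?case .
  qed
  then have "inj f"
    by (auto intro!: injI)
  then have "(UNIV :: cantor set) homeomorphic range f"
    using homeomorphic_compact[OF compact_UNIV_cantor cont refl] by simp
  then show ?thesis
    by (simp add: f_def[abs_def] t_def)
qed

end

(* Standard Borel spaces are treated as Borel retracts of the real line; the image of a Borel map f
   with a Borel left inverse g is then the Borel set {y. f (g y) = y}, so that no analytic sets are
   needed.  The Effros space is such a retract: a closed subspace K is coded by the distances of K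
   to a dense sequence, and the sequences arising in this way are cut out by explicit Borel
   conditions.

   For a Borel field W with dense sections, the dual unit ball of each fibre is coded by a closed
   subset of the Cantor set, because the values of a functional on the sections lie in bounded
   squares.  The standard tree retraction onto this subset depends in a Borel way on the fibre, and
   evaluation of functionals along it is a measurable version of the Banach-Mazur embedding into
   C_cantor; it is isometric by the Hahn-Banach theorem.  Pairing the resulting map into the
   Effros space with a Borel injection of the base into [0,1] gives universality. *)

theory Submission
  imports Defs "HOL-Computational_Algebra.Polynomial"
begin

section \<open>Standard Borel spaces as Borel retracts\<close>

text \<open>A Borel field gives access to its fibres only through the sections, the operations and
  the norm. All of this is condensed into seminorms on one fixed space: over a base point y, a
  polynomial is sent to the norm of the linear combination of the sections at y with its
  coefficients. These are seminorms and not norms, because the sections may be linearly dependent at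
  y; for each polynomial they are Borel in y. The Banach-Mazur theorem needs, for each y, a
  continuous map of the Cantor set onto the dual ball, and an arbitrary choice of such maps need not
  be Borel in y. Here the points of a single Cantor set denote candidate functionals for all y at
  once, and only the closed set of those that respect the seminorm varies with y. Whether a finite
  word extends to a point of this set is, by compactness, a Borel condition on y, and the retraction
  is computed from the answers to these questions alone.\<close>

lemma space_borel_of: "space (borel_of T) = topspace T"
  unfolding borel_of_def by (intro space_measure_of) (auto dest: openin_subset)

lemma sets_borel_of: "sets (borel_of T) = sigma_sets (topspace T) {U. openin T U}"
  unfolding borel_of_def by (intro sets_measure_of) (auto dest: openin_subset)

lemma borel_of_euclidean: "borel_of euclidean = borel"
  by (simp add: borel_of_def borel_def)

text \<open>Both sides refer to the same \<sigma>-algebra, since \<open>bool\<close> is discrete;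
  the coordinates of points of \<open>cantor\<close> thereby fall under the automation for
  predicates.\<close>

lemma borel_measurable_bool_iff [simp]:
  "(f :: 'a \<Rightarrow> bool) \<in> borel_measurable M \<longleftrightarrow> Measurable.pred M f"
proof -
  have "sets (borel :: bool measure) = sets (count_space UNIV)"
    by (auto simp: borel_def intro!: sigma_sets.Basic open_discrete)
  then have "borel_measurable M = (M \<rightarrow>\<^sub>M count_space (UNIV :: bool set))"
    by (intro measurable_cong_sets) auto
  then show ?thesis by simp
qed

text \<open>The Borel sets of a countable power of a second countable space are generated by the
  coordinates, so that maps into \<open>cantor\<close> can be checked for measurability coordinate
  by coordinate.\<close>

instance bool :: second_countable_topology
proof
  have "countable (Collect open :: bool set set)" by (rule countable_finite) simp
  moreover have "open = generate_topology (Collect open :: bool set set)"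
    by (auto simp: fun_eq_iff open_discrete intro: generate_topology.Basis)
  ultimately show "\<exists>B :: bool set set. countable B \<and> open = generate_topology B" by blast
qed

definition borel_retract :: "'a measure \<Rightarrow> 'b measure \<Rightarrow> bool" where
  "borel_retract M N \<longleftrightarrow> (\<exists>f\<in>M \<rightarrow>\<^sub>M N. \<exists>g\<in>N \<rightarrow>\<^sub>M M. \<forall>x\<in>space M. g (f x) = x)"

lemma borel_retractI:
  "\<lbrakk>f \<in> M \<rightarrow>\<^sub>M N; g \<in> N \<rightarrow>\<^sub>M M; \<And>x. x \<in> space M \<Longrightarrow> g (f x) = x\<rbrakk> \<Longrightarrow> borel_retract M N"
  unfolding borel_retract_def by blast

lemma borel_retract_trans:
  assumes "borel_retract L M" "borel_retract M N"
  shows "borel_retract L N"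
proof -
  obtain f g where fg: "f \<in> L \<rightarrow>\<^sub>M M" "g \<in> M \<rightarrow>\<^sub>M L" "\<forall>x\<in>space L. g (f x) = x"
    using assms(1) unfolding borel_retract_def by blast
  obtain h k where hk: "h \<in> M \<rightarrow>\<^sub>M N" "k \<in> N \<rightarrow>\<^sub>M M" "\<forall>x\<in>space M. k (h x) = x"
    using assms(2) unfolding borel_retract_def by blast
  show ?thesis
    by (rule borel_retractI[of "h \<circ> f" _ _ "g \<circ> k"])
       (use fg hk in \<open>auto intro: measurable_comp dest: measurable_space\<close>)
qed

lemma borel_retract_pair:
  assumes "borel_retract M M'" "borel_retract N N'"
  shows "borel_retract (M \<Otimes>\<^sub>M N) (M' \<Otimes>\<^sub>M N')"
proof -
  obtain f g where fg[measurable]: "f \<in> M \<rightarrow>\<^sub>M M'" "g \<in> M' \<rightarrow>\<^sub>M M" and 1: "\<forall>x\<in>space M. g (f x) = x"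
    using assms(1) unfolding borel_retract_def by blast
  obtain h k where hk[measurable]: "h \<in> N \<rightarrow>\<^sub>M N'" "k \<in> N' \<rightarrow>\<^sub>M N" and 2: "\<forall>x\<in>space N. k (h x) = x"
    using assms(2) unfolding borel_retract_def by blast
  show ?thesis
    by (rule borel_retractI[of "\<lambda>z. (f (fst z), h (snd z))" _ _ "\<lambda>z. (g (fst z), k (snd z))"])
       (use 1 2 in \<open>auto simp: space_pair_measure\<close>)
qed

text \<open>Points outside \<open>A\<close> are retracted to one fixed point of \<open>A\<close>,
  whence the assumption that there is one.\<close>

lemma borel_retract_restrict_space:
  assumes A: "A \<inter> space M \<in> sets M" and "A \<inter> space M \<noteq> {}"
  shows "borel_retract (restrict_space M A) M"
proof -
  obtain a where a: "a \<in> A" "a \<in> space M" using \<open>A \<inter> space M \<noteq> {}\<close> by blast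
  have "(\<lambda>x. if x \<in> A then x else a) \<in> M \<rightarrow>\<^sub>M M"
    using A a by (intro measurable_If_set) auto
  then have "(\<lambda>x. if x \<in> A then x else a) \<in> M \<rightarrow>\<^sub>M restrict_space M A"
    using a by (auto intro!: measurable_restrict_space2)
  then show ?thesis
    by (rule borel_retractI[of "\<lambda>x. x", rotated])
       (auto simp: space_restrict_space intro: measurable_restrict_space1)
qed

text \<open>A Borel injection whose image is Borel has a Borel inverse as soon as it separates a
  generating family; the Lusin-Souslin theorem is thereby avoided.\<close>

lemma borel_retract_generatorI:
  assumes M: "sets M = sigma_sets (space M) G" "G \<subseteq> Pow (space M)" "space M \<noteq> {}"
    and f: "f \<in> M \<rightarrow>\<^sub>M N" "inj_on f (space M)" "f ` space M \<in> sets N"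
    and G: "\<And>A. A \<in> G \<Longrightarrow> \<exists>B\<in>sets N. A = f -` B \<inter> space M"
  shows "borel_retract M N"
proof -
  obtain a where a: "a \<in> space M" using M(3) by blast
  define g where "g y = (if y \<in> f ` space M then the_inv_into (space M) f y else a)" for y
  have gf: "g (f x) = x" if "x \<in> space M" for x
    using that f(2) by (simp add: g_def the_inv_into_f_f)
  have "g \<in> N \<rightarrow>\<^sub>M M"
  proof (rule measurable_sigma_sets[OF M(1,2)])
    show "g \<in> space N \<rightarrow> space M"
      using a gf by (auto simp: g_def the_inv_into_f_f f(2))
    fix A assume "A \<in> G"
    then obtain B where B: "B \<in> sets N" "A = f -` B \<inter> space M" using G by blast
    have sub: "f ` space M \<subseteq> space N" using f(1) by (auto dest: measurable_space)
    \<comment> \<open>Off the image of \<open>f\<close> the map \<open>g\<close> is constantly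
      \<open>a\<close>, so the complement of the image belongs to the preimage of \<open>A\<close>
      or not according to whether \<open>a\<close> lies in \<open>A\<close>.\<close>
    have "g -` A \<inter> space N = (B \<inter> f ` space M) \<union> (if a \<in> A then space N - f ` space M else {})"
      using sub B gf by (auto simp: g_def split: if_splits)
    then show "g -` A \<inter> space N \<in> sets N"
      using B f(3) by auto
  qed
  then show ?thesis using f(1) gf by (intro borel_retractI) auto
qed

section \<open>Coding sequences of reals in the Cantor set and in the real line\<close>

lemma real_as_supremum_of_rationals:
  "(SUP n::nat. if x < real_of_rat (from_nat n) then - \<infinity> else ereal (real_of_rat (from_nat n))) = ereal x"
proof (rule antisym)
  show "(SUP n::nat. if x < real_of_rat (from_nat n) then - \<infinity> else ereal (real_of_rat (from_nat n))) \<le> ereal x"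
    by (intro SUP_least) auto
  show "ereal x \<le> (SUP n::nat. if x < real_of_rat (from_nat n) then - \<infinity> else ereal (real_of_rat (from_nat n)))"
  proof (rule dense_le)
    fix z assume "z < ereal x"
    then obtain y where "z < ereal y" "y < x"
      by (metis ereal_dense2 less_ereal.simps(1))
    then obtain r where "y < real_of_rat r" "real_of_rat r < x" using of_rat_dense by blast
    then have "z \<le> (if x < real_of_rat (from_nat (to_nat r)) then - \<infinity> else ereal (real_of_rat (from_nat (to_nat r))))"
      using \<open>z < ereal y\<close> less_imp_le[OF order.strict_trans[of z "ereal y" "ereal (real_of_rat r)"]]
      by auto
    then show "z \<le> (SUP n::nat. if x < real_of_rat (from_nat n) then - \<infinity> else ereal (real_of_rat (from_nat n)))"
      by (rule SUP_upper2[OF UNIV_I])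
  qed
qed

text \<open>The bits of a sequence answer all questions \<open>s i < q\<close> with rational q.
  Decoding is a countable supremum in the extended reals, hence defined and Borel at every point of
  \<open>cantor\<close>, even if its bits do not form Dedekind cuts.\<close>

lemma borel_retract_real_sequences_cantor:
  "borel_retract (borel :: (nat \<Rightarrow> real) measure) (borel :: cantor measure)"
proof -
  let ?q = "\<lambda>n::nat. real_of_rat (from_nat n)"
  let ?f = "\<lambda>s k. s (fst (prod_decode k)) < ?q (snd (prod_decode k))"
  let ?g = "\<lambda>b i. real_of_ereal (SUP n::nat. if b (prod_encode (i, n)) then - \<infinity> else ereal (?q n))"
  show ?thesis
  proof (rule borel_retractI[of ?f _ _ ?g])
    show "?f \<in> borel \<rightarrow>\<^sub>M borel"
      by (intro measurable_coordinatewise_then_product) simp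
    have [measurable]: "Measurable.pred borel (\<lambda>b :: cantor. b n)" for n
      unfolding borel_measurable_bool_iff[symmetric] by (rule measurable_product_coordinates)
    show "?g \<in> borel \<rightarrow>\<^sub>M borel"
      by (intro measurable_coordinatewise_then_product) measurable
    show "?g (?f s) = s" for s :: "nat \<Rightarrow> real"
      by (simp only: prod_encode_inverse fst_conv snd_conv real_as_supremum_of_rationals real_of_ereal.simps)
  qed
qed

text \<open>The middle-thirds set is compact, so the inverse of the homeomorphism remains Borel when
  it is extended by a constant to the whole line.\<close>

lemma borel_retract_cantor_real: "borel_retract (borel :: cantor measure) (borel :: real measure)"
proof -
  obtain C :: "real set" where C: "(UNIV :: cantor set) homeomorphic C"
    using cantor_homeomorphic by blast
  then obtain f g where fg: "homeomorphism UNIV C f (g :: real \<Rightarrow> cantor)"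
    unfolding homeomorphic_def by blast
  then have cont: "continuous_on UNIV f" "continuous_on C g" "\<And>b. g (f b) = b"
    by (auto simp: homeomorphism_def)
  have "compact C" using C compact_UNIV_cantor homeomorphic_compactness by blast
  then have "closed C" by (rule compact_imp_closed)
  then have C': "C \<in> sets borel" by simp
  have "(\<lambda>x. if x \<in> C then g x else (\<lambda>_. False)) \<in> borel_measurable borel"
    by (rule borel_measurable_continuous_on_if) (use C' cont in auto)
  moreover have "f b \<in> C" for b using fg by (auto simp: homeomorphism_def)
  ultimately show ?thesis
    using cont by (intro borel_retractI[of f]) (auto intro: borel_measurable_continuous_onI)
qed

lemma borel_retract_real_sequences:
  "borel_retract (borel :: (nat \<Rightarrow> real) measure) (borel :: real measure)"
  using borel_retract_real_sequences_cantor borel_retract_cantor_real by (rule borel_retract_trans)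

text \<open>A point of a Polish space is coded by its distances to a dense sequence.  The sequences of
  reals arising in this way are cut out by countably many inequalities.\<close>

lemma borel_retract_polish:
  fixes P :: "'a topology"
  assumes P: "completely_metrizable_space P" "second_countable P" "topspace P \<noteq> {}"
  shows "borel_retract (borel_of P) (borel :: (nat \<Rightarrow> real) measure)"
proof -
  obtain S d where "Metric_space S d" and mc: "Metric_space.mcomplete S d"
    and PS: "P = Metric_space.mtopology S d"
    using P(1) unfolding completely_metrizable_space_def by blast
  interpret Metric_space S d by fact
  have top: "topspace P = S" by (simp add: PS)
  obtain \<B> where \<B>: "countable \<B>" "\<forall>V\<in>\<B>. openin P V"
    "\<forall>U x. openin P U \<and> x \<in> U \<longrightarrow> (\<exists>V\<in>\<B>. x \<in> V \<and> V \<subseteq> U)"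
    using P(2) unfolding second_countable_def by blast
  define D where "D = (\<lambda>V. SOME a. a \<in> V) ` (\<B> - {{}})"
  have V_in: "(SOME a. a \<in> V) \<in> V" if "V \<in> \<B> - {{}}" for V
    using that by (auto intro: someI_ex)
  then have DS: "D \<subseteq> S"
    using \<B>(2) openin_subset top by (auto simp: D_def) blast
  have "countable D" using \<B>(1) by (simp add: D_def)
  have Ddense: "\<exists>a\<in>D. d x a < e" if x: "x \<in> S" and e: "0 < e" for x e
  proof -
    have "openin P (mball x e)" "x \<in> mball x e" using x e by (auto simp: PS)
    then obtain V where V: "V \<in> \<B>" "x \<in> V" "V \<subseteq> mball x e" using \<B>(3) by metis
    then have "(SOME a. a \<in> V) \<in> mball x e" "(SOME a. a \<in> V) \<in> D"
      using V_in[of V] by (auto simp: D_def simp del: in_mball)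
    then show ?thesis by auto
  qed
  have "D \<noteq> {}" using Ddense[of _ 1] P(3) top by fastforce
  define x where "x = from_nat_into D"
  have x: "range x = D"
    unfolding x_def using \<open>D \<noteq> {}\<close> \<open>countable D\<close> by (rule range_from_nat_into)
  have xS: "x n \<in> S" for n using DS x by blast
  have dense: "\<exists>n. d u (x n) < e" if "u \<in> S" "0 < e" for u e
    using Ddense[OF that] unfolding x[symmetric] by blast
  define f where "f u n = d u (x n)" for u n
  have ball_vimage: "mball (x n) r = f -` {s. s n < r} \<inter> S" for n r
    using xS by (auto simp: f_def commute)
  have seq_sets: "{s :: nat \<Rightarrow> real. s n < r} \<in> sets borel" for n r
    by measurable
  have open_rep: "U = (\<Union>(n, k) \<in> {(n, k). mball (x n) (1 / Suc k) \<subseteq> U}. mball (x n) (1 / Suc k))"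
    if U: "openin P U" for U
  proof (rule subset_antisym; rule subsetI)
    fix u assume u: "u \<in> U"
    then obtain r where r: "0 < r" "mball u r \<subseteq> U" using U by (auto simp: PS openin_mtopology)
    have uS: "u \<in> S" using u U openin_subset top by blast
    obtain k where k: "1 / Suc k < r / 2" using r(1) nat_approx_posE[of "r/2"] by auto
    obtain n where n: "d u (x n) < 1 / Suc k" using dense[OF uS, of "1 / Suc k"] by auto
    have "mball (x n) (1 / Suc k) \<subseteq> mball u r"
    proof
      fix v assume "v \<in> mball (x n) (1 / Suc k)"
      then show "v \<in> mball u r"
        using triangle[of u "x n" v] n k uS xS by auto
    qed
    moreover have "u \<in> mball (x n) (1 / Suc k)" using n uS xS by (simp add: commute)
    ultimately show "u \<in> (\<Union>(n, k) \<in> {(n, k). mball (x n) (1 / Suc k) \<subseteq> U}. mball (x n) (1 / Suc k))"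
      using r(2) by blast
  qed auto
  have f_meas: "f \<in> borel_of P \<rightarrow>\<^sub>M borel"
  proof (rule measurable_coordinatewise_then_product, rule borel_measurableI_less)
    fix n r
    have "{u \<in> space (borel_of P). f u n < r} = mball (x n) r"
      by (subst ball_vimage) (auto simp: space_borel_of top)
    moreover have "openin P (mball (x n) r)" by (simp add: PS)
    ultimately show "{u \<in> space (borel_of P). f u n < r} \<in> sets (borel_of P)"
      by (simp add: sets_borel_of sigma_sets.Basic)
  qed
  \<comment> \<open>The inequalities are those satisfied by the distances of the \<open>x n\<close>
    from a point in some metric extension of the sequence; the last condition puts that point into
    the closure and so, by completeness, into the space itself.\<close>
  define I where "I = {s :: nat \<Rightarrow> real. (\<forall>n m. \<bar>s n - s m\<bar> \<le> d (x n) (x m) \<and> d (x n) (x m) \<le> s n + s m)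
      \<and> (\<forall>k. \<exists>n. s n < 1 / Suc k)}"
  have image: "f ` S = I"
  proof (rule subset_antisym; rule subsetI)
    fix s assume "s \<in> f ` S"
    then obtain u where u: "u \<in> S" "s = f u" by blast
    have "\<bar>d u (x n) - d u (x m)\<bar> \<le> d (x n) (x m)" for n m
      using triangle[of u "x n" "x m"] triangle[of u "x m" "x n"] u xS by (simp add: commute abs_le_iff)
    moreover have "d (x n) (x m) \<le> d u (x n) + d u (x m)" for n m
      using triangle[of "x n" u "x m"] u xS by (simp add: commute)
    ultimately show "s \<in> I" using u dense[of u] by (simp add: I_def f_def)
  next
    fix s assume s: "s \<in> I"
    then have s1: "\<bar>s n - s m\<bar> \<le> d (x n) (x m)" "d (x n) (x m) \<le> s n + s m" for n m
      by (auto simp: I_def)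
    have "\<forall>k. \<exists>n. s n < 1 / Suc k" using s by (auto simp: I_def)
    then obtain j where j: "s (j k) < 1 / Suc k" for k by metis
    have s0: "0 \<le> s n" for n using s1(2)[of n n] nonneg[of "x n" "x n"] by linarith
    have j0: "(\<lambda>k. s (j k)) \<longlonglongrightarrow> 0"
      by (rule tendsto_sandwich[OF _ _ tendsto_const LIMSEQ_Suc[OF lim_1_over_n]])
         (use j s0 in \<open>auto intro!: always_eventually less_imp_le\<close>)
    have "MCauchy (\<lambda>k. x (j k))"
      unfolding MCauchy_def
    proof (intro conjI allI impI)
      fix e :: real assume "0 < e"
      then obtain N where N: "\<And>k. k \<ge> N \<Longrightarrow> s (j k) < e / 2"
        using order_tendstoD(2)[OF j0, of "e/2"] by (auto simp: eventually_sequentially)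
      then show "\<exists>N. \<forall>n n'. N \<le> n \<longrightarrow> N \<le> n' \<longrightarrow> d (x (j n)) (x (j n')) < e"
        by (intro exI[of _ N] allI impI) (smt (verit) s1(2) field_sum_of_halves)
    qed (use xS in auto)
    then obtain u where "limitin mtopology (\<lambda>k. x (j k)) u sequentially"
      using mc unfolding mcomplete_def by blast
    then have u: "u \<in> S" "(\<lambda>k. d (x (j k)) u) \<longlonglongrightarrow> 0" by (auto simp: limitin_metric_dist_null)
    have "f u n = s n" for n
    proof -
      \<comment> \<open>\<open>s n\<close> differs from the distance between \<open>x n\<close> and
        \<open>x (j k)\<close> by at most \<open>s (j k)\<close>, and replacing
        \<open>x (j k)\<close> by \<open>u\<close> costs their distance; both errors vanish in the
        limit.\<close>
      have "\<bar>d u (x n) - s n\<bar> \<le> 2 * s (j k) + d (x (j k)) u" for k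
        using s1[of n "j k"] triangle[of u "x (j k)" "x n"] triangle[of "x n" u "x (j k)"] u(1) xS
        by (simp add: commute abs_le_iff)
      moreover have "(\<lambda>k. 2 * s (j k) + d (x (j k)) u) \<longlonglongrightarrow> 2 * 0 + 0"
        by (intro tendsto_intros j0 u(2))
      ultimately have "\<bar>d u (x n) - s n\<bar> \<le> 2 * 0 + 0"
        by (intro LIMSEQ_le_const[of _ "2 * 0 + 0"]) auto
      then show ?thesis by (simp add: f_def)
    qed
    then have "f u = s" by (rule ext)
    then show "s \<in> f ` S" using u(1) by blast
  qed
  show ?thesis
  proof (rule borel_retract_generatorI[where f = f])
    show "sets (borel_of P) = sigma_sets (space (borel_of P)) {U. openin P U}"
      by (simp add: sets_borel_of space_borel_of)
    show "{U. openin P U} \<subseteq> Pow (space (borel_of P))"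
      by (auto simp: space_borel_of dest: openin_subset)
    show "space (borel_of P) \<noteq> {}" using P(3) by (simp add: space_borel_of)
    show "inj_on f (space (borel_of P))"
    proof (rule inj_onI)
      fix u v assume uv: "u \<in> space (borel_of P)" "v \<in> space (borel_of P)" "f u = f v"
      then have "u \<in> S" "v \<in> S" by (auto simp: space_borel_of top)
      have "d u v < e" if e: "0 < e" for e
      proof -
        obtain n where "d u (x n) < e / 2" using dense[OF \<open>u \<in> S\<close>, of "e/2"] e by auto
        moreover have "d v (x n) = d u (x n)" using uv(3) by (metis f_def)
        ultimately show ?thesis
          using triangle[of u "x n" v] \<open>u \<in> S\<close> \<open>v \<in> S\<close> xS by (simp add: commute)
      qed
      then have "d u v \<le> 0"
        by (meson leI less_irrefl)
      then have "d u v = 0" using nonneg[of u v] by simp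
      then show "u = v" using \<open>u \<in> S\<close> \<open>v \<in> S\<close> by simp
    qed
    have "I \<in> sets borel"
      unfolding I_def by measurable
    then show "f ` space (borel_of P) \<in> sets borel"
      by (simp add: space_borel_of top image)
    fix U assume "U \<in> {U. openin P U}"
    then have U: "openin P U" by simp
    \<comment> \<open>The representation \<open>open_rep\<close> carried over to codes: a ball
      around \<open>x n\<close> corresponds to a bound on the n-th coordinate.\<close>
    let ?B = "\<Union>(n, k) \<in> {(n, k). mball (x n) (1 / Suc k) \<subseteq> U}. {s :: nat \<Rightarrow> real. s n < 1 / Suc k}"
    have "?B \<in> sets borel"
      using seq_sets by (intro sets.countable_UN'') (auto)
    moreover have "U = f -` ?B \<inter> space (borel_of P)"
      by (subst open_rep[OF U]) (auto simp: ball_vimage space_borel_of top)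
    ultimately show "\<exists>B\<in>sets borel. U = f -` B \<inter> space (borel_of P)" by blast
  qed (rule f_meas)
qed

lemma second_countable_euclidean: "second_countable (euclidean :: 'a::second_countable_topology topology)"
proof -
  obtain B :: "'a set set" where B: "countable B" "topological_basis B"
    using ex_countable_basis by blast
  show ?thesis
    unfolding second_countable_def
  proof (intro exI[of _ B] conjI ballI allI impI)
    show "openin euclidean V" if "V \<in> B" for V using topological_basis_open[OF B(2) that] by simp
    show "\<exists>V\<in>B. x \<in> V \<and> V \<subseteq> U" if "openin euclidean U \<and> x \<in> U" for U x
    proof -
      have "open U" "x \<in> U" using that by auto
      then obtain V where "V \<in> B" "x \<in> V" "V \<subseteq> U" by (rule topological_basisE[OF B(2)])
      then show ?thesis by blast
    qed
  qed (rule B(1))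
qed

text \<open>Forwards, a Polish space is passed through sequences of reals to the real line;
  backwards, the real line is itself the required Polish space. The empty space is listed separately
  because there is no map from the reals into it.\<close>

lemma standard_borel_iff_retract:
  "standard_borel M \<longleftrightarrow> space M = {} \<or> borel_retract M (borel :: real measure)"
proof
  assume "standard_borel M"
  then obtain P :: "real topology" and B f g where
    P: "completely_metrizable_space P" "second_countable P" "B \<in> sets (borel_of P)"
    and f: "f \<in> M \<rightarrow>\<^sub>M restrict_space (borel_of P) B"
    and g: "g \<in> restrict_space (borel_of P) B \<rightarrow>\<^sub>M M" and gf: "\<forall>x\<in>space M. g (f x) = x"
    unfolding standard_borel_def by blast
  show "space M = {} \<or> borel_retract M (borel :: real measure)"
  proof (cases "space M = {}")
    case False
    then obtain a where "a \<in> space M" by blast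
    then have "f a \<in> B \<inter> space (borel_of P)" using measurable_space[OF f] by (auto simp: space_restrict_space)
    then have "B \<inter> space (borel_of P) \<noteq> {}" "topspace P \<noteq> {}"
      by (auto simp: space_borel_of)
    have "borel_retract M (restrict_space (borel_of P) B)"
      using f g gf by (intro borel_retractI) auto
    moreover have "borel_retract (restrict_space (borel_of P) B) (borel_of P)"
      using \<open>B \<inter> space (borel_of P) \<noteq> {}\<close> P(3) by (intro borel_retract_restrict_space) auto
    ultimately have "borel_retract M (borel_of P)" by (rule borel_retract_trans)
    then have "borel_retract M (borel :: (nat \<Rightarrow> real) measure)"
      using borel_retract_polish[OF P(1,2) \<open>topspace P \<noteq> {}\<close>] by (rule borel_retract_trans)
    then have "borel_retract M (borel :: real measure)"
      using borel_retract_real_sequences by (rule borel_retract_trans)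
    then show ?thesis ..
  qed simp
next
  have P: "completely_metrizable_space (euclidean :: real topology)" "second_countable (euclidean :: real topology)"
    by (simp_all add: completely_metrizable_space_euclidean second_countable_euclidean)
  assume "space M = {} \<or> borel_retract M (borel :: real measure)"
  then show "standard_borel M"
  proof
    assume "space M = {}"
    then show ?thesis
      unfolding standard_borel_def
      by (intro exI[of _ "euclidean"] exI[of _ "{}"] exI[of _ undefined] conjI P)
         (auto simp: measurable_def space_restrict_space)
  next
    assume "borel_retract M (borel :: real measure)"
    then obtain f :: "'a \<Rightarrow> real" and g
      where fg: "f \<in> M \<rightarrow>\<^sub>M borel" "g \<in> borel \<rightarrow>\<^sub>M M" "\<forall>x\<in>space M. g (f x) = x"
      unfolding borel_retract_def by (elim bexE)
    note [measurable] = fg(1,2)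
    define B where "B = {y :: real. f (g y) = y}"
    have "B \<in> sets borel" unfolding B_def by measurable
    moreover have "f \<in> M \<rightarrow>\<^sub>M restrict_space borel B"
      using fg by (intro measurable_restrict_space2) (auto simp: B_def)
    ultimately show ?thesis
      unfolding standard_borel_def
      by (intro exI[of _ "euclidean"] exI[of _ B] exI[of _ f] exI[of _ g] conjI P)
         (use fg in \<open>auto simp: borel_of_euclidean B_def space_restrict_space intro: measurable_restrict_space1\<close>)
  qed
qed

lemma standard_borel_pair:
  assumes "standard_borel M" "standard_borel N"
  shows "standard_borel (M \<Otimes>\<^sub>M N)"
proof -
  have "borel_retract ((borel :: real measure) \<Otimes>\<^sub>M (borel :: real measure)) (borel :: (nat \<Rightarrow> real) measure)"
  proof (rule borel_retractI)
    show "(\<lambda>z n. if n = (0::nat) then fst z else snd z) \<in> (borel :: real measure) \<Otimes>\<^sub>M (borel :: real measure) \<rightarrow>\<^sub>M borel"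
      by (intro measurable_coordinatewise_then_product) simp
    show "(\<lambda>s. (s 0, s 1)) \<in> (borel :: (nat \<Rightarrow> real) measure) \<rightarrow>\<^sub>M borel \<Otimes>\<^sub>M borel"
      by simp
  qed simp
  then have "borel_retract ((borel :: real measure) \<Otimes>\<^sub>M (borel :: real measure)) (borel :: real measure)"
    using borel_retract_real_sequences by (rule borel_retract_trans)
  then show ?thesis
    using assms borel_retract_pair[of M "borel :: real measure" N "borel :: real measure"]
      borel_retract_trans[of "M \<Otimes>\<^sub>M N" "(borel :: real measure) \<Otimes>\<^sub>M (borel :: real measure)" "borel :: real measure"]
    by (auto simp: standard_borel_iff_retract space_pair_measure)
qed

lemma standard_borel_retract:
  assumes MN: "borel_retract M N" and N: "standard_borel N"
  shows "standard_borel M"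
proof -
  have "space N = {} \<longrightarrow> space M = {}"
    using MN by (auto simp: borel_retract_def measurable_empty_iff)
  then show "standard_borel M"
    using borel_retract_trans[OF MN] N by (auto simp: standard_borel_iff_retract)
qed

lemma standard_borel_restrict_space:
  assumes "standard_borel M" "A \<inter> space M \<in> sets M"
  shows "standard_borel (restrict_space M A)"
proof (cases "A \<inter> space M = {}")
  case True
  then show ?thesis by (simp add: standard_borel_iff_retract space_restrict_space)
next
  case False
  then show ?thesis
    using assms borel_retract_restrict_space standard_borel_retract by blast
qed

lemma standard_borel_real_sequences: "standard_borel (borel :: (nat \<Rightarrow> real) measure)"
  by (simp add: standard_borel_iff_retract borel_retract_real_sequences)

lemma standard_borel_real: "standard_borel (borel :: real measure)"
  using borel_retractI[of "\<lambda>x. x" "borel :: real measure" borel "\<lambda>x. x"]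
  by (simp add: standard_borel_iff_retract)

lemma sets_retract_image:
  assumes N: "standard_borel N"
    and f: "f \<in> M \<rightarrow>\<^sub>M N" and g: "g \<in> N \<rightarrow>\<^sub>M M" and gf: "\<And>x. x \<in> space M \<Longrightarrow> g (f x) = x"
  shows "f ` space M \<in> sets N"
proof (cases "space N = {}")
  case True
  then have "f ` space M = {}" using f by (auto dest: measurable_space)
  then show ?thesis by simp
next
  case False
  then obtain e e' where e: "e \<in> N \<rightarrow>\<^sub>M (borel :: real measure)" "\<forall>x\<in>space N. e' (e x) = x"
    using N unfolding standard_borel_iff_retract borel_retract_def by blast
  note [measurable] = f g e(1)
  \<comment> \<open>Equality need not be testable in an abstract measurable space, so both sides are
    compared through the Borel injection \<open>e\<close> into the reals.\<close>
  have "f ` space M = {y \<in> space N. e (f (g y)) = e y}"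
    using gf e(2) measurable_space[OF f] measurable_space[OF g] by (auto simp: image_iff) metis
  also have "\<dots> \<in> sets N" by measurable
  finally show ?thesis .
qed

section \<open>Continuous functions on the Cantor set\<close>

lemma open_cylinder: "open {c :: cantor. \<forall>i<m. c i = b i}"
proof -
  have "open {c :: cantor. c i = b i}" for i
    using open_vimage[OF open_discrete[of "{b i}"] continuous_on_product_coordinates[of i]]
    by (simp add: vimage_def)
  then have "open (\<Inter>i\<in>{..<m}. {c :: cantor. c i = b i})" by (intro open_INT) auto
  also have "(\<Inter>i\<in>{..<m}. {c. c i = b i}) = {c :: cantor. \<forall>i<m. c i = b i}" by auto
  finally show ?thesis .
qed

lemma cylinder_basis:
  assumes "open U" "(b :: cantor) \<in> U"
  obtains m where "{c. \<forall>i<m. c i = b i} \<subseteq> U"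
proof -
  have "openin (product_topology (\<lambda>_::nat. euclidean :: bool topology) UNIV) U"
    using assms(1) by (simp add: euclidean_product_topology)
  then obtain X where X: "b \<in> (\<Pi>\<^sub>E i\<in>UNIV. X i)" "finite {i. X i \<noteq> topspace (euclidean :: bool topology)}"
    "(\<Pi>\<^sub>E i\<in>UNIV. X i) \<subseteq> U"
    using product_topology_open_contains_basis[OF _ assms(2)] by meson
  have "finite {i. X i \<noteq> UNIV}" using X(2) by simp
  then obtain m where "{i. X i \<noteq> UNIV} \<subseteq> {..<m}"
    using finite_nat_iff_bounded by blast
  then have m: "X i = UNIV" if "\<not> i < m" for i using that by auto
  have "c \<in> (\<Pi>\<^sub>E i\<in>UNIV. X i)" if "\<forall>i<m. c i = b i" for c
  proof (intro PiE_I)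
    show "c i \<in> X i" for i
      using X(1) that m[of i] by (cases "i < m") (auto simp: PiE_iff)
  qed simp
  then have "{c. \<forall>i<m. c i = b i} \<subseteq> (\<Pi>\<^sub>E i\<in>UNIV. X i)" by (intro subsetI) simp
  then show ?thesis using X(3) by (intro that) (rule order_trans)
qed

lemma continuous_on_finite_dependence:
  assumes "\<And>b c. (\<forall>i<m. b i = c i) \<Longrightarrow> f b = f c"
  shows "continuous_on (UNIV :: cantor set) f"
  unfolding continuous_on_topological
proof (intro ballI allI impI)
  fix b B assume "f b \<in> B"
  then have "f y \<in> B" if "y \<in> {c. \<forall>i<m. c i = b i}" for y
    using assms[of y b] that by simp
  then show "\<exists>A. open A \<and> b \<in> A \<and> (\<forall>y\<in>UNIV. y \<in> A \<longrightarrow> f y \<in> B)"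
    by (intro exI[of _ "{c. \<forall>i<m. c i = b i}"] conjI open_cylinder) auto
qed

text \<open>Finitely many cylinders on which \<open>f\<close> stays within e/2 of its value at the
  centre cover the Cantor set; a common bound for their lengths serves as \<open>m\<close>.\<close>

lemma cantor_uniform_modulus:
  fixes f :: "cantor \<Rightarrow> 'a::metric_space"
  assumes f: "continuous_on UNIV f" and e: "0 < e"
  obtains m where "\<And>b c. (\<forall>i<m. b i = c i) \<Longrightarrow> dist (f b) (f c) < e"
proof -
  have "\<forall>b. \<exists>m. {c. \<forall>i<m. c i = b i} \<subseteq> {c. dist (f c) (f b) < e / 2}"
  proof
    fix b
    have "open {c. dist (f c) (f b) < e / 2}"
      using f by (intro open_Collect_less continuous_intros) auto
    moreover have "b \<in> {c. dist (f c) (f b) < e / 2}" using e by simp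
    ultimately show "\<exists>m. {c. \<forall>i<m. c i = b i} \<subseteq> {c. dist (f c) (f b) < e / 2}"
      by (rule cylinder_basis) (rule exI)
  qed
  from choice[OF this]
  obtain m where m: "\<And>b. {c. \<forall>i<m b. c i = b i} \<subseteq> {c. dist (f c) (f b) < e / 2}" by blast
  obtain D where D: "finite D" "UNIV \<subseteq> (\<Union>b\<in>D. {c :: cantor. \<forall>i<m b. c i = b i})"
  proof (rule compactE_image[OF compact_UNIV_cantor, of UNIV "\<lambda>b. {c. \<forall>i<m b. c i = b i}"])
    show "open {c. \<forall>i<m b. c i = b i}" for b by (rule open_cylinder)
    show "UNIV \<subseteq> (\<Union>b\<in>UNIV. {c :: cantor. \<forall>i<m b. c i = b i})" by auto
  qed
  obtain n where n: "\<And>b. b \<in> D \<Longrightarrow> m b \<le> n"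
    using finite_nat_set_iff_bounded_le[of "m ` D"] D(1) by auto
  have "dist (f b) (f c) < e" if bc: "\<forall>i<n. b i = c i" for b c
  proof -
    obtain d where d: "d \<in> D" "\<forall>i<m d. b i = d i" using D(2) by auto
    then have "\<forall>i<m d. c i = d i" using bc n[of d] by auto
    then have "b \<in> {c. \<forall>i<m d. c i = d i}" "c \<in> {c. \<forall>i<m d. c i = d i}" using d(2) by simp_all
    then have "dist (f b) (f d) < e / 2" "dist (f c) (f d) < e / 2" using m[of d] by blast+
    then show ?thesis by (rule dist_triangle_half_l)
  qed
  then show ?thesis using that by blast
qed

lemma cantor_Bcontfun_inverse:
  "continuous_on UNIV f \<Longrightarrow> apply_bcontfun (Bcontfun (f :: cantor \<Rightarrow> complex)) = f"
  using range_apply_bcontfun_cantor by (metis apply_bcontfun_inverse mem_Collect_eq rangeE)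

lemma C_cantor_simps [simp]:
  "carrier C_cantor = UNIV" "plus C_cantor = (+)" "zero C_cantor = 0" "nrm C_cantor = norm"
  by (simp_all add: C_cantor_def)

lemma norm_scale_C_cantor: "norm (scale C_cantor a u) = cmod a * norm u"
proof (rule order_antisym)
  have le: "norm (scale C_cantor a u) \<le> cmod a * norm u" for a u
    by (rule norm_bound)
       (simp add: apply_scale_C_cantor norm_mult mult_left_mono norm_bounded)
  show "norm (scale C_cantor a u) \<le> cmod a * norm u" by (rule le)
  show "cmod a * norm u \<le> norm (scale C_cantor a u)"
  proof (cases "a = 0")
    case False
    then have "scale C_cantor (inverse a) (scale C_cantor a u) = u"
      by (intro bcontfun_eqI) (simp add: apply_scale_C_cantor)
    then have "norm u \<le> cmod (inverse a) * norm (scale C_cantor a u)"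
      using le[of "inverse a" "scale C_cantor a u"] by simp
    then show ?thesis using False by (simp add: norm_inverse inverse_eq_divide norm_divide field_simps)
  qed simp
qed

lemma scale_C_cantor_minus_one: "scale C_cantor (- 1) u = - u"
  by (rule bcontfun_eqI) (simp add: apply_scale_C_cantor)

lemma scale_C_cantor_add_right: "scale C_cantor a (u + v) = scale C_cantor a u + scale C_cantor a v"
  by (rule bcontfun_eqI) (simp add: apply_scale_C_cantor algebra_simps)

lemma scale_C_cantor_diff_right: "scale C_cantor a (u - v) = scale C_cantor a u - scale C_cantor a v"
  by (rule bcontfun_eqI) (simp add: apply_scale_C_cantor algebra_simps)

lemma scale_C_cantor_add_left: "scale C_cantor (a + b) u = scale C_cantor a u + scale C_cantor b u"
  by (rule bcontfun_eqI) (simp add: apply_scale_C_cantor algebra_simps)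

lemma scale_C_cantor_scale: "scale C_cantor a (scale C_cantor b u) = scale C_cantor (a * b) u"
  by (rule bcontfun_eqI) (simp add: apply_scale_C_cantor algebra_simps)

lemma scale_C_cantor_one: "scale C_cantor 1 u = u"
  by (rule bcontfun_eqI) (simp add: apply_scale_C_cantor)

lemma scale_C_cantor_zero: "scale C_cantor 0 u = 0"
  by (rule bcontfun_eqI) (simp add: apply_scale_C_cantor)

lemma norm_dist_C_cantor: "norm_dist C_cantor = dist"
  by (intro ext) (simp add: norm_dist_def scale_C_cantor_minus_one dist_norm)

lemma norm_topology_C_cantor: "norm_topology C_cantor = euclidean"
  by (simp add: norm_topology_def norm_dist_C_cantor)

lemma borel_of_C_cantor: "borel_of (norm_topology C_cantor) = borel"
  by (simp add: norm_topology_C_cantor borel_of_euclidean)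

lemma complete_C_cantor: "complete (UNIV :: (cantor \<Rightarrow>\<^sub>C complex) set)"
  unfolding complete_def
proof (intro allI impI)
  fix f :: "nat \<Rightarrow> cantor \<Rightarrow>\<^sub>C complex"
  assume "(\<forall>n. f n \<in> UNIV) \<and> Cauchy f"
  then have "Cauchy f" by simp
  then obtain g where "uniform_limit UNIV f g sequentially"
    using uniformly_convergent_eq_cauchy[of "\<lambda>_. True" f]
    unfolding Cauchy_def uniform_limit_sequentially_iff
    by (metis dist_fun_lt_imp_dist_val_lt)
  from uniform_limit_bcontfunE[OF this sequentially_bot]
  obtain l where "f \<longlonglongrightarrow> l" .
  then show "\<exists>l\<in>UNIV. f \<longlonglongrightarrow> l" by blast
qed

lemma complex_rational_approx:
  assumes "0 < e"
  obtains a b where "dist w (Complex (of_rat a) (of_rat b)) < e"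
proof -
  obtain p where p: "Re w - e / 2 < of_rat p" "of_rat p < Re w"
    using of_rat_dense[of "Re w - e / 2" "Re w"] assms by auto
  obtain q where q: "Im w - e / 2 < of_rat q" "of_rat q < Im w"
    using of_rat_dense[of "Im w - e / 2" "Im w"] assms by auto
  have "dist w (Complex (of_rat p) (of_rat q)) \<le> \<bar>Re w - of_rat p\<bar> + \<bar>Im w - of_rat q\<bar>"
    unfolding dist_norm using cmod_le[of "w - Complex (of_rat p) (of_rat q)"] by simp
  also have "\<dots> < e" using p q by linarith
  finally show ?thesis by (rule that)
qed

text \<open>Functions that depend on finitely many bits and take values with rational real and
  imaginary parts are uniformly dense. Each is described by a length and an association list from
  words to pairs of rationals, hence by an element of a countable type.\<close>

lemma C_cantor_separable:
  "\<exists>x :: nat \<Rightarrow> cantor \<Rightarrow>\<^sub>C complex. \<forall>u e. 0 < e \<longrightarrow> (\<exists>n. dist u (x n) < e)"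
proof -
  define val where "val L s = (case map_of L s of None \<Rightarrow> 0 | Some (p, q) \<Rightarrow> Complex (of_rat p) (of_rat q))"
    for L :: "(bool list \<times> rat \<times> rat) list" and s
  define h where "h z = Bcontfun (\<lambda>b :: cantor. val (snd z) (map b [0..<fst z]))" for z
  have cont: "continuous_on UNIV (\<lambda>b :: cantor. val (snd z) (map b [0..<fst z]))" for z
  proof (rule continuous_on_finite_dependence)
    fix b c :: cantor assume "\<forall>i<fst z. b i = c i"
    then have "map b [0..<fst z] = map c [0..<fst z]" by simp
    then show "val (snd z) (map b [0..<fst z]) = val (snd z) (map c [0..<fst z])" by (rule arg_cong)
  qed
  have h: "apply_bcontfun (h z) b = val (snd z) (map b [0..<fst z])" for z b
    by (simp add: h_def cantor_Bcontfun_inverse[OF cont])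
  have "\<exists>z. dist u (h z) < e" if e: "0 < e" for u e
  proof -
    obtain m where m: "\<And>b c. (\<forall>i<m. b i = c i) \<Longrightarrow> dist (apply_bcontfun u b) (apply_bcontfun u c) < e / 4"
      by (rule cantor_uniform_modulus[of "apply_bcontfun u" "e / 4"]) (use e in auto)
    have "\<exists>p q. dist w (Complex (of_rat p) (of_rat q)) < e / 4" for w
      using complex_rational_approx[of "e / 4" w] e by (metis divide_pos_pos zero_less_numeral)
    then obtain p q where pq: "dist w (Complex (of_rat (p w)) (of_rat (q w))) < e / 4" for w by metis
    have "finite {s :: bool list. length s = m}"
      using finite_lists_length_eq[of "UNIV :: bool set" m] by simp
    then obtain S where S: "set S = {s :: bool list. length s = m}" using finite_list by blast
    \<comment> \<open>The sample point of the cylinder of \<open>s\<close> is the word followed by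
      zeros. The modulus of continuity and the rational value cost e/4 each, which leaves room for a
      strict inequality.\<close>
    define ext where "ext s i = (i < m \<and> s ! i)" for s :: "bool list" and i
    define L where "L = map (\<lambda>s. (s, p (apply_bcontfun u (ext s)), q (apply_bcontfun u (ext s)))) S"
    have L: "map_of L s = Some (p (apply_bcontfun u (ext s)), q (apply_bcontfun u (ext s)))"
      if "length s = m" for s
      using that S by (simp add: L_def map_of_map_restrict restrict_map_def)
    have "dist u (h (m, L)) \<le> e / 4 + e / 4"
    proof (rule dist_bound)
      fix b :: cantor
      let ?s = "map b [0..<m]"
      have "dist (apply_bcontfun u b) (apply_bcontfun u (ext ?s)) < e / 4"
        by (rule m) (simp add: ext_def)
      moreover have "dist (apply_bcontfun u (ext ?s)) (apply_bcontfun (h (m, L)) b) < e / 4"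
        using pq by (simp add: h val_def L)
      ultimately show "dist (apply_bcontfun u b) (apply_bcontfun (h (m, L)) b) \<le> e / 4 + e / 4"
        using dist_triangle[of "apply_bcontfun u b" "apply_bcontfun (h (m, L)) b" "apply_bcontfun u (ext ?s)"]
        by linarith
    qed
    then show ?thesis using e by (intro exI[of _ "(m, L)"]) linarith
  qed
  then have "\<exists>n. dist u (h (from_nat n)) < e" if "0 < e" for u e using that by (metis from_nat_to_nat)
  then show ?thesis by (intro exI[of _ "\<lambda>n. h (from_nat n)"]) blast
qed

text \<open>The finitely supported points form a countable dense set, so the supremum may be taken
  over countably many evaluations; this is what makes distances measurable.\<close>

lemma dist_C_cantor_le_iff:
  fixes u v :: "cantor \<Rightarrow>\<^sub>C complex"
  shows "dist u v \<le> r \<longleftrightarrow> (\<forall>s. dist (apply_bcontfun u (\<lambda>i. i < length s \<and> s ! i))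
     (apply_bcontfun v (\<lambda>i. i < length s \<and> s ! i)) \<le> r)" (is "_ \<longleftrightarrow> (\<forall>s. ?D s \<le> r)")
proof
  assume "dist u v \<le> r"
  then show "\<forall>s. ?D s \<le> r" using dist_bounded[of u _ v] order_trans by blast
next
  assume *: "\<forall>s. ?D s \<le> r"
  show "dist u v \<le> r"
  proof (rule dist_bound)
    fix b
    have "dist (apply_bcontfun u b) (apply_bcontfun v b) \<le> r + e" if e: "0 < e" for e
    proof -
      have cont: "continuous_on UNIV (\<lambda>b. dist (apply_bcontfun u b) (apply_bcontfun v b))"
        by (intro continuous_intros) auto
      obtain m where m: "\<And>b c. (\<forall>i<m. b i = c i) \<Longrightarrow>
          dist (dist (apply_bcontfun u b) (apply_bcontfun v b)) (dist (apply_bcontfun u c) (apply_bcontfun v c)) < e"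
        using cantor_uniform_modulus[OF cont e] by blast
      let ?c = "\<lambda>i. i < length (map b [0..<m]) \<and> map b [0..<m] ! i"
      have "dist (dist (apply_bcontfun u b) (apply_bcontfun v b)) (dist (apply_bcontfun u ?c) (apply_bcontfun v ?c)) < e"
        by (rule m) simp
      moreover have "dist (apply_bcontfun u ?c) (apply_bcontfun v ?c) \<le> r" using * by blast
      ultimately show ?thesis unfolding dist_real_def by linarith
    qed
    then show "dist (apply_bcontfun u b) (apply_bcontfun v b) \<le> r" by (rule field_le_epsilon)
  qed
qed

section \<open>Separable complete metric spaces\<close>

locale complete_separable =
  fixes x :: "nat \<Rightarrow> 'a::metric_space"
  assumes dense: "0 < e \<Longrightarrow> \<exists>n. dist u (x n) < e"
    and complete: "complete (UNIV :: 'a set)"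
begin

lemma open_eq_Union_balls:
  assumes "open U"
  shows "U = (\<Union>z \<in> {z. ball (x (fst z)) (1 / real (Suc (snd z))) \<subseteq> U}. ball (x (fst z)) (1 / real (Suc (snd z))))"
proof (rule subset_antisym; rule subsetI)
  fix u assume u: "u \<in> U"
  then obtain r where r: "0 < r" "ball u r \<subseteq> U" using assms open_contains_ball by blast
  obtain k where k: "1 / real (Suc k) < r / 2" using r(1) nat_approx_posE[of "r/2"] by auto
  obtain n where n: "dist u (x n) < 1 / real (Suc k)" using dense[of "1 / real (Suc k)"] by auto
  have "ball (x n) (1 / real (Suc k)) \<subseteq> ball u r"
  proof
    fix v assume "v \<in> ball (x n) (1 / real (Suc k))"
    then show "v \<in> ball u r"
      using dist_triangle[of u v "x n"] n k by (simp del: of_nat_Suc)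
  qed
  moreover have "u \<in> ball (x n) (1 / real (Suc k))" using n by (simp add: dist_commute)
  ultimately show "u \<in> (\<Union>z \<in> {z. ball (x (fst z)) (1 / real (Suc (snd z))) \<subseteq> U}. ball (x (fst z)) (1 / real (Suc (snd z))))"
    using r(2) by (intro UN_I[of "(n, k)"]) auto
qed auto

lemma borel_measurable_iff_dist:
  "f \<in> borel_measurable M \<longleftrightarrow> (\<forall>n. (\<lambda>w. dist (f w) (x n)) \<in> borel_measurable M)"
proof
  assume "f \<in> borel_measurable M"
  moreover have "(\<lambda>u. dist u (x n)) \<in> borel_measurable borel" for n
    by (intro borel_measurable_continuous_onI continuous_intros)
  ultimately show "\<forall>n. (\<lambda>w. dist (f w) (x n)) \<in> borel_measurable M"
    using measurable_compose by blast
next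
  assume *: "\<forall>n. (\<lambda>w. dist (f w) (x n)) \<in> borel_measurable M"
  have ball: "f -` ball (x n) r \<inter> space M \<in> sets M" for n r
  proof -
    have "f -` ball (x n) r \<inter> space M = {w \<in> space M. dist (f w) (x n) < r}"
      by (auto simp: dist_commute)
    also have "\<dots> \<in> sets M" using *[rule_format, of n] by measurable
    finally show ?thesis .
  qed
  show "f \<in> borel_measurable M"
  proof (rule borel_measurableI)
    fix U :: "'a set" assume "open U"
    let ?I = "{z. ball (x (fst z)) (1 / real (Suc (snd z))) \<subseteq> U}"
    have "f -` U \<inter> space M = (\<Union>z\<in>?I. f -` ball (x (fst z)) (1 / real (Suc (snd z))) \<inter> space M)"
      by (subst open_eq_Union_balls[OF \<open>open U\<close>]) blast
    also have "\<dots> \<in> sets M" using ball by (intro sets.countable_UN'') auto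
    finally show "f -` U \<inter> space M \<in> sets M" .
  qed
qed

lemma second_countable: "second_countable (euclidean :: 'a topology)"
  unfolding second_countable_def
proof (intro exI conjI ballI allI impI)
  show "countable (range (\<lambda>z :: nat \<times> nat. ball (x (fst z)) (1 / real (Suc (snd z)))))" by simp
  fix V assume "V \<in> range (\<lambda>z :: nat \<times> nat. ball (x (fst z)) (1 / real (Suc (snd z))))"
  then show "openin euclidean V" by auto
next
  fix U u assume Uu: "openin euclidean U \<and> (u :: 'a) \<in> U"
  then have "open U" by simp
  from open_eq_Union_balls[OF this] Uu
  have "u \<in> (\<Union>z \<in> {z. ball (x (fst z)) (1 / real (Suc (snd z))) \<subseteq> U}. ball (x (fst z)) (1 / real (Suc (snd z))))"
    by blast
  then show "\<exists>V\<in>range (\<lambda>z :: nat \<times> nat. ball (x (fst z)) (1 / real (Suc (snd z)))). u \<in> V \<and> V \<subseteq> U"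
    by blast
qed

lemma standard_borel: "standard_borel (borel :: 'a measure)"
proof -
  have "completely_metrizable_space (euclidean :: 'a topology)"
    using Met_TC.completely_metrizable_space_mtopology complete by auto
  then have "borel_retract (borel_of euclidean :: 'a measure) (borel :: (nat \<Rightarrow> real) measure)"
    using second_countable by (rule borel_retract_polish) simp
  then show ?thesis
    unfolding borel_of_euclidean using standard_borel_real_sequences by (rule standard_borel_retract)
qed

text \<open>A sequence \<open>s\<close> of reals is to be thought of as the distances of the \<open>x n\<close> to a closed set.
  The greedy choice \<open>nearby s n p\<close> approaches that set starting from \<open>x n\<close>.\<close>

definition reachable :: "(nat \<Rightarrow> real) \<Rightarrow> bool" where
  "reachable s \<longleftrightarrow> (\<forall>n j. \<exists>m. dist (x n) (x m) < s n + (1/2)^j \<and> s m < (1/2)^j)"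

definition nearer :: "(nat \<Rightarrow> real) \<Rightarrow> nat \<Rightarrow> nat \<Rightarrow> nat" where
  "nearer s n j = (LEAST m. dist (x n) (x m) < s n + (1/2)^j \<and> s m < (1/2)^j)"

primrec nearby :: "(nat \<Rightarrow> real) \<Rightarrow> nat \<Rightarrow> nat \<Rightarrow> nat \<Rightarrow> nat" where
  "nearby s n p 0 = nearer s n p"
| "nearby s n p (Suc j) = nearer s (nearby s n p j) (p + Suc j)"

definition select :: "(nat \<Rightarrow> real) \<Rightarrow> nat \<Rightarrow> nat \<Rightarrow> 'a" where
  "select s n p = lim (\<lambda>j. x (nearby s n p j))"

context
  fixes s assumes s: "reachable s"
begin

lemma nearer: "dist (x n) (x (nearer s n j)) < s n + (1/2)^j" "s (nearer s n j) < (1/2)^j"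
  using s LeastI_ex[of "\<lambda>m. dist (x n) (x m) < s n + (1/2)^j \<and> s m < (1/2)^j"]
  by (auto simp: reachable_def nearer_def)

lemma nearby_small: "s (nearby s n p j) < (1/2)^(p + j)"
  by (cases j) (simp_all only: nearby.simps nearer(2) add_0_right)

text \<open>The step from index j is shorter than \<open>s (nearby s n p j)\<close> plus half of
  (1/2)^(p + j), hence than 2 * (1/2)^(p + j). Since (1/2)^m - (1/2)^(m + 1) is half of (1/2)^m, the
  sum of the steps telescopes with the factor 4.\<close>

lemma dist_nearby:
  "dist (x (nearby s n p j)) (x (nearby s n p (j + i))) \<le> 4 * ((1/2)^(p + j) - (1/2)^(p + j + i))"
proof (induction i)
  case (Suc i)
  let ?y = "\<lambda>j. x (nearby s n p j)"
  have "dist (?y (j + i)) (?y (Suc (j + i))) < s (nearby s n p (j + i)) + (1/2)^(p + Suc (j + i))"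
    unfolding nearby.simps by (rule nearer(1))
  then have "dist (?y (j + i)) (?y (Suc (j + i))) \<le> 2 * (1/2)^(p + j + i)"
  proof -
    have "(1/2 :: real)^(p + Suc (j + i)) = (1/2)^(p + j + i) / 2" by (simp add: add.assoc)
    then show ?thesis
      using nearby_small[of n p "j + i"] zero_less_power[of "1/2 :: real" "p + j + i"]
        \<open>dist (?y (j + i)) (?y (Suc (j + i))) < _\<close>
      by (simp only: add.assoc) linarith
  qed
  then show ?case
    using Suc dist_triangle[of "?y j" "?y (Suc (j + i))" "?y (j + i)"]
    by (simp del: nearby.simps add: algebra_simps)
qed simp

lemma nearby_tendsto: "(\<lambda>j. x (nearby s n p j)) \<longlonglongrightarrow> select s n p"
proof -
  have "Cauchy (\<lambda>j. x (nearby s n p j))"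
  proof (rule metric_CauchyI)
    fix e :: real assume "0 < e"
    then obtain N where N: "(1/2 :: real)^N < e / 8"
      using real_arch_pow_inv[of "e/8" "1/2"] by auto
    have *: "dist (x (nearby s n p N)) (x (nearby s n p j)) < e / 2" if j: "j \<ge> N" for j
    proof -
      obtain i where i: "j = N + i" using le_Suc_ex[OF j] by blast
      have arith: "4 * (a - b) < e / 2" if "a \<le> c" "0 \<le> b" "c < e / 8" for a b c
        using that by (simp add: field_simps)
      have "4 * ((1/2)^(p + N) - (1/2)^(p + N + i)) < e / 2"
        by (rule arith[OF _ _ N]) (auto intro: power_decreasing)
      then show ?thesis using dist_nearby[of n p N i] i by simp
    qed
    show "\<exists>M. \<forall>m\<ge>M. \<forall>k\<ge>M. dist (x (nearby s n p m)) (x (nearby s n p k)) < e"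
      using dist_triangle_half_r[OF * *] by blast
  qed
  then have "convergent (\<lambda>j. x (nearby s n p j))"
    using complete unfolding complete_def convergent_def by blast
  then show ?thesis by (simp add: select_def convergent_LIMSEQ_iff)
qed

text \<open>The first choice \<open>nearer s n p\<close> costs \<open>s n + (1/2)^p\<close>, all
  later ones together at most \<open>4 * (1/2)^p\<close>.\<close>

lemma dist_select: "dist (x n) (select s n p) \<le> s n + 5 * (1/2)^p"
proof (rule LIMSEQ_le_const2)
  show "(\<lambda>j. dist (x n) (x (nearby s n p j))) \<longlonglongrightarrow> dist (x n) (select s n p)"
    by (intro tendsto_intros nearby_tendsto)
  have "dist (x n) (x (nearby s n p j)) \<le> s n + 5 * (1/2)^p" for j
  proof -
    have "dist (x n) (x (nearby s n p 0)) \<le> s n + (1/2)^p"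
      unfolding nearby.simps by (rule less_imp_le[OF nearer(1)])
    moreover have "dist (x (nearby s n p 0)) (x (nearby s n p j)) \<le> 4 * (1/2)^p"
    proof -
      have "4 * ((1/2)^(p + 0) - (1/2)^(p + 0 + j)) \<le> 4 * (1/2 :: real)^p" by simp
      from order_trans[OF dist_nearby[of n p 0 j] this] show ?thesis by (simp del: nearby.simps)
    qed
    ultimately show ?thesis
      using dist_triangle[of "x n" "x (nearby s n p j)" "x (nearby s n p 0)"] by linarith
  qed
  then show "\<exists>N. \<forall>j\<ge>N. dist (x n) (x (nearby s n p j)) \<le> s n + 5 * (1/2)^p" by blast
qed

end

text \<open>The choices are least indices, thus measurable maps into a countable discrete space, and
  \<open>select\<close> is a pointwise limit of their composites with \<open>x\<close>.\<close>

lemma measurable_select: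
  assumes s: "\<And>n. (\<lambda>w. s w n) \<in> borel_measurable M" and r: "\<And>w. w \<in> space M \<Longrightarrow> reachable (s w)"
  shows "(\<lambda>w. select (s w) n p) \<in> borel_measurable M"
proof -
  note [measurable] = s
  have nearer: "(\<lambda>w. nearer (s w) n j) \<in> M \<rightarrow>\<^sub>M count_space UNIV" for n j
    unfolding nearer_def by measurable
  have "(\<lambda>w. nearby (s w) n p j) \<in> M \<rightarrow>\<^sub>M count_space UNIV" for j
  proof (induction j)
    case (Suc j)
    show ?case
      unfolding nearby.simps by (rule measurable_compose_countable[OF nearer Suc])
  qed (simp add: nearer)
  then have "(\<lambda>w. x (nearby (s w) n p j)) \<in> borel_measurable M" for j
    by (rule measurable_compose) simp
  then show ?thesis
    by (rule borel_measurable_LIMSEQ_metric) (rule nearby_tendsto[OF r])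
qed

end

section \<open>Borel maps into the space of continuous functions on the Cantor set\<close>

definition C_cantor_seq :: "nat \<Rightarrow> cantor \<Rightarrow>\<^sub>C complex" where
  "C_cantor_seq = (SOME x. \<forall>u e. 0 < e \<longrightarrow> (\<exists>n. dist u (x n) < e))"

interpretation C_cantor: complete_separable C_cantor_seq
proof
  show "\<exists>n. dist u (C_cantor_seq n) < e" if "0 < e" for u e
    using someI_ex[OF C_cantor_separable] that unfolding C_cantor_seq_def by blast
qed (rule complete_C_cantor)

lemma borel_measurable_apply_bcontfun:
  "(\<lambda>u. apply_bcontfun u b) \<in> borel_measurable borel"
proof (intro borel_measurable_continuous_onI)
  show "continuous_on UNIV (\<lambda>u. apply_bcontfun u b)"
    unfolding continuous_on_iff using dist_bounded[of _ b] by (metis UNIV_I le_less_trans)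
qed

text \<open>By \<open>dist_C_cantor_le_iff\<close> a closed ball is given by countably many
  conditions on values, and the distances to a dense sequence determine measurability.\<close>

lemma borel_measurable_C_cantor_iff:
  fixes f :: "'a \<Rightarrow> cantor \<Rightarrow>\<^sub>C complex"
  shows "f \<in> borel_measurable M \<longleftrightarrow> (\<forall>b. (\<lambda>w. apply_bcontfun (f w) b) \<in> borel_measurable M)"
proof
  assume "f \<in> borel_measurable M"
  then show "\<forall>b. (\<lambda>w. apply_bcontfun (f w) b) \<in> borel_measurable M"
    by (intro allI measurable_compose[OF _ borel_measurable_apply_bcontfun])
next
  assume [rule_format, measurable]: "\<forall>b. (\<lambda>w. apply_bcontfun (f w) b) \<in> borel_measurable M"
  show "f \<in> borel_measurable M"
    unfolding C_cantor.borel_measurable_iff_dist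
  proof (intro allI borel_measurableI_le)
    fix n r
    show "{w \<in> space M. dist (f w) (C_cantor_seq n) \<le> r} \<in> sets M"
      unfolding dist_C_cantor_le_iff by measurable
  qed
qed

lemma borel_measurable_plus_C_cantor [measurable (raw)]:
  fixes f g :: "'a \<Rightarrow> cantor \<Rightarrow>\<^sub>C complex"
  assumes "f \<in> borel_measurable M" "g \<in> borel_measurable M"
  shows "(\<lambda>w. f w + g w) \<in> borel_measurable M"
  using assms unfolding borel_measurable_C_cantor_iff
  by (auto intro: borel_measurable_add)

lemma borel_measurable_scale_C_cantor [measurable (raw)]:
  assumes "a \<in> borel_measurable M" "f \<in> borel_measurable M"
  shows "(\<lambda>w. scale C_cantor (a w) (f w)) \<in> borel_measurable M"
  using assms unfolding borel_measurable_C_cantor_iff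
  by (auto simp: apply_scale_C_cantor intro: borel_measurable_times)

section \<open>The Effros Borel space\<close>

lemma closed_subspaces_C_cantor_iff:
  "K \<in> closed_subspaces C_cantor \<longleftrightarrow> closed K \<and> 0 \<in> K \<and> (\<forall>u\<in>K. \<forall>v\<in>K. u + v \<in> K) \<and>
     (\<forall>a. \<forall>u\<in>K. scale C_cantor a u \<in> K)"
  by (simp add: closed_subspaces_def norm_topology_C_cantor)

lemma space_effros: "space (effros E) = closed_subspaces E"
  unfolding effros_def by (intro space_measure_of) auto

lemma sets_effros:
  "sets (effros E) = sigma_sets (closed_subspaces E)
     {{K \<in> closed_subspaces E. K \<inter> U \<noteq> {}} | U. openin (norm_topology E) U}"
  unfolding effros_def by (intro sets_measure_of) auto

lemma measurable_effrosI:
  assumes "\<And>y. y \<in> space M \<Longrightarrow> \<gamma> y \<in> closed_subspaces C_cantor"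
    and "\<And>U. open U \<Longrightarrow> {y \<in> space M. \<gamma> y \<inter> U \<noteq> {}} \<in> sets M"
  shows "\<gamma> \<in> M \<rightarrow>\<^sub>M effros C_cantor"
  unfolding effros_def
proof (rule measurable_measure_of)
  fix A assume "A \<in> {{K \<in> closed_subspaces C_cantor. K \<inter> U \<noteq> {}} | U. openin (norm_topology C_cantor) U}"
  then obtain U where U: "open U" "A = {K \<in> closed_subspaces C_cantor. K \<inter> U \<noteq> {}}"
    by (auto simp: norm_topology_C_cantor)
  have "\<gamma> -` A \<inter> space M = {y \<in> space M. \<gamma> y \<inter> U \<noteq> {}}"
    using assms(1) U(2) by auto
  then show "\<gamma> -` A \<inter> space M \<in> sets M" using assms(2)[OF U(1)] by simp
qed (use assms(1) in auto)

lemma infdist_less_iff: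
  assumes "A \<noteq> {}"
  shows "infdist u A < r \<longleftrightarrow> (\<exists>v\<in>A. dist u v < r)"
proof
  assume "infdist u A < r"
  then show "\<exists>v\<in>A. dist u v < r"
    using assms by (simp add: infdist_notempty cINF_less_iff)
next
  assume "\<exists>v\<in>A. dist u v < r"
  then show "infdist u A < r" using infdist_le le_less_trans by blast
qed

lemma borel_measurable_infdist_effros:
  assumes "\<gamma> \<in> M \<rightarrow>\<^sub>M effros C_cantor"
  shows "(\<lambda>y. infdist u (\<gamma> y)) \<in> borel_measurable M"
proof (rule borel_measurableI_less)
  fix r
  have \<gamma>: "\<gamma> y \<in> closed_subspaces C_cantor" if "y \<in> space M" for y
    using measurable_space[OF assms that] by (simp add: space_effros)
  have ne: "\<gamma> y \<noteq> {}" if "y \<in> space M" for y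
    using \<gamma>[OF that] by (auto simp: closed_subspaces_C_cantor_iff)
  have "{K \<in> closed_subspaces C_cantor. K \<inter> ball u r \<noteq> {}} \<in> sets (effros C_cantor)"
    unfolding sets_effros by (rule sigma_sets.Basic) (auto simp: norm_topology_C_cantor)
  then have "\<gamma> -` {K \<in> closed_subspaces C_cantor. K \<inter> ball u r \<noteq> {}} \<inter> space M \<in> sets M"
    by (rule measurable_sets[OF assms])
  also have "\<gamma> -` {K \<in> closed_subspaces C_cantor. K \<inter> ball u r \<noteq> {}} \<inter> space M =
      {y \<in> space M. infdist u (\<gamma> y) < r}"
  proof -
    have "\<gamma> y \<inter> ball u r \<noteq> {} \<longleftrightarrow> infdist u (\<gamma> y) < r" if "y \<in> space M" for y
      unfolding infdist_less_iff[OF ne[OF that]] by (auto simp: disjoint_iff)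
    then show ?thesis using \<gamma> by auto
  qed
  finally show "{y \<in> space M. infdist u (\<gamma> y) < r} \<in> sets M" .
qed

context complete_separable
begin

text \<open>An open set is a union of balls around members of the dense sequence, and a set meets
  such a ball exactly if its distance from the centre is less than the radius. The generators of the
  Effros structure thereby become conditions on the codes.\<close>

lemma Int_open_nonempty_iff:
  assumes "open U" "K \<noteq> {}"
  shows "K \<inter> U \<noteq> {} \<longleftrightarrow> (\<exists>z. ball (x (fst z)) (1 / real (Suc (snd z))) \<subseteq> U \<and>
    infdist (x (fst z)) K < 1 / real (Suc (snd z)))"
proof -
  have "K \<inter> U \<noteq> {} \<longleftrightarrow> (\<exists>z. ball (x (fst z)) (1 / real (Suc (snd z))) \<subseteq> U \<and>
      K \<inter> ball (x (fst z)) (1 / real (Suc (snd z))) \<noteq> {})"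
    using open_eq_Union_balls[OF assms(1)] by blast
  also have "\<dots> \<longleftrightarrow> (\<exists>z. ball (x (fst z)) (1 / real (Suc (snd z))) \<subseteq> U \<and>
      (\<exists>v\<in>K. dist (x (fst z)) v < 1 / real (Suc (snd z))))"
    by (simp only: disjoint_iff mem_ball) blast
  finally show ?thesis by (simp only: infdist_less_iff[OF assms(2)])
qed

lemma reachable_infdist:
  assumes "K \<noteq> {}"
  shows "reachable (\<lambda>n. infdist (x n) K)"
  unfolding reachable_def
proof (intro allI)
  fix n j
  let ?R = "infdist (x n) K + (1/2)^j"
  have "infdist (x n) K < ?R" by simp
  then obtain v where v: "v \<in> K" "dist (x n) v < ?R" using infdist_less_iff[OF assms] by blast
  have "0 < min (?R - dist (x n) v) ((1/2)^j)" using v(2) by simp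
  then obtain m where m: "dist v (x m) < min (?R - dist (x n) v) ((1/2)^j)" using dense by blast
  have "dist (x n) (x m) < ?R" using dist_triangle[of "x n" "x m" v] m by linarith
  moreover have "infdist (x m) K < (1/2)^j"
    using infdist_le[OF v(1), of "x m"] m by (simp add: dist_commute)
  ultimately show "\<exists>m. dist (x n) (x m) < ?R \<and> infdist (x m) K < (1/2)^j" by blast
qed

lemma nearby_tendsto_0:
  assumes "reachable s" "\<And>n. 0 \<le> s n"
  shows "(\<lambda>j. s (nearby s n p j)) \<longlonglongrightarrow> 0"
proof (rule tendsto_sandwich[OF _ _ tendsto_const])
  show "(\<lambda>j. (1/2 :: real)^(p + j)) \<longlonglongrightarrow> 0"
    using LIMSEQ_ignore_initial_segment[OF LIMSEQ_power_zero[of "1/2 :: real"], of p]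
    by (simp add: add.commute)
  show "\<forall>\<^sub>F j in sequentially. s (nearby s n p j) \<le> (1/2)^(p + j)"
    using nearby_small[OF assms(1)] by (intro always_eventually allI less_imp_le)
qed (use assms(2) in auto)

lemma select_infdist_in:
  assumes "closed K" "K \<noteq> {}"
  shows "select (\<lambda>n. infdist (x n) K) n p \<in> K"
proof -
  let ?s = "\<lambda>n. infdist (x n) K"
  have "(\<lambda>j. infdist (x (nearby ?s n p j)) K) \<longlonglongrightarrow> infdist (select ?s n p) K"
    by (intro tendsto_intros nearby_tendsto reachable_infdist assms)
  moreover have "(\<lambda>j. infdist (x (nearby ?s n p j)) K) \<longlonglongrightarrow> 0"
    using nearby_tendsto_0[OF reachable_infdist[OF assms(2)]] infdist_nonneg by blast
  ultimately have "infdist (select ?s n p) K = 0" by (rule LIMSEQ_unique)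
  then show ?thesis using in_closed_iff_infdist_zero[OF assms] by blast
qed

lemma select_infdist_dense:
  assumes "u \<in> K" "0 < e"
  shows "\<exists>n p. dist u (select (\<lambda>n. infdist (x n) K) n p) < e"
proof -
  obtain n where n: "dist u (x n) < e / 4" using dense[of "e/4"] assms(2) by auto
  \<comment> \<open>With e/4 for the distance from \<open>u\<close> to \<open>x n\<close>, e/4 for
    \<open>infdist (x n) K\<close> and the factor 5 of \<open>dist_select\<close>, the errors add up
    to e.\<close>
  obtain p where p: "(1/2 :: real)^p < e / 10"
    using real_arch_pow_inv[of "e/10" "1/2"] assms(2) by auto
  have "K \<noteq> {}" using assms(1) by auto
  from dist_select[OF reachable_infdist[OF this], of n p]
  have "dist (x n) (select (\<lambda>n. infdist (x n) K) n p) \<le> infdist (x n) K + 5 * (1/2)^p" .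
  moreover have "infdist (x n) K < e / 4"
    using infdist_le[OF assms(1), of "x n"] n by (simp add: dist_commute)
  ultimately have "dist u (select (\<lambda>n. infdist (x n) K) n p) < e"
    using n p dist_triangle[of u "select (\<lambda>n. infdist (x n) K) n p" "x n"] by linarith
  then show ?thesis by blast
qed

end

text \<open>The image of the Effros space under \<open>K \<mapsto> (\<lambda>n. infdist (C_cantor_seq n) K)\<close>: reachability
  expresses that the distances are attained in the limit, the last two inequalities that \<open>K\<close> is a
  linear subspace.\<close>

definition subspace_codes :: "(nat \<Rightarrow> real) set" where
  "subspace_codes = {s. C_cantor.reachable s \<and>
       (\<forall>j. \<exists>n. norm (C_cantor_seq n) < (1/2)^j \<and> s n < (1/2)^j)} \<inter>
     {s. (\<forall>n. 0 \<le> s n) \<and> (\<forall>n m. s n \<le> s m + dist (C_cantor_seq n) (C_cantor_seq m)) \<and>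
       (\<forall>n m k. s k \<le> s n + s m + dist (C_cantor_seq k) (C_cantor_seq n + C_cantor_seq m)) \<and>
       (\<forall>a n k. s k \<le> cmod a * s n + dist (C_cantor_seq k) (scale C_cantor a (C_cantor_seq n)))}"

text \<open>The homogeneity condition quantifies over all complex \<open>a\<close>, which is
  harmless: weak inequalities between continuous functions define a closed set, however many there
  are. Only the existential conditions rely on countability.\<close>

lemma sets_subspace_codes: "subspace_codes \<in> sets borel"
  unfolding subspace_codes_def
proof (rule sets.Int)
  show "{s. C_cantor.reachable s \<and> (\<forall>j. \<exists>n. norm (C_cantor_seq n) < (1/2)^j \<and> s n < (1/2)^j)} \<in> sets borel"
    unfolding C_cantor.reachable_def by measurable
  have "closed {s :: nat \<Rightarrow> real. (\<forall>n. 0 \<le> s n) \<and>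
       (\<forall>n m. s n \<le> s m + dist (C_cantor_seq n) (C_cantor_seq m)) \<and>
       (\<forall>n m k. s k \<le> s n + s m + dist (C_cantor_seq k) (C_cantor_seq n + C_cantor_seq m)) \<and>
       (\<forall>a n k. s k \<le> cmod a * s n + dist (C_cantor_seq k) (scale C_cantor a (C_cantor_seq n)))}"
    by (intro closed_Collect_conj closed_Collect_all closed_Collect_le continuous_intros
        continuous_on_product_coordinates)
  then show "{s :: nat \<Rightarrow> real. (\<forall>n. 0 \<le> s n) \<and>
       (\<forall>n m. s n \<le> s m + dist (C_cantor_seq n) (C_cantor_seq m)) \<and>
       (\<forall>n m k. s k \<le> s n + s m + dist (C_cantor_seq k) (C_cantor_seq n + C_cantor_seq m)) \<and>
       (\<forall>a n k. s k \<le> cmod a * s n + dist (C_cantor_seq k) (scale C_cantor a (C_cantor_seq n)))} \<in> sets borel"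
    by (rule borel_closed)
qed

lemma dist_scale_C_cantor: "dist (scale C_cantor a u) (scale C_cantor a v) = cmod a * dist u v"
  by (simp add: dist_norm norm_scale_C_cantor flip: scale_C_cantor_diff_right)

text \<open>Distances from \<open>K\<close> need not be attained, so the inequalities for sums and
  multiples are proved up to e with nearly closest points.\<close>

lemma infdist_in_subspace_codes:
  assumes K: "K \<in> closed_subspaces C_cantor"
  shows "(\<lambda>n. infdist (C_cantor_seq n) K) \<in> subspace_codes"
proof -
  let ?x = C_cantor_seq
  have K': "closed K" "0 \<in> K" "\<And>u v. u \<in> K \<Longrightarrow> v \<in> K \<Longrightarrow> u + v \<in> K"
    "\<And>a u. u \<in> K \<Longrightarrow> scale C_cantor a u \<in> K"
    using K by (auto simp: closed_subspaces_C_cantor_iff)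
  then have ne: "K \<noteq> {}" by auto
  have near: "\<exists>v\<in>K. dist u v < infdist u K + e" if "0 < e" for u e
    using infdist_less_iff[OF ne, of u "infdist u K + e"] that by simp
  have zero: "\<exists>n. norm (?x n) < (1/2)^j \<and> infdist (?x n) K < (1/2)^j" for j
  proof -
    obtain n where "dist 0 (?x n) < (1/2)^j" using C_cantor.dense[of "(1/2)^j" 0] by auto
    then show ?thesis
      using infdist_le[OF K'(2), of "?x n"] by (intro exI[of _ n]) (simp add: dist_norm)
  qed
  have add: "infdist (?x k) K \<le> infdist (?x n) K + infdist (?x m) K + dist (?x k) (?x n + ?x m)" for n m k
  proof (rule field_le_epsilon)
    fix e :: real assume e: "0 < e"
    obtain u where u: "u \<in> K" "dist (?x n) u < infdist (?x n) K + e / 2" using near[of "e/2" "?x n"] e by auto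
    obtain v where v: "v \<in> K" "dist (?x m) v < infdist (?x m) K + e / 2" using near[of "e/2" "?x m"] e by auto
    have "infdist (?x k) K \<le> dist (?x k) (u + v)" using K'(3) u v by (intro infdist_le) auto
    also have "\<dots> \<le> dist (?x k) (?x n + ?x m) + dist (?x n + ?x m) (u + v)" by (rule dist_triangle)
    also have "dist (?x n + ?x m) (u + v) \<le> dist (?x n) u + dist (?x m) v" by (rule dist_triangle_add)
    finally show "infdist (?x k) K \<le> infdist (?x n) K + infdist (?x m) K + dist (?x k) (?x n + ?x m) + e"
      using u(2) v(2) by linarith
  qed
  have scale: "infdist (?x k) K \<le> cmod a * infdist (?x n) K + dist (?x k) (scale C_cantor a (?x n))" for a n k
  proof (rule field_le_epsilon)
    fix e :: real assume e: "0 < e"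
    \<comment> \<open>Adding 1 keeps the denominator positive when \<open>a\<close> is 0.\<close>
    have pos: "0 < e / (cmod a + 1)" using e by (simp add: add_nonneg_pos)
    obtain u where u: "u \<in> K" "dist (?x n) u < infdist (?x n) K + e / (cmod a + 1)"
      using near[OF pos, of "?x n"] by auto
    have "infdist (?x k) K \<le> dist (?x k) (scale C_cantor a u)" using K'(4) u by (intro infdist_le) auto
    also have "\<dots> \<le> dist (?x k) (scale C_cantor a (?x n)) + dist (scale C_cantor a (?x n)) (scale C_cantor a u)"
      by (rule dist_triangle)
    also have "dist (scale C_cantor a (?x n)) (scale C_cantor a u) = cmod a * dist (?x n) u"
      by (rule dist_scale_C_cantor)
    also have "\<dots> \<le> cmod a * (infdist (?x n) K + e / (cmod a + 1))"
      using u(2) by (intro mult_left_mono) auto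
    also have "\<dots> = cmod a * infdist (?x n) K + cmod a / (cmod a + 1) * e"
      by (simp add: algebra_simps)
    also have "cmod a / (cmod a + 1) * e \<le> 1 * e"
      using e by (intro mult_right_mono) (auto simp: divide_le_eq add_nonneg_pos)
    finally show "infdist (?x k) K \<le> cmod a * infdist (?x n) K + dist (?x k) (scale C_cantor a (?x n)) + e"
      by simp
  qed
  show ?thesis
    unfolding subspace_codes_def
    using C_cantor.reachable_infdist[OF ne] zero add scale infdist_nonneg infdist_triangle by auto
qed

text \<open>The subspace is recovered as the limits of those \<open>x n\<close> whose prescribed
  distance tends to zero. The points given by \<open>select\<close> lie in it and bound its
  distances from above; the Lipschitz condition bounds them from below.\<close>

lemma subspace_codes_realized:
  assumes s: "s \<in> subspace_codes"
  shows "\<exists>K\<in>closed_subspaces C_cantor. \<forall>n. infdist (C_cantor_seq n) K = s n"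
proof -
  let ?x = C_cantor_seq
  have r: "C_cantor.reachable s" and zero: "\<And>j. \<exists>n. norm (?x n) < (1/2)^j \<and> s n < (1/2)^j"
    and nonneg: "\<And>n. 0 \<le> s n" and lip: "\<And>n m. s n \<le> s m + dist (?x n) (?x m)"
    and add: "\<And>n m k. s k \<le> s n + s m + dist (?x k) (?x n + ?x m)"
    and scale: "\<And>a n k. s k \<le> cmod a * s n + dist (?x k) (scale C_cantor a (?x n))"
    using s by (auto simp: subspace_codes_def)
  define K where "K = {u. \<forall>e>0. \<exists>n. dist u (?x n) < e \<and> s n < e}"
  have K: "\<exists>n. dist u (?x n) < e \<and> s n < e" if "u \<in> K" "0 < e" for u e
    using that by (simp add: K_def)
  have closed: "closed K"
    unfolding closed_sequential_limits
  proof (intro allI impI)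
    fix f l assume f: "(\<forall>n. f n \<in> K) \<and> f \<longlonglongrightarrow> l"
    show "l \<in> K"
      unfolding K_def
    proof (intro CollectI allI impI)
      fix e :: real assume e: "0 < e"
      then obtain n where n: "dist (f n) l < e / 2"
        using f unfolding lim_sequentially by (metis half_gt_zero order_refl)
      obtain m where m: "dist (f n) (?x m) < e / 2" "s m < e / 2" using K[of "f n" "e/2"] f e by auto
      then have "dist l (?x m) < e" using n dist_triangle3[of l "?x m" "f n"] by linarith
      then show "\<exists>n. dist l (?x n) < e \<and> s n < e" using m e by (intro exI[of _ m]) auto
    qed
  qed
  have "0 \<in> K"
    unfolding K_def
  proof (intro CollectI allI impI)
    fix e :: real assume "0 < e"
    then obtain j where "(1/2 :: real)^j < e" using real_arch_pow_inv[of e "1/2"] by auto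
    then show "\<exists>n. dist 0 (?x n) < e \<and> s n < e" using zero[of j] unfolding dist_norm
      by (auto simp: norm_minus_cancel intro: less_trans)
  qed
  moreover have "u + v \<in> K" if "u \<in> K" "v \<in> K" for u v
    unfolding K_def
  proof (intro CollectI allI impI)
    fix e :: real assume e: "0 < e"
    obtain n where n: "dist u (?x n) < e / 5" "s n < e / 5" using K[OF \<open>u \<in> K\<close>, of "e/5"] e by auto
    obtain m where m: "dist v (?x m) < e / 5" "s m < e / 5" using K[OF \<open>v \<in> K\<close>, of "e/5"] e by auto
    obtain k where k: "dist (?x n + ?x m) (?x k) < e / 5" using C_cantor.dense[of "e/5"] e by auto
    have "dist (u + v) (?x k) \<le> dist (u + v) (?x n + ?x m) + dist (?x n + ?x m) (?x k)"
      by (rule dist_triangle)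
    also have "dist (u + v) (?x n + ?x m) \<le> dist u (?x n) + dist v (?x m)" by (rule dist_triangle_add)
    finally have "dist (u + v) (?x k) < e" using n m k e by linarith
    moreover have "s k < e" using add[of k n m] n m k e by (simp add: dist_commute)
    ultimately show "\<exists>k. dist (u + v) (?x k) < e \<and> s k < e" by blast
  qed
  moreover have "scale C_cantor a u \<in> K" if "u \<in> K" for a u
    unfolding K_def
  proof (intro CollectI allI impI)
    fix e :: real assume e: "0 < e"
    have pos: "0 < e / 2 / (cmod a + 1)" using e by (simp add: add_nonneg_pos)
    have le: "cmod a * r < e / 2" if "r < e / 2 / (cmod a + 1)" "0 \<le> r" for r
    proof -
      have "cmod a * r \<le> r * (cmod a + 1)" using that(2) by (simp add: algebra_simps)
      also have "\<dots> < e / 2" using that(1) by (subst (asm) pos_less_divide_eq) (simp_all add: add_nonneg_pos)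
      finally show ?thesis .
    qed
    obtain n where n: "dist u (?x n) < e / 2 / (cmod a + 1)" "s n < e / 2 / (cmod a + 1)"
      using K[OF \<open>u \<in> K\<close> pos] by auto
    obtain k where k: "dist (scale C_cantor a (?x n)) (?x k) < e / 2" using C_cantor.dense[of "e/2"] e by auto
    have "dist (scale C_cantor a u) (?x k) \<le> dist (scale C_cantor a u) (scale C_cantor a (?x n)) +
        dist (scale C_cantor a (?x n)) (?x k)"
      by (rule dist_triangle)
    also have "dist (scale C_cantor a u) (scale C_cantor a (?x n)) < e / 2"
      unfolding dist_scale_C_cantor using le[OF n(1)] by simp
    finally have "dist (scale C_cantor a u) (?x k) < e" using k by linarith
    moreover have "s k < e" using scale[of k a n] le[OF n(2) nonneg] k by (simp add: dist_commute)
    ultimately show "\<exists>k. dist (scale C_cantor a u) (?x k) < e \<and> s k < e" by blast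
  qed
  ultimately have "K \<in> closed_subspaces C_cantor"
    using closed by (simp add: closed_subspaces_C_cantor_iff)
  moreover have "infdist (?x n) K = s n" for n
  proof (rule order_antisym)
    show "infdist (?x n) K \<le> s n"
    proof (rule field_le_epsilon)
      fix e :: real assume "0 < e"
      then obtain p where p: "(1/2 :: real)^p < e / 5" using real_arch_pow_inv[of "e/5" "1/2"] by auto
      have "C_cantor.select s n p \<in> K"
        unfolding K_def
      proof (intro CollectI allI impI)
        fix d :: real assume "0 < d"
        then have "\<forall>\<^sub>F j in sequentially. dist (?x (C_cantor.nearby s n p j)) (C_cantor.select s n p) < d"
          using C_cantor.nearby_tendsto[OF r] tendstoD by blast
        moreover have "\<forall>\<^sub>F j in sequentially. s (C_cantor.nearby s n p j) < d"
          using C_cantor.nearby_tendsto_0[OF r nonneg] \<open>0 < d\<close> by (rule order_tendstoD)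
        ultimately have "\<forall>\<^sub>F j in sequentially. dist (C_cantor.select s n p) (?x (C_cantor.nearby s n p j)) < d
            \<and> s (C_cantor.nearby s n p j) < d"
          by eventually_elim (simp add: dist_commute)
        then show "\<exists>k. dist (C_cantor.select s n p) (?x k) < d \<and> s k < d"
          using eventually_happens'[OF sequentially_bot] by blast
      qed
      then have "infdist (?x n) K \<le> dist (?x n) (C_cantor.select s n p)" by (rule infdist_le)
      then show "infdist (?x n) K \<le> s n + e" using C_cantor.dist_select[OF r, of n p] p by linarith
    qed
    have "K \<noteq> {}" using \<open>0 \<in> K\<close> by auto
    have "s n \<le> dist (?x n) u" if u: "u \<in> K" for u
    proof (rule field_le_epsilon)
      fix e :: real assume "0 < e"
      then obtain m where m: "dist u (?x m) < e / 2" "s m < e / 2" using K[OF u, of "e/2"] by auto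
      then show "s n \<le> dist (?x n) u + e"
        using lip[of n m] dist_triangle[of "?x n" "?x m" u] by linarith
    qed
    then show "s n \<le> infdist (?x n) K"
      using \<open>K \<noteq> {}\<close> by (simp add: infdist_notempty cINF_greatest)
  qed
  ultimately show ?thesis by blast
qed

lemma standard_borel_effros: "standard_borel (effros C_cantor)"
proof -
  let ?f = "\<lambda>K n. infdist (C_cantor_seq n) K"
  let ?G = "{{K \<in> closed_subspaces C_cantor. K \<inter> U \<noteq> {}} | U. openin (norm_topology C_cantor) U}"
  have ne: "K \<noteq> {}" "closed K" if "K \<in> closed_subspaces C_cantor" for K
    using that by (auto simp: closed_subspaces_C_cantor_iff)
  have "borel_retract (effros C_cantor) (borel :: (nat \<Rightarrow> real) measure)"
  proof (rule borel_retract_generatorI[where f = ?f and G = ?G])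
    show "sets (effros C_cantor) = sigma_sets (space (effros C_cantor)) ?G"
      by (simp add: sets_effros space_effros)
    show "?G \<subseteq> Pow (space (effros C_cantor))" by (auto simp: space_effros)
    have "UNIV \<in> closed_subspaces C_cantor" by (simp add: closed_subspaces_C_cantor_iff)
    then show "space (effros C_cantor) \<noteq> {}" by (auto simp: space_effros)
    show "?f \<in> effros C_cantor \<rightarrow>\<^sub>M borel"
      by (intro measurable_coordinatewise_then_product borel_measurable_infdist_effros) simp
    have code: "K \<inter> U \<noteq> {} \<longleftrightarrow> (\<exists>z. ball (C_cantor_seq (fst z)) (1 / real (Suc (snd z))) \<subseteq> U \<and>
        ?f K (fst z) < 1 / real (Suc (snd z)))"
      if "K \<in> closed_subspaces C_cantor" "open U" for K U
      using C_cantor.Int_open_nonempty_iff[OF that(2) ne(1)[OF that(1)]] .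
    show "inj_on ?f (space (effros C_cantor))"
    proof (rule inj_onI)
      fix K L assume KL: "K \<in> space (effros C_cantor)" "L \<in> space (effros C_cantor)" "?f K = ?f L"
      then have *: "K \<in> closed_subspaces C_cantor" "L \<in> closed_subspaces C_cantor"
        by (auto simp: space_effros)
      have eq: "infdist (C_cantor_seq n) K = infdist (C_cantor_seq n) L" for n
        using fun_cong[OF KL(3), of n] .
      have "K \<inter> U \<noteq> {} \<longleftrightarrow> L \<inter> U \<noteq> {}" if "open U" for U
        unfolding code[OF *(1) that] code[OF *(2) that] eq ..
      \<comment> \<open>\<open>L\<close> meets the open complement of \<open>K\<close> only if
        \<open>K\<close> does, which is impossible, so \<open>L\<close> is contained in
        \<open>K\<close>; likewise conversely.\<close>
      from this[of "- K"] this[of "- L"] show "K = L"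
        using ne[OF *(1)] ne[OF *(2)] by (auto simp: open_Compl)
    qed
    have "?f ` space (effros C_cantor) = subspace_codes"
    proof (rule subset_antisym; rule subsetI)
      fix s assume "s \<in> ?f ` space (effros C_cantor)"
      then show "s \<in> subspace_codes" using infdist_in_subspace_codes by (auto simp: space_effros)
    next
      fix s assume "s \<in> subspace_codes"
      then obtain K where "K \<in> closed_subspaces C_cantor" "\<forall>n. infdist (C_cantor_seq n) K = s n"
        using subspace_codes_realized by blast
      then show "s \<in> ?f ` space (effros C_cantor)"
        by (intro image_eqI[of _ _ K] ext) (auto simp: space_effros)
    qed
    then show "?f ` space (effros C_cantor) \<in> sets borel" by (simp add: sets_subspace_codes)
    fix A assume "A \<in> ?G"
    then obtain U where U: "open U" "A = {K \<in> closed_subspaces C_cantor. K \<inter> U \<noteq> {}}"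
      by (auto simp: norm_topology_C_cantor)
    let ?B = "{s :: nat \<Rightarrow> real. \<exists>z. ball (C_cantor_seq (fst z)) (1 / real (Suc (snd z))) \<subseteq> U \<and>
        s (fst z) < 1 / real (Suc (snd z))}"
    have "?B \<in> sets borel" by measurable
    moreover have "A = ?f -` ?B \<inter> space (effros C_cantor)"
      unfolding U(2) space_effros using code[OF _ U(1)] by auto
    ultimately show "\<exists>B\<in>sets borel. A = ?f -` B \<inter> space (effros C_cantor)" by blast
  qed
  then show ?thesis using standard_borel_real_sequences by (rule standard_borel_retract)
qed

section \<open>Normed spaces on a carrier set\<close>

locale normed_carrier =
  fixes E :: "'a normed_struct"
  assumes E: "complex_normed_space E"
begin

lemma zero_in: "zero E \<in> carrier E"
  and plus_in: "u \<in> carrier E \<Longrightarrow> v \<in> carrier E \<Longrightarrow> plus E u v \<in> carrier E"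
  and scale_in: "u \<in> carrier E \<Longrightarrow> scale E a u \<in> carrier E"
  and plus_commute: "u \<in> carrier E \<Longrightarrow> v \<in> carrier E \<Longrightarrow> plus E u v = plus E v u"
  and scale_plus: "u \<in> carrier E \<Longrightarrow> v \<in> carrier E \<Longrightarrow>
    scale E a (plus E u v) = plus E (scale E a u) (scale E a v)"
  and scale_add: "u \<in> carrier E \<Longrightarrow> scale E (a + b) u = plus E (scale E a u) (scale E b u)"
  and scale_mult: "u \<in> carrier E \<Longrightarrow> scale E (a * b) u = scale E a (scale E b u)"
  and scale_one: "u \<in> carrier E \<Longrightarrow> scale E 1 u = u"
  using E unfolding complex_normed_space_def complex_vector_space_def by simp_all

lemma plus_assoc:
  assumes "u \<in> carrier E" "v \<in> carrier E" "w \<in> carrier E"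
  shows "plus E (plus E u v) w = plus E u (plus E v w)"
proof -
  have "\<forall>u\<in>carrier E. \<forall>v\<in>carrier E. \<forall>w\<in>carrier E. plus E (plus E u v) w = plus E u (plus E v w)"
    using E unfolding complex_normed_space_def complex_vector_space_def by (elim conjE)
  then show ?thesis using assms by (simp only:)
qed

lemma zero_plus:
  assumes "u \<in> carrier E"
  shows "plus E (zero E) u = u"
proof -
  have "\<forall>u\<in>carrier E. plus E (zero E) u = u"
    using E unfolding complex_normed_space_def complex_vector_space_def by (elim conjE)
  then show ?thesis using assms by (rule bspec)
qed

lemma nrm_nonneg: "u \<in> carrier E \<Longrightarrow> 0 \<le> nrm E u"
  and nrm_eq_0: "u \<in> carrier E \<Longrightarrow> nrm E u = 0 \<longleftrightarrow> u = zero E"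
  and nrm_scale: "u \<in> carrier E \<Longrightarrow> nrm E (scale E a u) = cmod a * nrm E u"
  and nrm_plus: "u \<in> carrier E \<Longrightarrow> v \<in> carrier E \<Longrightarrow> nrm E (plus E u v) \<le> nrm E u + nrm E v"
  using E unfolding complex_normed_space_def by simp_all

lemma plus_zero: "u \<in> carrier E \<Longrightarrow> plus E u (zero E) = u"
  using plus_commute zero_in zero_plus by metis

text \<open>Definiteness of the norm takes the place of the usual cancellation argument.\<close>

lemma scale_zero: "u \<in> carrier E \<Longrightarrow> scale E 0 u = zero E"
  using nrm_scale[of u 0] nrm_eq_0[of "scale E 0 u"] scale_in by simp

lemma plus_left_commute:
  "u \<in> carrier E \<Longrightarrow> v \<in> carrier E \<Longrightarrow> w \<in> carrier E \<Longrightarrow> plus E u (plus E v w) = plus E v (plus E u w)"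
  by (metis plus_assoc plus_commute)

lemma plus_minus: "u \<in> carrier E \<Longrightarrow> plus E u (scale E (- 1) u) = zero E"
  using scale_add[of u 1 "- 1"] by (simp add: scale_zero scale_one)

lemma plus_minus_cancel:
  "u \<in> carrier E \<Longrightarrow> v \<in> carrier E \<Longrightarrow> plus E (plus E u (scale E (- 1) v)) v = u"
  by (simp add: plus_assoc scale_in plus_commute[of "scale E (- 1) v" v] plus_minus plus_zero)

lemma norm_dist_eq:
  "u \<in> carrier E \<Longrightarrow> v \<in> carrier E \<Longrightarrow> norm_dist E u v = nrm E (plus E u (scale E (- 1) v))"
  by (simp add: norm_dist_def)

lemma norm_dist_zero: "u \<in> carrier E \<Longrightarrow> norm_dist E u (zero E) = nrm E u"
  using plus_minus_cancel[of u "zero E"] by (simp add: norm_dist_eq zero_in plus_zero plus_in scale_in)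

lemma norm_dist_commute: "norm_dist E u v = norm_dist E v u"
proof (cases "u \<in> carrier E \<and> v \<in> carrier E")
  case True
  then have "plus E v (scale E (- 1) u) = scale E (- 1) (plus E u (scale E (- 1) v))"
    using scale_mult[of v "- 1" "- 1"]
    by (simp add: scale_plus scale_in scale_one plus_commute)
  then show ?thesis using True by (simp add: norm_dist_eq nrm_scale plus_in scale_in)
qed (auto simp: norm_dist_def)

lemma norm_dist_triangle:
  assumes "u \<in> carrier E" "v \<in> carrier E" "w \<in> carrier E"
  shows "norm_dist E u w \<le> norm_dist E u v + norm_dist E v w"
proof -
  let ?v = "plus E v (scale E (- 1) w)"
  have "plus E u (scale E (- 1) w) = plus E (plus E (plus E u (scale E (- 1) v)) v) (scale E (- 1) w)"
    using assms by (simp add: plus_minus_cancel)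
  also have "\<dots> = plus E (plus E u (scale E (- 1) v)) ?v"
    using assms by (simp add: plus_assoc plus_in scale_in)
  finally show ?thesis
    using assms nrm_plus by (simp add: norm_dist_eq plus_in scale_in)
qed

sublocale Metric_space "carrier E" "norm_dist E"
proof
  show "0 \<le> norm_dist E u v" for u v
    by (simp add: norm_dist_def nrm_nonneg plus_in scale_in)
  show "norm_dist E u v = 0 \<longleftrightarrow> u = v" if "u \<in> carrier E" "v \<in> carrier E" for u v
    using that plus_minus_cancel[of u v] zero_plus[of v] plus_minus[of u]
    by (auto simp: norm_dist_eq nrm_eq_0 plus_in scale_in)
qed (auto simp: norm_dist_commute norm_dist_triangle)

lemma norm_dist_plus:
  assumes "u \<in> carrier E" "v \<in> carrier E" "u' \<in> carrier E" "v' \<in> carrier E"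
  shows "norm_dist E (plus E u v) (plus E u' v') \<le> norm_dist E u u' + norm_dist E v v'"
proof -
  have "plus E (plus E u v) (scale E (- 1) (plus E u' v')) =
      plus E (plus E u (scale E (- 1) u')) (plus E v (scale E (- 1) v'))"
    using assms by (simp add: scale_plus plus_assoc plus_left_commute[of v] plus_in scale_in)
  then show ?thesis
    using assms nrm_plus by (simp add: norm_dist_eq plus_in scale_in)
qed

lemma norm_dist_scale:
  assumes "u \<in> carrier E" "v \<in> carrier E"
  shows "norm_dist E (scale E a u) (scale E a v) = cmod a * norm_dist E u v"
proof -
  have "plus E (scale E a u) (scale E (- 1) (scale E a v)) = scale E a (plus E u (scale E (- 1) v))"
    using assms scale_mult[of v "- 1" a] scale_mult[of v a "- 1"] by (simp add: scale_plus scale_in)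
  then show ?thesis
    using assms by (simp add: norm_dist_eq nrm_scale plus_in scale_in)
qed

lemma closure_of_range_eq_carrier_iff:
  assumes "range f \<subseteq> carrier E"
  shows "norm_topology E closure_of range f = carrier E \<longleftrightarrow>
    (\<forall>u\<in>carrier E. \<forall>r>0. \<exists>n. norm_dist E u (f n) < r)"
proof -
  have "f n \<in> carrier E" for n using assms by auto
  then show ?thesis unfolding norm_topology_def metric_closure_of by auto
qed

end

section \<open>Fields of subspaces\<close>

lemma norm_dist_subspace:
  "norm_dist (C_cantor\<lparr>carrier := K\<rparr>) u v = (if u \<in> K \<and> v \<in> K then dist u v else 0)"
proof -
  have "norm (u + scale C_cantor (- 1) v) = dist u v"
    by (simp only: scale_C_cantor_minus_one dist_norm diff_conv_add_uminus)
  then show ?thesis by (simp add: norm_dist_def)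
qed

lemma normed_carrier_subspace:
  assumes K: "K \<in> closed_subspaces C_cantor"
  shows "normed_carrier (C_cantor\<lparr>carrier := K\<rparr>)"
proof
  have K': "0 \<in> K" "\<And>u v. u \<in> K \<Longrightarrow> v \<in> K \<Longrightarrow> u + v \<in> K"
    "\<And>a u. u \<in> K \<Longrightarrow> scale C_cantor a u \<in> K"
    using K by (auto simp: closed_subspaces_C_cantor_iff)
  have "- u \<in> K" if "u \<in> K" for u
    using K'(3)[OF that, of "- 1"] by (simp add: scale_C_cantor_minus_one)
  then have "\<exists>v\<in>K. u + v = 0" if "u \<in> K" for u using that by (intro bexI[of _ "- u"]) auto
  then show "complex_normed_space (C_cantor\<lparr>carrier := K\<rparr>)"
    using K'
    by (auto simp: complex_normed_space_def complex_vector_space_def scale_C_cantor_add_right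
        scale_C_cantor_add_left scale_C_cantor_scale scale_C_cantor_one norm_scale_C_cantor
        algebra_simps norm_triangle_ineq)
qed

text \<open>A Castaing representation of \<open>K\<close>: all pairs of a starting index and an
  accuracy are enumerated. The formula involves \<open>K\<close> only through its code, which makes
  the selection Borel in \<open>K\<close>.\<close>

lemma dense_selection_subspace:
  fixes K
  defines "\<sigma> \<equiv> (\<lambda>k. C_cantor.select (\<lambda>n. infdist (C_cantor_seq n) K) (fst (prod_decode k)) (snd (prod_decode k)))"
  assumes K: "K \<in> closed_subspaces C_cantor"
  shows "range \<sigma> \<subseteq> K" and "norm_topology (C_cantor\<lparr>carrier := K\<rparr>) closure_of range \<sigma> = K"
proof -
  interpret normed_carrier "C_cantor\<lparr>carrier := K\<rparr>" using K by (rule normed_carrier_subspace)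
  show sub: "range \<sigma> \<subseteq> K"
    using K C_cantor.select_infdist_in by (auto simp: \<sigma>_def closed_subspaces_C_cantor_iff)
  have "\<exists>k. dist u (\<sigma> k) < r" if u: "u \<in> K" and r: "0 < r" for u r
  proof -
    obtain n p where "dist u (C_cantor.select (\<lambda>n. infdist (C_cantor_seq n) K) n p) < r"
      using C_cantor.select_infdist_dense[OF u r] by blast
    then show ?thesis by (intro exI[of _ "prod_encode (n, p)"]) (simp add: \<sigma>_def)
  qed
  then show "norm_topology (C_cantor\<lparr>carrier := K\<rparr>) closure_of range \<sigma> = K"
    using sub closure_of_range_eq_carrier_iff[of \<sigma>] by (simp add: norm_dist_subspace range_subsetD[OF sub])
qed

lemma separable_banach_subspace:
  assumes K: "K \<in> closed_subspaces C_cantor"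
  shows "separable_banach_space (C_cantor\<lparr>carrier := K\<rparr>)"
proof -
  interpret normed_carrier "C_cantor\<lparr>carrier := K\<rparr>" using K by (rule normed_carrier_subspace)
  have "closed K" using K by (simp add: closed_subspaces_C_cantor_iff)
  have "mcomplete"
    unfolding mcomplete_def
  proof (intro allI impI)
    fix \<sigma> assume \<sigma>: "MCauchy \<sigma>"
    then have K: "\<sigma> n \<in> K" for n unfolding MCauchy_def by auto
    have "Cauchy \<sigma>"
      using \<sigma> unfolding MCauchy_def Cauchy_def by (simp add: norm_dist_subspace K)
    then obtain l where l: "\<sigma> \<longlonglongrightarrow> l" using complete_C_cantor unfolding complete_def by blast
    then have "l \<in> K" using \<open>closed K\<close> K closed_sequentially by blast
    then have "limitin mtopology \<sigma> l sequentially"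
      using l K unfolding limitin_metric by (simp add: norm_dist_subspace tendsto_iff)
    then show "\<exists>l. limitin mtopology \<sigma> l sequentially" ..
  qed
  moreover have "separable_space (norm_topology (C_cantor\<lparr>carrier := K\<rparr>))"
    unfolding separable_space_def
  proof (intro exI conjI)
    have top: "topspace (norm_topology (C_cantor\<lparr>carrier := K\<rparr>)) = K"
      unfolding norm_topology_def topspace_mtopology by simp
    show "range (\<lambda>k. C_cantor.select (\<lambda>n. infdist (C_cantor_seq n) K) (fst (prod_decode k)) (snd (prod_decode k)))
        \<subseteq> topspace (norm_topology (C_cantor\<lparr>carrier := K\<rparr>))"
      unfolding top by (rule dense_selection_subspace(1)[OF K])
    show "norm_topology (C_cantor\<lparr>carrier := K\<rparr>) closure_of
        range (\<lambda>k. C_cantor.select (\<lambda>n. infdist (C_cantor_seq n) K) (fst (prod_decode k)) (snd (prod_decode k)))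
        = topspace (norm_topology (C_cantor\<lparr>carrier := K\<rparr>))"
      unfolding top by (rule dense_selection_subspace(2)[OF K])
  qed simp
  ultimately show ?thesis using E by (simp add: separable_banach_space_def)
qed

text \<open>The distance is 1-Lipschitz in the point and Borel in the subspace. Passing through the
  members of a dense sequence separates the two variables.\<close>

lemma borel_measurable_infdist_joint:
  assumes f: "f \<in> borel_measurable M" and \<gamma>: "\<gamma> \<in> M \<rightarrow>\<^sub>M effros C_cantor"
  shows "(\<lambda>w. infdist (f w) (\<gamma> w)) \<in> borel_measurable M"
proof (rule borel_measurableI_less)
  fix r
  have 1[measurable]: "(\<lambda>w. dist (f w) (C_cantor_seq n)) \<in> borel_measurable M" for n
    using f C_cantor.borel_measurable_iff_dist by blast
  have 2[measurable]: "(\<lambda>w. infdist (C_cantor_seq n) (\<gamma> w)) \<in> borel_measurable M" for n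
    by (rule borel_measurable_infdist_effros[OF \<gamma>])
  have "infdist u K < r \<longleftrightarrow> (\<exists>n. dist u (C_cantor_seq n) + infdist (C_cantor_seq n) K < r)" for u K
  proof
    assume *: "infdist u K < r"
    obtain n where "dist u (C_cantor_seq n) < (r - infdist u K) / 2"
      using C_cantor.dense[of "(r - infdist u K) / 2" u] * by auto
    then show "\<exists>n. dist u (C_cantor_seq n) + infdist (C_cantor_seq n) K < r"
      using infdist_triangle[of "C_cantor_seq n" K u]
      by (intro exI[of _ n]) (simp add: dist_commute field_simps)
  next
    assume "\<exists>n. dist u (C_cantor_seq n) + infdist (C_cantor_seq n) K < r"
    then obtain n where "dist u (C_cantor_seq n) + infdist (C_cantor_seq n) K < r" ..
    then show "infdist u K < r" using infdist_triangle[of u K "C_cantor_seq n"] by linarith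
  qed
  then have "{w \<in> space M. infdist (f w) (\<gamma> w) < r} =
      {w \<in> space M. \<exists>n. dist (f w) (C_cantor_seq n) + infdist (C_cantor_seq n) (\<gamma> w) < r}" by simp
  also have "\<dots> \<in> sets M" by measurable
  finally show "{w \<in> space M. infdist (f w) (\<gamma> w) < r} \<in> sets M" .
qed

lemma subspace_field_simps [simp]:
  "base (subspace_field E Y \<gamma>) = Y"
  "fibre (subspace_field E Y \<gamma>) = (\<lambda>y. E\<lparr>carrier := \<gamma> y\<rparr>)"
  "total_space (subspace_field E Y \<gamma>) =
     restrict_space (Y \<Otimes>\<^sub>M borel_of (norm_topology E)) {(y, u). u \<in> \<gamma> y}"
  by (simp_all add: subspace_field_def)

theorem borel_banach_field_subspace_field:
  fixes Y :: "'y measure"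
  assumes Y: "standard_borel Y" and \<gamma>: "\<gamma> \<in> Y \<rightarrow>\<^sub>M effros C_cantor"
  shows "borel_banach_field (subspace_field C_cantor Y \<gamma>)"
proof -
  let ?V = "subspace_field C_cantor Y \<gamma>"
  let ?T = "total_space ?V"
  have T: "?T = restrict_space (Y \<Otimes>\<^sub>M borel) {(y, u). u \<in> \<gamma> y}"
    by (simp add: borel_of_C_cantor)
  have sub: "\<gamma> y \<in> closed_subspaces C_cantor" if "y \<in> space Y" for y
    using measurable_space[OF \<gamma> that] by (simp add: space_effros)
  then have K: "closed (\<gamma> y)" "0 \<in> \<gamma> y" "\<And>u v. u \<in> \<gamma> y \<Longrightarrow> v \<in> \<gamma> y \<Longrightarrow> u + v \<in> \<gamma> y"
    "\<And>a u. u \<in> \<gamma> y \<Longrightarrow> scale C_cantor a u \<in> \<gamma> y" if "y \<in> space Y" for y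
    using that by (auto simp: closed_subspaces_C_cantor_iff)
  have space_T: "space ?T = {(y, u). y \<in> space Y \<and> u \<in> \<gamma> y}"
    unfolding T by (auto simp: space_restrict_space space_pair_measure)
  have fst_T: "fst \<in> ?T \<rightarrow>\<^sub>M Y" and snd_T: "snd \<in> borel_measurable ?T"
    unfolding T by (auto intro: measurable_restrict_space1)
  \<comment> \<open>A map into the total space is Borel if its components are and its values lie in
    the fibres; addition, scalar multiplication and sections are all handled in this form.\<close>
  have into_T: "h \<in> M \<rightarrow>\<^sub>M ?T"
    if "(\<lambda>w. fst (h w)) \<in> M \<rightarrow>\<^sub>M Y" "(\<lambda>w. snd (h w)) \<in> borel_measurable M"
      "\<And>w. w \<in> space M \<Longrightarrow> snd (h w) \<in> \<gamma> (fst (h w))"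
    for h and M :: "'z measure"
    unfolding T using that
    by (intro measurable_restrict_space2) (auto simp: measurable_pair_iff comp_def case_prod_beta)
  \<comment> \<open>The graph of \<open>\<gamma>\<close> is the zero set of the distance from the
    fibre, since the fibres are closed and nonempty.\<close>
  have "{(y, u). u \<in> \<gamma> y} \<inter> space (Y \<Otimes>\<^sub>M borel) =
      {z \<in> space (Y \<Otimes>\<^sub>M borel). infdist (snd z) (\<gamma> (fst z)) = 0}"
    using K(1,2) in_closed_iff_infdist_zero by (fastforce simp: space_pair_measure)
  also have "\<dots> \<in> sets (Y \<Otimes>\<^sub>M borel)"
  proof -
    have [measurable]: "(\<lambda>z. infdist (snd z) (\<gamma> (fst z))) \<in> borel_measurable (Y \<Otimes>\<^sub>M borel)"
      by (intro borel_measurable_infdist_joint measurable_compose[OF _ \<gamma>]) auto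
    show ?thesis by measurable
  qed
  finally have std: "standard_borel ?T"
    unfolding T by (intro standard_borel_restrict_space standard_borel_pair Y C_cantor.standard_borel)
  have nrm: "(\<lambda>(y, v). nrm (fibre ?V y) v) \<in> ?T \<rightarrow>\<^sub>M restrict_space borel {0..}"
  proof (rule measurable_restrict_space2)
    have "norm \<in> borel_measurable (borel :: (cantor \<Rightarrow>\<^sub>C complex) measure)"
      by (intro borel_measurable_continuous_onI continuous_intros)
    from measurable_compose[OF snd_T this]
    show "(\<lambda>(y, v). nrm (fibre ?V y) v) \<in> borel_measurable ?T"
      by (simp add: case_prod_beta)
  qed auto
  have fst1: "(\<lambda>p. fst (fst p)) \<in> fibre_product ?V \<rightarrow>\<^sub>M Y"
    and snd1: "(\<lambda>p. snd (fst p)) \<in> borel_measurable (fibre_product ?V)"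
    and snd2: "(\<lambda>p. snd (snd p)) \<in> borel_measurable (fibre_product ?V)"
    unfolding fibre_product_def
    by (intro measurable_restrict_space1 measurable_compose[OF measurable_fst] measurable_compose[OF measurable_snd]
        fst_T snd_T)+
  have "(\<lambda>p. (fst (fst p), snd (fst p) + snd (snd p))) \<in> fibre_product ?V \<rightarrow>\<^sub>M ?T"
  proof (rule into_T)
    fix p assume "p \<in> space (fibre_product ?V)"
    then have "fst p \<in> space ?T" "snd p \<in> space ?T" "fst (fst p) = fst (snd p)"
      by (auto simp: fibre_product_def space_restrict_space space_pair_measure)
    then show "snd (fst (fst p), snd (fst p) + snd (snd p)) \<in> \<gamma> (fst (fst (fst p), snd (fst p) + snd (snd p)))"
      unfolding space_T using K(3) by auto
  qed (use fst1 snd1 snd2 in auto)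
  then have plus: "(\<lambda>((y, v), (z, w)). (y, plus (fibre ?V y) v w)) \<in> fibre_product ?V \<rightarrow>\<^sub>M ?T"
    by (simp add: case_prod_unfold)
  have "(\<lambda>z. (fst (snd z), scale C_cantor (fst z) (snd (snd z)))) \<in> borel \<Otimes>\<^sub>M ?T \<rightarrow>\<^sub>M ?T"
  proof (rule into_T)
    fix z :: "complex \<times> 'y \<times> (cantor \<Rightarrow>\<^sub>C complex)"
    assume "z \<in> space (borel \<Otimes>\<^sub>M ?T)"
    then have "snd z \<in> space ?T" by (auto simp: space_pair_measure)
    then show "snd (fst (snd z), scale C_cantor (fst z) (snd (snd z))) \<in>
        \<gamma> (fst (fst (snd z), scale C_cantor (fst z) (snd (snd z))))"
      unfolding space_T using K(4) by auto
  next
    show "(\<lambda>z. fst (fst (snd z), scale C_cantor (fst z) (snd (snd z)))) \<in> borel \<Otimes>\<^sub>M ?T \<rightarrow>\<^sub>M Y"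
      unfolding fst_conv by (rule measurable_compose[OF measurable_snd fst_T])
    show "(\<lambda>z. snd (fst (snd z), scale C_cantor (fst z) (snd (snd z)))) \<in> borel_measurable (borel \<Otimes>\<^sub>M ?T)"
      unfolding snd_conv
      by (intro borel_measurable_scale_C_cantor measurable_fst measurable_compose[OF measurable_snd snd_T])
  qed
  then have scale: "(\<lambda>(a, (y, v)). (y, scale (fibre ?V y) a v)) \<in> borel \<Otimes>\<^sub>M ?T \<rightarrow>\<^sub>M ?T"
    by (simp add: case_prod_unfold)
  let ?\<sigma> = "\<lambda>k y. C_cantor.select (\<lambda>n. infdist (C_cantor_seq n) (\<gamma> y)) (fst (prod_decode k)) (snd (prod_decode k))"
  have "dense_sections ?V (\<lambda>k y. (y, ?\<sigma> k y))"
    unfolding dense_sections_def borel_section_def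
  proof (intro conjI allI ballI)
    fix k
    have "(\<lambda>y. (y, ?\<sigma> k y)) \<in> Y \<rightarrow>\<^sub>M ?T"
    proof (rule into_T)
      show "(\<lambda>y. snd (y, ?\<sigma> k y)) \<in> borel_measurable Y"
        unfolding snd_conv
        by (intro C_cantor.measurable_select borel_measurable_infdist_effros \<gamma> C_cantor.reachable_infdist)
           (use K(2) in auto)
      show "snd (y, ?\<sigma> k y) \<in> \<gamma> (fst (y, ?\<sigma> k y))" if "y \<in> space Y" for y
        using dense_selection_subspace(1)[OF sub[OF that]] by auto
    qed simp
    then show "(\<lambda>y. (y, ?\<sigma> k y)) \<in> base ?V \<rightarrow>\<^sub>M ?T" by simp
  next
    fix y assume "y \<in> space (base ?V)"
    then show "norm_topology (fibre ?V y) closure_of range (\<lambda>k. snd (y, ?\<sigma> k y)) = carrier (fibre ?V y)"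
      using dense_selection_subspace(2)[OF sub[of y]] by simp
  qed simp
  then show ?thesis
    unfolding borel_banach_field_def
    using Y std fst_T nrm plus scale separable_banach_subspace[OF sub] space_T by auto
qed

section \<open>The Hahn-Banach theorem\<close>

locale complex_space = vector_space cs for cs :: "complex \<Rightarrow> 'b::ab_group_add \<Rightarrow> 'b"
begin

definition sublinear :: "('b \<Rightarrow> real) \<Rightarrow> bool" where
  "sublinear q \<longleftrightarrow> (\<forall>x y. q (x + y) \<le> q x + q y) \<and> (\<forall>t x. 0 \<le> t \<longrightarrow> q (cs (of_real t) x) = t * q x)"

definition seminorm :: "('b \<Rightarrow> real) \<Rightarrow> bool" where
  "seminorm q \<longleftrightarrow> (\<forall>x y. q (x + y) \<le> q x + q y) \<and> (\<forall>a x. q (cs a x) = cmod a * q x)"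

lemma seminorm_imp_sublinear: "seminorm q \<Longrightarrow> sublinear q"
  by (auto simp: seminorm_def sublinear_def)

lemma seminormD:
  assumes "seminorm q"
  shows "q (x + y) \<le> q x + q y" "q (cs a x) = cmod a * q x" "q 0 = 0" "q (- x) = q x" "0 \<le> q x"
    "q (x - y) \<le> q x + q y" "q x \<le> q y + q (x - y)"
proof -
  show 1: "q (x + y) \<le> q x + q y" for x y using assms by (simp add: seminorm_def)
  show 2: "q (cs a x) = cmod a * q x" for a x using assms by (simp add: seminorm_def)
  show 3: "q 0 = 0" using 2[of 0 0] by simp
  show 4: "q (- x) = q x" for x using 2[of "- 1" x] by simp
  show "0 \<le> q x" using 1[of x "- x"] by (simp add: 3 4)
  show "q (x - y) \<le> q x + q y" using 1[of x "- y"] by (simp add: 4)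
  show "q x \<le> q y + q (x - y)" using 1[of y "x - y"] by simp
qed

text \<open>For t > 0 the reverse inequality is the assumed one for 1 / t.\<close>

lemma sublinearI:
  assumes add: "\<And>x y. q (x + y) \<le> q x + q y" and 0: "q 0 = 0"
    and scale: "\<And>t x. 0 < t \<Longrightarrow> q (cs (of_real t) x) \<le> t * q x"
  shows "sublinear q"
proof -
  have "q (cs (of_real t) x) = t * q x" if t: "0 < t" for t x
  proof (rule order_antisym)
    have "q (cs (of_real (1 / t)) (cs (of_real t) x)) \<le> 1 / t * q (cs (of_real t) x)"
      using t by (intro scale) simp
    then show "t * q x \<le> q (cs (of_real t) x)" using t by (simp add: field_simps flip: of_real_mult)
  qed (rule scale[OF t])
  then have "q (cs (of_real t) x) = t * q x" if "0 \<le> t" for t x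
    using that 0 by (cases "t = 0") auto
  then show ?thesis using add by (simp add: sublinear_def)
qed

lemma sublinear_0: "sublinear q \<Longrightarrow> q 0 = 0"
  unfolding sublinear_def by (metis mult_zero_left of_real_0 order_refl scale_zero_left)

lemma sublinear_ge:
  assumes "sublinear q"
  shows "- q (- x) \<le> q x"
proof -
  have "q (x + - x) \<le> q x + q (- x)" using assms unfolding sublinear_def by blast
  then show ?thesis using sublinear_0[OF assms] by simp
qed

text \<open>Downward directedness is what makes the infimum subadditive: two members of the family
  can be replaced by a single smaller one.\<close>

lemma sublinear_INF:
  assumes I: "I \<noteq> {}" and q: "\<And>i. i \<in> I \<Longrightarrow> sublinear (q i)"
    and bdd: "\<And>x. bdd_below ((\<lambda>i. q i x) ` I)"
    and dir: "\<And>i j. i \<in> I \<Longrightarrow> j \<in> I \<Longrightarrow> \<exists>k\<in>I. \<forall>x. q k x \<le> q i x \<and> q k x \<le> q j x"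
  shows "sublinear (\<lambda>x. INF i\<in>I. q i x)"
proof (rule sublinearI)
  have lower: "(INF i\<in>I. q i x) \<le> q i x" if "i \<in> I" for i x using bdd that by (rule cINF_lower)
  have "(INF i\<in>I. q i 0) = (INF i\<in>I. 0)" using sublinear_0[OF q] by (intro INF_cong) auto
  then show "(INF i\<in>I. q i 0) = 0" using I by simp
  show "(INF i\<in>I. q i (cs (of_real t) x)) \<le> t * (INF i\<in>I. q i x)" if t: "0 < t" for t x
  proof -
    have "(INF i\<in>I. q i (cs (of_real t) x)) / t \<le> q i x" if "i \<in> I" for i
      using lower[OF that, of "cs (of_real t) x"] q[OF that] t by (simp add: sublinear_def field_simps)
    then have "(INF i\<in>I. q i (cs (of_real t) x)) / t \<le> (INF i\<in>I. q i x)"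
      using I by (intro cINF_greatest)
    then show ?thesis using t by (simp add: field_simps)
  qed
  fix x y
  have "(INF i\<in>I. q i (x + y)) \<le> q i x + q j y" if ij: "i \<in> I" "j \<in> I" for i j
  proof -
    obtain k where k: "k \<in> I" "\<forall>x. q k x \<le> q i x \<and> q k x \<le> q j x" using dir[OF ij] by blast
    have "(INF i\<in>I. q i (x + y)) \<le> q k (x + y)" using k(1) by (rule lower)
    also have "\<dots> \<le> q k x + q k y" using q[OF k(1)] by (simp add: sublinear_def)
    also have "\<dots> \<le> q i x + q j y" using k(2) by (intro add_mono) auto
    finally show ?thesis .
  qed
  then have "(INF i\<in>I. q i (x + y)) - q j y \<le> (INF i\<in>I. q i x)" if "j \<in> I" for j
    using I that by (intro cINF_greatest) (auto simp: algebra_simps)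
  then have "(INF i\<in>I. q i (x + y)) - (INF i\<in>I. q i x) \<le> (INF i\<in>I. q i y)"
    using I by (intro cINF_greatest) (auto simp: algebra_simps)
  then show "(INF i\<in>I. q i (x + y)) \<le> (INF i\<in>I. q i x) + (INF i\<in>I. q i y)" by simp
qed

text \<open>The device of the minimal-functional proof of the Hahn-Banach theorem: a sublinear
  functional below \<open>q\<close> whose value at \<open>- x\<close> is at most
  \<open>- q x\<close>, as the case t = 1 shows.\<close>

definition push :: "('b \<Rightarrow> real) \<Rightarrow> 'b \<Rightarrow> 'b \<Rightarrow> real" where
  "push q x z = (INF t\<in>{0..}. q (z + cs (of_real t) x) - t * q x)"

lemma push:
  assumes q: "sublinear q"
  shows "sublinear (push q x)" "push q x z \<le> q z" "push q x z \<le> q (z + x) - q x"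
proof -
  have add: "q (u + v) \<le> q u + q v" for u v using q by (simp add: sublinear_def)
  have scale: "q (cs (of_real t) u) = t * q u" if "0 \<le> t" for t u using q that by (simp add: sublinear_def)
  have ge: "- q (- z) \<le> q (z + cs (of_real t) x) - t * q x" if "0 \<le> t" for t z
    using add[of "z + cs (of_real t) x" "- z"] by (simp add: scale[OF that])
  have lower: "push q x z \<le> q (z + cs (of_real t) x) - t * q x" if "0 \<le> t" for t z
    unfolding push_def using ge that by (intro cINF_lower bdd_belowI2[of _ "- q (- z)"]) auto
  show "push q x z \<le> q z" using lower[of 0 z] by simp
  show "push q x z \<le> q (z + x) - q x" using lower[of 1 z] by simp
  show "sublinear (push q x)"
  proof (rule sublinearI)
    have "push q x 0 = (INF t\<in>{0::real..}. 0)"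
      unfolding push_def by (intro INF_cong) (auto simp: scale)
    also have "\<dots> = 0" by (rule cINF_const) auto
    finally show "push q x 0 = 0" .
    show "push q x (cs (of_real t) z) \<le> t * push q x z" if t: "0 < t" for t z
    proof -
      have "push q x (cs (of_real t) z) / t \<le> q (z + cs (of_real r) x) - r * q x" if r: "r \<in> {0..}" for r
      proof -
        have "push q x (cs (of_real t) z) \<le> q (cs (of_real t) z + cs (of_real (t * r)) x) - t * r * q x"
          using lower[of "t * r" "cs (of_real t) z"] r t by simp
        also have "cs (of_real t) z + cs (of_real (t * r)) x = cs (of_real t) (z + cs (of_real r) x)"
          by (simp add: scale_right_distrib)
        also have "q \<dots> = t * q (z + cs (of_real r) x)" using t by (intro scale) simp
        finally show ?thesis using t by (simp add: field_simps)
      qed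
      then have "push q x (cs (of_real t) z) / t \<le> push q x z"
        unfolding push_def[of q x z] by (intro cINF_greatest) auto
      then show ?thesis using t by (simp add: field_simps)
    qed
    fix z w
    have le: "push q x (z + w) \<le> (q (z + cs (of_real t) x) - t * q x) + (q (w + cs (of_real r) x) - r * q x)"
      if "t \<in> {0..}" "r \<in> {0..}" for t r
    proof -
      have "push q x (z + w) \<le> q (z + w + cs (of_real (t + r)) x) - (t + r) * q x"
        using that by (intro lower) simp
      also have "z + w + cs (of_real (t + r)) x = (z + cs (of_real t) x) + (w + cs (of_real r) x)"
        by (simp add: scale_left_distrib)
      finally show ?thesis
        using add[of "z + cs (of_real t) x" "w + cs (of_real r) x"] by (simp add: algebra_simps)
    qed
    have "push q x (z + w) - (q (w + cs (of_real r) x) - r * q x) \<le> push q x z" if "r \<in> {0..}" for r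
      unfolding push_def[of q x z] using le[OF _ that] by (intro cINF_greatest) (auto simp: algebra_simps)
    then have "push q x (z + w) - push q x z \<le> push q x w"
      unfolding push_def[of q x w] by (intro cINF_greatest) (auto simp: algebra_simps)
    then show "push q x (z + w) \<le> push q x z + push q x w" by simp
  qed
qed

text \<open>A minimal sublinear functional is linear, since pushing it in any direction does not
  decrease it.\<close>

lemma sublinear_dominates_linear:
  assumes p: "sublinear p"
  obtains f where "\<And>x y. f (x + y) = f x + f y" "\<And>t x. f (cs (of_real t) x) = t * f x" "\<And>x. f x \<le> p x"
proof -
  define A where "A = {q. sublinear q \<and> (\<forall>x. q x \<le> p x)}"
  define P :: "('b \<Rightarrow> real) \<Rightarrow> ('b \<Rightarrow> real) \<Rightarrow> bool" where "P = (\<lambda>q r. \<forall>x. r x \<le> q x)"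
  \<comment> \<open>\<open>P\<close> is the reversed pointwise order, so that Zorn's lemma yields a
    minimal element; a nonempty chain is bounded by its pointwise infimum.\<close>
  have "\<exists>m\<in>A. \<forall>q\<in>A. P m q \<longrightarrow> q = m"
  proof (rule predicate_Zorn)
    have "transp P" "reflp P" "antisymp P"
      unfolding P_def by (auto intro!: transpI reflpI antisympI ext intro: order_trans order_antisym)
    then show "partial_order_on A (relation_of P A)"
      by (auto simp: partial_order_on_def preorder_on_def relation_of_def refl_on_def trans_def antisym_def
          transp_def reflp_def antisymp_def)
    fix C assume C: "C \<in> Chains (relation_of P A)"
    then have CA: "C \<subseteq> A" by (auto simp: Chains_def relation_of_def)
    show "\<exists>u\<in>A. \<forall>q\<in>C. P q u"
    proof (cases "C = {}")
      case True
      then show ?thesis using p by (intro bexI[of _ p]) (auto simp: A_def)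
    next
      case False
      have "- p (- x) \<le> q x" if "q \<in> C" for q x
      proof -
        have "sublinear q" "q (- x) \<le> p (- x)" using CA that by (auto simp: A_def)
        then show ?thesis using sublinear_ge[of q x] by linarith
      qed
      then have bdd: "bdd_below ((\<lambda>q. q x) ` C)" for x by (intro bdd_belowI2)
      have "sublinear (\<lambda>x. INF q\<in>C. q x)"
      proof (rule sublinear_INF[OF False _ bdd])
        show "sublinear q" if "q \<in> C" for q using CA that by (auto simp: A_def)
        show "\<exists>k\<in>C. \<forall>x. k x \<le> q x \<and> k x \<le> r x" if qr: "q \<in> C" "r \<in> C" for q r
        proof -
          have "P q r \<or> P r q" using C qr by (auto simp: Chains_def relation_of_def)
          then show ?thesis using qr unfolding P_def by auto
        qed
      qed
      moreover have lower: "(INF q\<in>C. q x) \<le> q x" if "q \<in> C" for q x using bdd that by (rule cINF_lower)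
      moreover have "(INF q\<in>C. q x) \<le> p x" for x
      proof -
        obtain q where q: "q \<in> C" using False by blast
        then have "q x \<le> p x" using CA by (auto simp: A_def)
        then show ?thesis using lower[OF q, of x] by linarith
      qed
      ultimately show ?thesis by (intro bexI[of _ "\<lambda>x. INF q\<in>C. q x"]) (auto simp: A_def P_def)
    qed
  qed
  then obtain f where f: "f \<in> A" and min: "\<And>q. q \<in> A \<Longrightarrow> P f q \<Longrightarrow> q = f" by blast
  then have sub: "sublinear f" and fp: "f x \<le> p x" for x by (auto simp: A_def)
  have "push f x = f" for x
  proof (rule min)
    show "P f (push f x)" using push(2)[OF sub] by (simp add: P_def)
    show "push f x \<in> A"
      using push(1)[OF sub] order_trans[OF push(2)[OF sub] fp] by (simp add: A_def)
  qed
  \<comment> \<open>This is superadditivity of \<open>f\<close>, the half of additivity that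
    sublinearity does not give.\<close>
  then have "f z \<le> f (z + x) - f x" for x z using push(3)[OF sub, of x z] by simp
  then have add: "f (x + y) = f x + f y" for x y
    using sub by (intro order_antisym) (auto simp: sublinear_def le_diff_eq)
  have minus: "f (- x) = - f x" for x using add[of x "- x"] sublinear_0[OF sub] by simp
  have "f (cs (of_real t) x) = t * f x" for t x
  proof (cases "0 \<le> t")
    case False
    then have "f (cs (of_real (- t)) x) = - t * f x" using sub by (simp only: sublinear_def)
    then show ?thesis using minus[of "cs (of_real t) x"] by simp
  qed (use sub in \<open>simp add: sublinear_def\<close>)
  then show ?thesis using add fp that by blast
qed

text \<open>Dominating by \<open>push N x0\<close> instead of \<open>N\<close> builds in that the
  value at \<open>- x0\<close> is at most \<open>- N x0\<close>; this takes the place of the usual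
  extension from the line through \<open>x0\<close>.\<close>

theorem norming_functional:
  assumes N: "seminorm N"
  obtains \<omega> where "\<And>x y. \<omega> (x + y) = \<omega> x + \<omega> y" "\<And>a x. \<omega> (cs a x) = a * \<omega> x"
    "\<And>x. cmod (\<omega> x) \<le> N x" "cmod (\<omega> x0) = N x0"
proof -
  note sub = seminorm_imp_sublinear[OF N]
  obtain f where add: "\<And>x y. f (x + y) = f x + f y" and scale: "\<And>t x. f (cs (of_real t) x) = t * f x"
    and le: "\<And>x. f x \<le> push N x0 x"
    by (rule sublinear_dominates_linear[OF push(1)[OF sub, of x0]]) blast
  have fN: "f x \<le> N x" for x using le push(2)[OF sub] order_trans by blast
  have minus: "f (- x) = - f x" for x using scale[of "- 1" x] by simp
  have "f (- x0) \<le> N (- x0 + x0) - N x0" using le push(3)[OF sub] order_trans by blast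
  then have "N x0 \<le> f x0" using sublinear_0[OF sub] by (simp add: minus)
  \<comment> \<open>A complex linear functional with real part f is x \<mapsto> f(x) - i f(i
    x).\<close>
  define \<omega> where "\<omega> x = Complex (f x) (- f (cs \<i> x))" for x
  have \<omega>_add: "\<omega> (x + y) = \<omega> x + \<omega> y" for x y
    by (simp add: \<omega>_def complex_eq_iff add scale_right_distrib)
  have f_cs: "f (cs a x) = Re a * f x + Im a * f (cs \<i> x)" for a x
  proof -
    have "cs a x = cs (of_real (Re a)) x + cs (of_real (Im a)) (cs \<i> x)"
      using complex_eq[of a] by (simp add: scale_left_distrib[symmetric] mult.commute)
    then show ?thesis by (simp only: add scale)
  qed
  have \<omega>_cs: "\<omega> (cs a x) = a * \<omega> x" for a x
    unfolding \<omega>_def complex_eq_iff using f_cs[of a x] f_cs[of "\<i> * a" x] by (simp add: algebra_simps)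
  have \<omega>_le: "cmod (\<omega> x) \<le> N x" for x
  proof (cases "\<omega> x = 0")
    case True
    then show ?thesis using seminormD(5)[OF N] by simp
  next
    case False
    \<comment> \<open>Multiplication by this number of modulus 1 rotates \<open>\<omega> x\<close>
      onto the positive real axis, where the bound on the real part applies.\<close>
    define c where "c = cnj (\<omega> x) / cmod (\<omega> x)"
    have c: "cmod c = 1" using False by (simp add: c_def norm_divide)
    have "c * \<omega> x = of_real (cmod (\<omega> x))"
      using False by (simp add: c_def complex_norm_square[symmetric] power2_eq_square mult.commute[of "cnj _"])
    then have "cmod (\<omega> x) = Re (\<omega> (cs c x))" by (simp add: \<omega>_cs)
    also have "\<dots> = f (cs c x)" by (simp add: \<omega>_def)
    also have "\<dots> \<le> N (cs c x)" by (rule fN)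
    also have "\<dots> = N x" using seminormD(2)[OF N, of c x] c by simp
    finally show ?thesis .
  qed
  have "N x0 \<le> Re (\<omega> x0)" using \<open>N x0 \<le> f x0\<close> by (simp add: \<omega>_def)
  then have "cmod (\<omega> x0) = N x0" using \<omega>_le[of x0] complex_Re_le_cmod[of "\<omega> x0"] by linarith
  then show ?thesis using that \<omega>_add \<omega>_cs \<omega>_le by blast
qed

end

section \<open>Linear combinations as polynomials\<close>

text \<open>The polynomial with coefficients \<open>a k\<close> stands for the formal linear combination of
  generators with these coefficients.\<close>

interpretation poly: complex_space "smult :: complex \<Rightarrow> complex poly \<Rightarrow> complex poly"
  by unfold_locales (auto simp: smult_add_right smult_add_left)

definition comb :: "(nat \<Rightarrow> complex) \<Rightarrow> complex poly \<Rightarrow> complex" where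
  "comb z p = (\<Sum>k\<le>degree p. coeff p k * z k)"

lemma comb_eq: "degree p \<le> n \<Longrightarrow> comb z p = (\<Sum>k\<le>n. coeff p k * z k)"
  unfolding comb_def by (rule sum.mono_neutral_left) (auto simp: coeff_eq_0)

lemma comb_add: "comb z (p + q) = comb z p + comb z q"
proof -
  let ?n = "max (degree p) (degree q)"
  show ?thesis
    by (simp add: comb_eq[of "p + q" ?n] comb_eq[of p ?n] comb_eq[of q ?n] degree_add_le
        sum.distrib distrib_right)
qed

lemma comb_smult: "comb z (smult a p) = a * comb z p"
  using comb_eq[of "smult a p" "degree p" z] by (simp add: comb_def degree_smult_le sum_distrib_left mult.assoc)

lemma comb_monom: "comb z (monom a k) = a * z k"
  using comb_eq[of "monom a k" k z]
  by (simp add: degree_monom_le if_distrib[of "\<lambda>c. c * _"] cong: if_cong)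

lemma seminorm_comb: "poly.seminorm (\<lambda>p. cmod (comb z p))"
  by (simp add: poly.seminorm_def comb_add comb_smult norm_mult norm_triangle_ineq)

lemma linear_eq_comb:
  assumes add: "\<And>x y. \<omega> (x + y) = \<omega> x + \<omega> y" and scale: "\<And>a x. \<omega> (smult a x) = a * \<omega> x"
  shows "\<omega> p = comb (\<lambda>k. \<omega> (monom 1 k)) p"
proof -
  have 0: "\<omega> 0 = (0 :: complex)" using scale[of 0 0] by simp
  have sum: "\<omega> (\<Sum>i\<le>n. g i) = (\<Sum>i\<le>n. \<omega> (g i))" for g and n :: nat by (induction n) (simp_all add: add)
  have "\<omega> p = \<omega> (\<Sum>i\<le>degree p. monom (coeff p i) i)" by (simp add: poly_as_sum_of_monoms)
  also have "\<dots> = (\<Sum>i\<le>degree p. \<omega> (smult (coeff p i) (monom 1 i)))" by (simp add: sum smult_monom)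
  finally show ?thesis by (simp add: scale comb_def)
qed

definition rational_poly :: "(rat \<times> rat) list \<Rightarrow> complex poly" where
  "rational_poly l = Poly (map (\<lambda>(a, b). Complex (of_rat a) (of_rat b)) l)"

text \<open>Induction on the coefficients. The seminorm is left arbitrary because the tail of the
  polynomial is measured in the seminorm shifted by one degree.\<close>

lemma rational_poly_dense:
  assumes "poly.seminorm S" "0 < e"
  shows "\<exists>l. S (p - rational_poly l) < e"
  using assms
proof (induction p arbitrary: S e)
  case 0
  then show ?case by (intro exI[of _ "[]"]) (simp add: rational_poly_def poly.seminormD(3))
next
  case (pCons c p)
  note S = poly.seminormD[OF pCons.prems(1)]
  have "poly.seminorm (\<lambda>q. S (pCons 0 q))"
    unfolding poly.seminorm_def
    using S(1)[of "pCons 0 _" "pCons 0 _"] S(2)[of _ "pCons 0 _"] by simp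
  then obtain l where l: "S (pCons 0 (p - rational_poly l)) < e / 2"
    using pCons.IH[of "\<lambda>q. S (pCons 0 q)" "e / 2"] pCons.prems(2) by auto
  have "0 < e / 2 / (S 1 + 1)" using pCons.prems(2) S(5)[of 1] by (intro divide_pos_pos) auto
  then obtain a b where ab: "dist c (Complex (of_rat a) (of_rat b)) < e / 2 / (S 1 + 1)"
    by (rule complex_rational_approx)
  let ?d = "c - Complex (of_rat a) (of_rat b)"
  have "pCons c p - rational_poly ((a, b) # l) = smult ?d 1 + pCons 0 (p - rational_poly l)"
    by (simp add: rational_poly_def one_pCons)
  then have "S (pCons c p - rational_poly ((a, b) # l)) \<le> S (smult ?d 1) + S (pCons 0 (p - rational_poly l))"
    by (simp only: S(1))
  also have "S (smult ?d 1) = cmod ?d * S 1" by (rule S(2))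
  also have "cmod ?d * S 1 \<le> cmod ?d * (S 1 + 1)" by (intro mult_left_mono) auto
  also have "\<dots> < e / 2"
    using ab S(5)[of 1] by (subst (asm) pos_less_divide_eq) (auto simp: dist_norm)
  finally show ?case using l by (intro exI[of _ "(a, b) # l"]) linarith
qed

text \<open>The sum of \<open>N\<close> and the modulus of \<open>comb z\<close> is a seminorm, for
  which the rational polynomials are dense; hence countably many constraints suffice to define the
  dual ball.\<close>

lemma comb_bounded_by_rational:
  assumes N: "poly.seminorm N" and le: "\<And>l. cmod (comb z (rational_poly l)) \<le> N (rational_poly l)"
  shows "cmod (comb z p) \<le> N p"
proof (rule field_le_epsilon)
  fix e :: real assume e: "0 < e"
  let ?S = "\<lambda>p. N p + cmod (comb z p)"
  have "poly.seminorm ?S"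
    using N seminorm_comb[of z] unfolding poly.seminorm_def by (simp add: algebra_simps add_mono)
      (smt (verit, best))
  then obtain l where l: "?S (p - rational_poly l) < e" using rational_poly_dense e by blast
  have "cmod (comb z p) \<le> cmod (comb z (rational_poly l)) + cmod (comb z (p - rational_poly l))"
    by (rule poly.seminormD(7)[OF seminorm_comb])
  also have "\<dots> \<le> N (rational_poly l) + cmod (comb z (p - rational_poly l))" using le by simp
  also have "N (rational_poly l) \<le> N p + N (rational_poly l - p)" by (rule poly.seminormD(7)[OF N])
  also have "N (rational_poly l - p) = N (p - rational_poly l)"
    using poly.seminormD(4)[OF N, of "p - rational_poly l"] by simp
  finally show "cmod (comb z p) \<le> N p + e" using l by linarith
qed

section \<open>A parametrized Banach-Mazur theorem\<close>

definition binary :: "cantor \<Rightarrow> real" where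
  "binary b = (\<Sum>n. of_bool (b n) / 2 ^ Suc n)"

lemma summable_binary: "summable (\<lambda>n. of_bool (b n) / 2 ^ Suc n :: real)"
  by (rule summable_comparison_test'[OF sums_summable[OF power_half_series], of 0])
     (simp add: power_one_over field_simps)

lemma continuous_binary: "continuous_on UNIV binary"
proof (rule uniform_limit_theorem)
  show "uniform_limit UNIV (\<lambda>n b. \<Sum>i<n. of_bool (b i) / 2 ^ Suc i) binary sequentially"
    unfolding binary_def[abs_def]
    by (rule Weierstrass_m_test[OF _ sums_summable[OF power_half_series]])
       (simp add: power_one_over field_simps)
  show "\<forall>\<^sub>F n in sequentially. continuous_on UNIV (\<lambda>b :: cantor. \<Sum>i<n. of_bool (b i) / 2 ^ Suc i :: real)"
    by (intro always_eventually allI continuous_on_finite_dependence sum.cong) auto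
qed simp

lemma binary_surj:
  assumes "0 \<le> r" "r < 1"
  obtains b where "binary b = r"
proof -
  \<comment> \<open>These are the usual binary digits: the partial sums are \<lfloor>2^n *
    r\<rfloor> / 2^n, starting from \<lfloor>r\<rfloor> = 0, which is where r < 1 enters.\<close>
  define b where "b n \<longleftrightarrow> odd \<lfloor>2 ^ Suc n * r\<rfloor>" for n
  have double: "\<lfloor>2 * z\<rfloor> = 2 * \<lfloor>z\<rfloor> + of_bool (odd \<lfloor>2 * z\<rfloor>)" for z :: real
  proof -
    have "\<lfloor>2 * z\<rfloor> = 2 * \<lfloor>z\<rfloor> \<or> \<lfloor>2 * z\<rfloor> = 2 * \<lfloor>z\<rfloor> + 1" by linarith
    then show ?thesis by auto
  qed
  have partial: "(\<Sum>i<n. of_bool (b i) / 2 ^ Suc i) = real_of_int \<lfloor>2 ^ n * r\<rfloor> / 2 ^ n" for n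
  proof (induction n)
    case 0
    have "\<lfloor>r\<rfloor> = 0" using assms by (simp add: floor_eq_iff)
    then show ?case by simp
  next
    case (Suc n)
    have "\<lfloor>2 ^ Suc n * r\<rfloor> = 2 * \<lfloor>2 ^ n * r\<rfloor> + of_bool (b n)"
      using double[of "2 ^ n * r"] by (simp only: b_def power_Suc mult.assoc)
    then have "real_of_int \<lfloor>2 ^ Suc n * r\<rfloor> = 2 * real_of_int \<lfloor>2 ^ n * r\<rfloor> + of_bool (b n)"
      by (simp only: of_int_add of_int_mult of_int_of_bool of_int_numeral)
    then show ?case using Suc by (simp add: add_divide_distrib)
  qed
  have "(\<lambda>n. real_of_int \<lfloor>2 ^ n * r\<rfloor> / 2 ^ n) \<longlonglongrightarrow> r"
  proof (rule tendsto_sandwich)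
    show "(\<lambda>n. r - (1/2)^n) \<longlonglongrightarrow> r"
      using tendsto_diff[OF tendsto_const LIMSEQ_power_zero[of "1/2 :: real"], of r] by simp
    show "\<forall>\<^sub>F n in sequentially. r - (1/2)^n \<le> real_of_int \<lfloor>2 ^ n * r\<rfloor> / 2 ^ n"
    proof (intro always_eventually allI)
      fix n
      have "2 ^ n * r - 1 \<le> real_of_int \<lfloor>2 ^ n * r\<rfloor>" by linarith
      then have "(2 ^ n * r - 1) / 2 ^ n \<le> real_of_int \<lfloor>2 ^ n * r\<rfloor> / 2 ^ n" by (intro divide_right_mono) auto
      then show "r - (1/2)^n \<le> real_of_int \<lfloor>2 ^ n * r\<rfloor> / 2 ^ n" by (simp add: diff_divide_distrib power_one_over)
    qed
    show "\<forall>\<^sub>F n in sequentially. real_of_int \<lfloor>2 ^ n * r\<rfloor> / 2 ^ n \<le> r"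
      by (intro always_eventually allI) (simp add: divide_le_eq mult.commute)
  qed simp
  then have "binary b = r"
    using summable_LIMSEQ[OF summable_binary[of b]] LIMSEQ_unique unfolding binary_def partial by blast
  then show ?thesis by (rule that)
qed

text \<open>The pairs (2k, i) and (2k + 1, i) index the binary digits of the real and the imaginary
  part. The map \<open>4 * r - 2\<close> sends [1/4, 3/4] to [-1, 1], so that the values required of
  a coordinate stay away from the endpoint r = 1, which \<open>binary_surj\<close> excludes.\<close>

definition coord :: "nat \<Rightarrow> cantor \<Rightarrow> complex" where
  "coord k b = Complex (4 * binary (\<lambda>i. b (prod_encode (2 * k, i))) - 2)
     (4 * binary (\<lambda>i. b (prod_encode (2 * k + 1, i))) - 2)"

lemma continuous_coord: "continuous_on UNIV (coord k)"
proof -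
  have "continuous_on UNIV (\<lambda>b :: cantor. binary (\<lambda>i. b (prod_encode (m, i))))" for m
    by (intro continuous_on_compose2[OF continuous_binary] continuous_on_coordinatewise_then_product
        continuous_on_product_coordinates) simp
  then show ?thesis unfolding coord_def[abs_def] Complex_eq by (intro continuous_intros)
qed

lemma coord_surj:
  assumes z: "\<And>k. cmod (z k) \<le> 1"
  obtains b where "\<And>k. coord k b = z k"
proof -
  have "\<exists>b. binary b = (c + 2) / 4" if "\<bar>c\<bar> \<le> 1" for c
    using that binary_surj[of "(c + 2) / 4"] by (auto simp: abs_le_iff)
  then obtain digits where digits: "\<And>c. \<bar>c\<bar> \<le> 1 \<Longrightarrow> binary (digits c) = (c + 2) / 4" by metis
  define b where "b j = (let (m, i) = prod_decode j in
    digits (if even m then Re (z (m div 2)) else Im (z (m div 2))) i)" for j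
  have "coord k b = z k" for k
    using abs_Re_le_cmod[of "z k"] abs_Im_le_cmod[of "z k"] z[of k]
    by (simp add: coord_def b_def digits complex_eq_iff add_divide_distrib)
  then show ?thesis by (rule that)
qed

text \<open>The standard retraction of the Cantor set onto a closed subset: \<open>T\<close> tells which finite words
  extend to a point of the subset, and \<open>guided\<close> follows the given point as long as \<open>T\<close> allows it.\<close>

primrec guided :: "(bool list \<Rightarrow> bool) \<Rightarrow> cantor \<Rightarrow> nat \<Rightarrow> bool list" where
  "guided T b 0 = []"
| "guided T b (Suc n) = guided T b n @ [if T (guided T b n @ [b n]) then b n else \<not> b n]"

definition tree_retract :: "(bool list \<Rightarrow> bool) \<Rightarrow> cantor \<Rightarrow> cantor" where
  "tree_retract T b n = last (guided T b (Suc n))"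

definition words :: "cantor set \<Rightarrow> bool list \<Rightarrow> bool" where
  "words C s \<longleftrightarrow> (\<exists>b\<in>C. map b [0..<length s] = s)"

lemma wordsI: "b \<in> C \<Longrightarrow> map b [0..<length s] = s \<Longrightarrow> words C s"
  by (auto simp: words_def)

lemma guided_eq_map: "guided T b n = map (tree_retract T b) [0..<n]"
  by (induction n) (simp_all add: tree_retract_def)

text \<open>By induction every guided word extends to a point of \<open>C\<close>: whenever the bit
  of \<open>b\<close> is rejected, the other one is accepted. A point all of whose initial words
  extend to points of a closed set lies in that set.\<close>

lemma tree_retract_in:
  assumes "closed C" "C \<noteq> {}"
  shows "tree_retract (words C) b \<in> C"
proof (rule ccontr)
  let ?r = "tree_retract (words C) b"
  have words: "words C (guided (words C) b n)" for n
  proof (induction n)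
    case 0
    obtain c where "c \<in> C" using assms(2) by blast
    then show ?case by (intro wordsI[of c]) simp_all
  next
    case (Suc n)
    let ?p = "guided (words C) b n"
    have len: "length ?p = n" by (simp add: guided_eq_map)
    have "\<exists>c\<in>C. map c [0..<length ?p] = ?p" using Suc by (rule words_def[THEN iffD1])
    then obtain c where c: "c \<in> C" "map c [0..<n] = ?p" unfolding len by (rule bexE)
    then have "words C (?p @ [c n])" by (intro wordsI[of c]) (simp_all add: len)
    then have "words C (?p @ [b n]) \<or> words C (?p @ [\<not> b n])" by (cases "c n = b n") auto
    then show ?case by auto
  qed
  assume "?r \<notin> C"
  then obtain m where m: "{c. \<forall>i<m. c i = ?r i} \<subseteq> - C"
    using cylinder_basis[of "- C" ?r] assms(1) by (auto simp: open_Compl)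
  have "words C (map ?r [0..<m])" using words[of m] by (simp only: guided_eq_map)
  then obtain c where c: "c \<in> C" "map c [0..<length (map ?r [0..<m])] = map ?r [0..<m]"
    by (rule words_def[THEN iffD1, THEN bexE])
  from c(2) have "\<forall>i<m. c i = ?r i"
    by (simp only: length_map length_upt map_eq_conv set_upt) simp
  then show False using m c(1) by blast
qed

lemma tree_retract_id:
  assumes "b \<in> C"
  shows "tree_retract (words C) b = b"
proof -
  have "guided (words C) b n = map b [0..<n]" for n
  proof (induction n)
    case (Suc n)
    have "words C (map b [0..<Suc n])" using assms by (intro wordsI[of b]) simp_all
    then show ?case using Suc by simp
  qed simp
  then show ?thesis by (intro ext) (simp add: tree_retract_def del: guided.simps)
qed

text \<open>The first n bits of the value depend on the first n bits of the argument alone, whatever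
  \<open>T\<close> is.\<close>

lemma continuous_tree_retract: "continuous_on UNIV (tree_retract T)"
proof (rule continuous_on_coordinatewise_then_product)
  have guided: "guided T b n = guided T c n" if "\<forall>i<n. b i = c i" for b c n
    using that by (induction n) auto
  show "continuous_on UNIV (\<lambda>b. tree_retract T b i)" for i
    unfolding tree_retract_def using guided by (intro continuous_on_finite_dependence[of "Suc i"]) metis
qed

lemma measurable_tree_retract:
  assumes T: "\<And>s. Measurable.pred M (\<lambda>w. T w s)"
  shows "(\<lambda>w. tree_retract (T w) b) \<in> borel_measurable M"
proof (rule measurable_coordinatewise_then_product)
  have guided: "(\<lambda>w. guided (T w) b n) \<in> M \<rightarrow>\<^sub>M count_space UNIV" for n
  proof (induction n)
    case (Suc n)
    have "(\<lambda>w. s @ [if T w (s @ [b n]) then b n else \<not> b n]) \<in> M \<rightarrow>\<^sub>M count_space UNIV" for s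
      using T by measurable
    from measurable_compose_countable[OF this Suc] show ?case by simp
  qed simp
  show "(\<lambda>w. tree_retract (T w) b i) \<in> borel_measurable M" for i
    unfolding tree_retract_def borel_measurable_bool_iff
    by (rule measurable_compose[OF guided]) simp
qed

text \<open>The points of \<open>dual_ball N\<close> code the functionals bounded by the seminorm \<open>N\<close>.\<close>

definition code :: "(complex poly \<Rightarrow> real) \<Rightarrow> cantor \<Rightarrow> nat \<Rightarrow> complex" where
  "code N b k = N (monom 1 k) * coord k b"

definition dual_ball :: "(complex poly \<Rightarrow> real) \<Rightarrow> cantor set" where
  "dual_ball N = {b. \<forall>l. cmod (comb (code N b) (rational_poly l)) \<le> N (rational_poly l)}"

lemma continuous_comb_code: "continuous_on UNIV (\<lambda>b. cmod (comb (code N b) p))"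
  unfolding comb_def code_def by (intro continuous_intros continuous_coord)

lemma closed_dual_ball: "closed (dual_ball N)"
  unfolding dual_ball_def by (intro closed_Collect_all closed_Collect_le continuous_comb_code continuous_on_const)

lemma dual_ball_bound: "poly.seminorm N \<Longrightarrow> b \<in> dual_ball N \<Longrightarrow> cmod (comb (code N b) p) \<le> N p"
  by (rule comb_bounded_by_rational) (simp_all add: dual_ball_def)

text \<open>The values of a norming functional on the generators, divided by the seminorms of the
  generators, lie in the unit disc and are therefore the coordinates of a point of the Cantor set.
  Where \<open>N\<close> vanishes on a generator, so does the functional, and nothing is lost by the
  convention that division by 0 gives 0.\<close>

lemma dual_ball_norming:
  assumes N: "poly.seminorm N"
  obtains b where "b \<in> dual_ball N" "cmod (comb (code N b) p) = N p"
proof -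
  obtain \<omega> where add: "\<And>x y. \<omega> (x + y) = \<omega> x + \<omega> y" and scale: "\<And>a x. \<omega> (smult a x) = a * \<omega> x"
    and le: "\<And>x. cmod (\<omega> x) \<le> N x" and eq: "cmod (\<omega> p) = N p"
    by (rule poly.norming_functional[OF N]) blast
  let ?N = "\<lambda>k. N (monom 1 k)"
  have "cmod (\<omega> (monom 1 k) / ?N k) \<le> 1" for k
    using le[of "monom 1 k"] poly.seminormD(5)[OF N, of "monom 1 k"]
    by (cases "?N k = 0") (simp_all add: norm_divide divide_le_eq)
  then obtain b where b: "\<And>k. coord k b = \<omega> (monom 1 k) / ?N k"
    using coord_surj[of "\<lambda>k. \<omega> (monom 1 k) / ?N k"] by blast
  have "code N b k = \<omega> (monom 1 k)" for k
    using le[of "monom 1 k"] by (cases "?N k = 0") (simp_all add: code_def b)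
  then have "code N b = (\<lambda>k. \<omega> (monom 1 k))" by (rule ext)
  then have "comb (code N b) q = \<omega> q" for q using linear_eq_comb[OF add scale, of q] by simp
  then show ?thesis using le eq by (intro that[of b]) (auto simp: dual_ball_def)
qed

text \<open>By compactness, a word extends to a point of the dual ball as soon as, for every \<open>m\<close>, some
  finitely supported extension satisfies the first \<open>m\<close> constraints up to an error of \<open>1 / (m + 1)\<close>.\<close>

lemma words_dual_ball_iff:
  "words (dual_ball N) s \<longleftrightarrow> (\<forall>m. \<exists>t. map (\<lambda>i. i < length t \<and> t ! i) [0..<length s] = s \<and>
     (\<forall>n<m. cmod (comb (code N (\<lambda>i. i < length t \<and> t ! i)) (rational_poly (from_nat n)))
        < N (rational_poly (from_nat n)) + 1 / real (Suc m)))" (is "?L \<longleftrightarrow> (\<forall>m. \<exists>t. ?P m t)")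
proof
  let ?g = "\<lambda>n b. cmod (comb (code N b) (rational_poly (from_nat n)))"
  let ?N = "\<lambda>n :: nat. N (rational_poly (from_nat n))"
  assume ?L
  then obtain b where b: "b \<in> dual_ball N" "map b [0..<length s] = s" by (auto simp: words_def)
  show "\<forall>m. \<exists>t. ?P m t"
  proof
    fix m
    \<comment> \<open>The slack makes the constraints strict at \<open>b\<close>; they define an
      open set and are inherited by a sufficiently long initial word of \<open>b\<close> followed by
      zeros.\<close>
    have "open (\<Inter>n\<in>{..<m}. {c. ?g n c < ?N n + 1 / real (Suc m)})"
      by (intro open_INT ballI open_Collect_less continuous_comb_code continuous_on_const) simp
    moreover have "b \<in> (\<Inter>n\<in>{..<m}. {c. ?g n c < ?N n + 1 / real (Suc m)})"
      using b(1) by (auto simp: dual_ball_def intro!: le_less_trans[of "cmod _" "N _"])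
    ultimately obtain k where k: "{c. \<forall>i<k. c i = b i} \<subseteq> (\<Inter>n\<in>{..<m}. {c. ?g n c < ?N n + 1 / real (Suc m)})"
      by (rule cylinder_basis)
    let ?k = "max k (length s)"
    let ?t = "map b [0..<?k]"
    have t: "(i < length ?t \<and> ?t ! i) = b i" if "i < ?k" for i using that by simp
    then have "(\<lambda>i. i < length ?t \<and> ?t ! i) \<in> {c. \<forall>i<k. c i = b i}" by auto
    then have constraints: "(\<lambda>i. i < length ?t \<and> ?t ! i) \<in> (\<Inter>n\<in>{..<m}. {c. ?g n c < ?N n + 1 / real (Suc m)})"
      using k by (rule rev_subsetD)
    have prefix: "map (\<lambda>i. i < length ?t \<and> ?t ! i) [0..<length s] = map b [0..<length s]"
      by (rule map_cong[OF refl]) (use t in force)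
    have "?P m ?t"
    proof (intro conjI allI impI)
      show "map (\<lambda>i. i < length ?t \<and> ?t ! i) [0..<length s] = s"
        using prefix b(2) by (rule trans)
      show "?g n (\<lambda>i. i < length ?t \<and> ?t ! i) < ?N n + 1 / real (Suc m)" if "n < m" for n
        using constraints that by blast
    qed
    then show "\<exists>t. ?P m t" by (rule exI[of "?P m" ?t])
  qed
next
  let ?g = "\<lambda>n b. cmod (comb (code N b) (rational_poly (from_nat n)))"
  let ?N = "\<lambda>n :: nat. N (rational_poly (from_nat n))"
  assume R: "\<forall>m. \<exists>t. ?P m t"
  \<comment> \<open>With weak inequalities the relaxed constraints define a decreasing sequence of
    nonempty compact sets; a common point satisfies the constraints without error.\<close>
  define C where "C m = {b. \<forall>i<length s. b i = s ! i} \<inter> (\<Inter>n\<in>{..<m}. {b. ?g n b \<le> ?N n + 1 / real (Suc m)})" for m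
  have closed: "closed (C m)" for m
  proof -
    have "closed {b :: cantor. \<forall>i<length s. b i = s ! i}"
      by (intro closed_Collect_all closed_Collect_imp closed_Collect_eq continuous_on_product_coordinates
          continuous_on_const) simp
    moreover have "closed {b. ?g n b \<le> ?N n + 1 / real (Suc m)}" for n
      by (intro closed_Collect_le continuous_comb_code continuous_on_const)
    ultimately show ?thesis unfolding C_def by (intro closed_Int closed_INT ballI)
  qed
  have "(\<Inter>m. C m) \<noteq> {}"
  proof (rule compact_space_imp_nest)
    show "compact_space (euclidean :: cantor topology)"
      using compact_UNIV_cantor by (simp add: compact_space_def)
    show "closedin euclidean (C m)" for m using closed by simp
    show "C m \<noteq> {}" for m
    proof -
      obtain t where t: "?P m t" using R by blast
      let ?b = "\<lambda>i. i < length t \<and> t ! i"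
      have "map ?b [0..<length s] ! i = ?b i" if "i < length s" for i
        using that by (subst nth_map) simp_all
      then have "?b i = s ! i" if "i < length s" for i
        unfolding t[THEN conjunct1] using that by blast
      then have "?b \<in> C m" using t[THEN conjunct2] unfolding C_def by (blast intro: less_imp_le)
      then show ?thesis by blast
    qed
    show "decseq C"
    proof (rule decseq_SucI)
      fix m
      have "1 / real (Suc (Suc m)) \<le> 1 / real (Suc m)" by (intro divide_left_mono) auto
      then have "{b. ?g n b \<le> ?N n + 1 / real (Suc (Suc m))} \<subseteq> {b. ?g n b \<le> ?N n + 1 / real (Suc m)}" for n
        by (intro Collect_mono impI) linarith
      then show "C (Suc m) \<subseteq> C m"
        unfolding C_def by (intro Int_mono INT_anti_mono subset_refl) simp_all
    qed
  qed
  then obtain b where b: "\<And>m. b \<in> C m" by blast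
  have "?g n b \<le> ?N n" for n
  proof (rule field_le_epsilon)
    fix e :: real assume "0 < e"
    then obtain k where k: "1 / real (Suc k) < e" using nat_approx_posE by blast
    \<comment> \<open>\<open>Suc n\<close> brings the n-th constraint into \<open>C ?m\<close>, and
      \<open>k\<close> makes its error small.\<close>
    let ?m = "max k (Suc n)"
    have "?g n b \<le> ?N n + 1 / real (Suc ?m)" using b[of ?m] by (auto simp: C_def)
    also have "1 / real (Suc ?m) \<le> 1 / real (Suc k)" by (intro divide_left_mono) auto
    finally show "?g n b \<le> ?N n + e" using k by linarith
  qed
  then have "cmod (comb (code N b) (rational_poly l)) \<le> N (rational_poly l)" for l
    by (metis from_nat_to_nat)
  then have "b \<in> dual_ball N" by (simp add: dual_ball_def)
  moreover have "map b [0..<length s] = s"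
    using b[of 0] by (intro nth_equalityI) (auto simp: C_def)
  ultimately show ?L by (auto simp: words_def)
qed

section \<open>The generators of the embedding\<close>

definition generator :: "(complex poly \<Rightarrow> real) \<Rightarrow> nat \<Rightarrow> cantor \<Rightarrow>\<^sub>C complex" where
  "generator N k = Bcontfun (\<lambda>b. code N (tree_retract (words (dual_ball N)) b) k)"

lemma apply_generator: "apply_bcontfun (generator N k) b = code N (tree_retract (words (dual_ball N)) b) k"
proof -
  have "continuous_on UNIV (\<lambda>b. code N (tree_retract (words (dual_ball N)) b) k)"
    unfolding code_def
    by (intro continuous_intros continuous_on_compose2[OF continuous_coord continuous_tree_retract]) simp
  then show ?thesis by (simp add: generator_def cantor_Bcontfun_inverse)
qed

text \<open>Each value of \<open>u\<close> is the value at \<open>p\<close> of a functional bounded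
  by \<open>N\<close>, which gives one inequality; the code of a functional that norms
  \<open>p\<close> is fixed by the retraction, which gives the other.\<close>

theorem generator_isometric:
  assumes N: "poly.seminorm N" and u: "\<And>b. apply_bcontfun u b = comb (\<lambda>k. apply_bcontfun (generator N k) b) p"
  shows "norm u = N p"
proof (rule order_antisym)
  let ?r = "tree_retract (words (dual_ball N))"
  have u': "apply_bcontfun u b = comb (code N (?r b)) p" for b by (simp add: u apply_generator)
  obtain c where c: "c \<in> dual_ball N" "cmod (comb (code N c) p) = N p" by (rule dual_ball_norming[OF N])
  then have "?r b \<in> dual_ball N" for b by (intro tree_retract_in closed_dual_ball) auto
  then show "norm u \<le> N p" by (intro norm_bound) (simp add: u' dual_ball_bound[OF N])
  show "N p \<le> norm u" using norm_bounded[of u c] c by (simp add: u' tree_retract_id)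
qed

text \<open>The seminorm enters in two ways, through the scaling in \<open>code\<close> and through
  the answers of \<open>words (dual_ball N)\<close>; \<open>words_dual_ball_iff\<close> writes the
  latter with countable quantifiers.\<close>

theorem measurable_generator:
  assumes N: "\<And>p. (\<lambda>w. N w p) \<in> borel_measurable M"
  shows "(\<lambda>w. generator (N w) k) \<in> borel_measurable M"
proof -
  note [measurable] = N
  have code: "(\<lambda>w. code (N w) b k) \<in> borel_measurable M" for b k unfolding code_def by measurable
  have [measurable]: "(\<lambda>w. comb (code (N w) b) p) \<in> borel_measurable M" for b p
    unfolding comb_def using code by measurable
  have "Measurable.pred M (\<lambda>w. words (dual_ball (N w)) s)" for s
    unfolding words_dual_ball_iff by measurable
  from measurable_tree_retract[OF this]
  have "(\<lambda>w. coord k (tree_retract (words (dual_ball (N w))) b)) \<in> borel_measurable M" for b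
    by (rule measurable_compose) (intro borel_measurable_continuous_onI continuous_coord)
  then show ?thesis
    unfolding borel_measurable_C_cantor_iff apply_generator code_def
    by (intro allI borel_measurable_times measurable_compose[OF N borel_measurable_of_real])
qed

section \<open>Extending isometries from dense sequences\<close>

definition dense_index :: "'a normed_struct \<Rightarrow> (nat \<Rightarrow> 'a) \<Rightarrow> 'a \<Rightarrow> nat \<Rightarrow> nat" where
  "dense_index E v w j = (LEAST n. norm_dist E w (v n) < (1/2)^j)"

definition extension ::
  "'a normed_struct \<Rightarrow> (nat \<Rightarrow> 'a) \<Rightarrow> (nat \<Rightarrow> cantor \<Rightarrow>\<^sub>C complex) \<Rightarrow> 'a \<Rightarrow> cantor \<Rightarrow>\<^sub>C complex" where
  "extension E v g w = lim (\<lambda>j. g (dense_index E v w j))"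

text \<open>The \<open>v n\<close> need not be closed under the operations, so linearity of
  \<open>g\<close> cannot be demanded. Prescribing the distances of sums and multiples from all
  \<open>g k\<close> has the same effect in the limit.\<close>

locale isometric_generators = normed_carrier E for E :: "'a normed_struct" +
  fixes v :: "nat \<Rightarrow> 'a" and g :: "nat \<Rightarrow> cantor \<Rightarrow>\<^sub>C complex"
  assumes v_in: "v n \<in> carrier E"
    and v_dense: "u \<in> carrier E \<Longrightarrow> 0 < r \<Longrightarrow> \<exists>n. norm_dist E u (v n) < r"
    and dist_g: "dist (g n) (g m) = norm_dist E (v n) (v m)"
    and dist_g_plus: "dist (g k) (g n + g m) = norm_dist E (v k) (plus E (v n) (v m))"
    and dist_g_scale: "dist (g k) (scale C_cantor a (g n)) = norm_dist E (v k) (scale E a (v n))"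
begin

abbreviation ext :: "'a \<Rightarrow> cantor \<Rightarrow>\<^sub>C complex" where "ext \<equiv> extension E v g"

lemma dense_index:
  assumes "w \<in> carrier E"
  shows "norm_dist E w (v (dense_index E v w j)) < (1/2)^j"
  unfolding dense_index_def by (rule LeastI_ex) (simp add: v_dense assms)

lemma dist_dense_index:
  assumes w: "w \<in> carrier E" and u: "u \<in> carrier E"
  shows "(\<lambda>j. norm_dist E u (v (dense_index E v w j))) \<longlonglongrightarrow> norm_dist E u w"
proof -
  let ?d = "\<lambda>j. norm_dist E u (v (dense_index E v w j)) - norm_dist E u w"
  have "norm (?d j) \<le> (1/2)^j" for j
    using norm_dist_triangle[OF u w v_in[of "dense_index E v w j"]]
      norm_dist_triangle[OF u v_in[of "dense_index E v w j"] w] dense_index[OF w, of j]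
    by (simp add: norm_dist_commute[of _ w] abs_le_iff)
  then have "?d \<longlonglongrightarrow> 0"
    by (intro Lim_null_comparison[OF _ LIMSEQ_power_zero[of "1/2 :: real"]]) (simp_all add: always_eventually)
  then show ?thesis by (rule LIM_zero_cancel)
qed

lemma ext_tendsto:
  assumes w: "w \<in> carrier E"
  shows "(\<lambda>j. g (dense_index E v w j)) \<longlonglongrightarrow> ext w"
proof -
  have "Cauchy (\<lambda>j. g (dense_index E v w j))"
  proof (rule metric_CauchyI)
    fix e :: real assume "0 < e"
    then obtain N where N: "(1/2 :: real)^N < e / 2" using real_arch_pow_inv[of "e/2" "1/2"] by auto
    have "dist (g (dense_index E v w m)) (g (dense_index E v w n)) < e" if "N \<le> m" "N \<le> n" for m n
    proof -
      have "(1/2 :: real)^m \<le> (1/2)^N" "(1/2 :: real)^n \<le> (1/2)^N" using that by (auto intro: power_decreasing)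
      then show ?thesis
        using norm_dist_triangle[OF v_in[of "dense_index E v w m"] w v_in[of "dense_index E v w n"]]
          dense_index[OF w, of m] dense_index[OF w, of n] N
        unfolding dist_g norm_dist_commute[of _ w] by linarith
    qed
    then show "\<exists>M. \<forall>m\<ge>M. \<forall>n\<ge>M. dist (g (dense_index E v w m)) (g (dense_index E v w n)) < e" by blast
  qed
  then have "convergent (\<lambda>j. g (dense_index E v w j))"
    using complete_C_cantor unfolding complete_def convergent_def by blast
  then show ?thesis by (simp add: extension_def convergent_LIMSEQ_iff)
qed

lemma dist_ext_g:
  assumes w: "w \<in> carrier E"
  shows "dist (ext w) (g n) = norm_dist E w (v n)"
proof (rule LIMSEQ_unique)
  show "(\<lambda>j. dist (g (dense_index E v w j)) (g n)) \<longlonglongrightarrow> dist (ext w) (g n)"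
    by (intro tendsto_intros ext_tendsto w)
  show "(\<lambda>j. dist (g (dense_index E v w j)) (g n)) \<longlonglongrightarrow> norm_dist E w (v n)"
    using dist_dense_index[OF w v_in[of n]] by (simp add: dist_g norm_dist_commute)
qed

lemma dist_ext:
  assumes "w \<in> carrier E" "u \<in> carrier E"
  shows "dist (ext u) (ext w) = norm_dist E u w"
proof (rule LIMSEQ_unique)
  show "(\<lambda>j. dist (ext u) (g (dense_index E v w j))) \<longlonglongrightarrow> dist (ext u) (ext w)"
    by (intro tendsto_intros ext_tendsto assms)
  show "(\<lambda>j. dist (ext u) (g (dense_index E v w j))) \<longlonglongrightarrow> norm_dist E u w"
    using dist_dense_index[OF assms] by (simp add: dist_ext_g assms)
qed

lemma ext_v: "ext (v n) = g n"
  using dist_ext_g[OF v_in, of n n] v_in by simp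

lemma ext_plus:
  assumes u: "u \<in> carrier E" and w: "w \<in> carrier E"
  shows "ext (plus E u w) = ext u + ext w"
proof -
  have uw: "plus E u w \<in> carrier E" using u w by (rule plus_in)
  have "dist (ext (plus E u w)) (ext u + ext w) \<le> 0 + e" if e: "0 < e" for e
  proof -
    \<comment> \<open>The sum of \<open>v n\<close> and \<open>v m\<close> need not occur in the
      sequence, hence a third index for \<open>plus E u w\<close>. The three error terms below are
      e/2, e/6 and e/3.\<close>
    obtain n where n: "norm_dist E u (v n) < e / 6" using v_dense[OF u, of "e/6"] e by auto
    obtain m where m: "norm_dist E w (v m) < e / 6" using v_dense[OF w, of "e/6"] e by auto
    obtain k where k: "norm_dist E (plus E u w) (v k) < e / 6" using v_dense[OF uw, of "e/6"] e by auto
    have "norm_dist E (v k) (plus E (v n) (v m)) \<le>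
        norm_dist E (plus E u w) (v k) + norm_dist E (plus E u w) (plus E (v n) (v m))"
      using norm_dist_triangle[OF v_in[of k] uw plus_in[OF v_in[of n] v_in[of m]]]
      by (simp add: norm_dist_commute[of "v k" "plus E u w"])
    moreover have "norm_dist E (plus E u w) (plus E (v n) (v m)) \<le> norm_dist E u (v n) + norm_dist E w (v m)"
      by (rule norm_dist_plus[OF u w v_in v_in])
    ultimately have 1: "dist (g k) (g n + g m) < e / 2" using n m k by (simp add: dist_g_plus)
    have 2: "dist (ext (plus E u w)) (g k) < e / 6" using k by (simp add: dist_ext_g uw)
    have "dist (g n + g m) (ext u + ext w) \<le> dist (g n) (ext u) + dist (g m) (ext w)"
      by (rule dist_triangle_add)
    then have 3: "dist (g n + g m) (ext u + ext w) < e / 3"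
      using n m by (simp add: dist_commute[of "g _"] dist_ext_g u w)
    have "dist (ext (plus E u w)) (ext u + ext w) \<le>
        dist (ext (plus E u w)) (g k) + dist (g k) (g n + g m) + dist (g n + g m) (ext u + ext w)"
      using dist_triangle[of "ext (plus E u w)" "ext u + ext w" "g k"]
        dist_triangle[of "g k" "ext u + ext w" "g n + g m"] by linarith
    then show ?thesis using 1 2 3 by linarith
  qed
  then have "dist (ext (plus E u w)) (ext u + ext w) \<le> 0" by (rule field_le_epsilon)
  then show ?thesis by simp
qed

lemma ext_scale:
  assumes u: "u \<in> carrier E"
  shows "ext (scale E a u) = scale C_cantor a (ext u)"
proof -
  have au: "scale E a u \<in> carrier E" using u by (rule scale_in)
  have "dist (ext (scale E a u)) (scale C_cantor a (ext u)) \<le> 0 + e" if e: "0 < e" for e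
  proof -
    have pos: "0 < e / 4 / (cmod a + 1)" using e by (simp add: add_nonneg_pos)
    obtain n where n: "norm_dist E u (v n) < e / 4 / (cmod a + 1)" using v_dense[OF u pos] by auto
    obtain k where k: "norm_dist E (scale E a u) (v k) < e / 4" using v_dense[OF au, of "e/4"] e by auto
    have "cmod a * norm_dist E u (v n) \<le> norm_dist E u (v n) * (cmod a + 1)"
      by (simp add: algebra_simps)
    also have "\<dots> < e / 4" using n by (subst (asm) pos_less_divide_eq) (simp_all add: add_nonneg_pos)
    finally have an: "cmod a * norm_dist E u (v n) < e / 4" .
    have "norm_dist E (v k) (scale E a (v n)) \<le>
        norm_dist E (scale E a u) (v k) + norm_dist E (scale E a u) (scale E a (v n))"
      using norm_dist_triangle[OF v_in[of k] au scale_in[OF v_in[of n]]]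
      by (simp add: norm_dist_commute[of "v k" "scale E a u"])
    then have 1: "dist (g k) (scale C_cantor a (g n)) < e / 2"
      using k an by (simp add: dist_g_scale norm_dist_scale u v_in)
    have 2: "dist (ext (scale E a u)) (g k) < e / 4" using k by (simp add: dist_ext_g au)
    have 3: "dist (scale C_cantor a (g n)) (scale C_cantor a (ext u)) < e / 4"
      using an by (simp add: dist_scale_C_cantor dist_commute[of "g _"] dist_ext_g u)
    have "dist (ext (scale E a u)) (scale C_cantor a (ext u)) \<le> dist (ext (scale E a u)) (g k) +
        dist (g k) (scale C_cantor a (g n)) + dist (scale C_cantor a (g n)) (scale C_cantor a (ext u))"
      using dist_triangle[of "ext (scale E a u)" "scale C_cantor a (ext u)" "g k"]
        dist_triangle[of "g k" "scale C_cantor a (ext u)" "scale C_cantor a (g n)"] by linarith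
    then show ?thesis using 1 2 3 by linarith
  qed
  then have "dist (ext (scale E a u)) (scale C_cantor a (ext u)) \<le> 0" by (rule field_le_epsilon)
  then show ?thesis by simp
qed

lemma ext_zero: "ext (zero E) = 0"
  using ext_scale[OF zero_in, of 0] by (simp add: scale_zero zero_in scale_C_cantor_zero)

lemma norm_ext: "u \<in> carrier E \<Longrightarrow> norm (ext u) = nrm E u"
  using dist_ext[OF zero_in, of u] by (simp add: ext_zero norm_dist_zero dist_norm)

lemma isometric_linear_iso_ext:
  "isometric_linear_iso E (C_cantor\<lparr>carrier := ext ` carrier E\<rparr>) ext"
proof -
  have "inj_on ext (carrier E)"
  proof (rule inj_onI)
    fix u w assume "u \<in> carrier E" "w \<in> carrier E" "ext u = ext w"
    then show "u = w" using dist_ext[of w u] by simp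
  qed
  then show ?thesis
    unfolding isometric_linear_iso_def
    by (auto simp: bij_betw_def ext_plus ext_scale norm_ext)
qed

text \<open>An isometric image of a complete space is complete, hence closed.\<close>

lemma ext_image_closed_subspace:
  assumes mcomplete
  shows "ext ` carrier E \<in> closed_subspaces C_cantor"
  unfolding closed_subspaces_C_cantor_iff
proof (intro conjI ballI allI)
  show "closed (ext ` carrier E)"
    unfolding closed_sequential_limits
  proof (intro allI impI)
    fix f l assume f: "(\<forall>n. f n \<in> ext ` carrier E) \<and> f \<longlonglongrightarrow> l"
    then have "\<forall>n. \<exists>w. w \<in> carrier E \<and> f n = ext w" by blast
    from choice[OF this] obtain w where w: "\<And>n. w n \<in> carrier E" "\<And>n. f n = ext (w n)" by blast
    have "Cauchy f" by (rule LIMSEQ_imp_Cauchy[OF conjunct2[OF f]])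
    then have "MCauchy w"
      unfolding MCauchy_def Cauchy_def by (auto simp: w dist_ext)
    then obtain u where u: "limitin mtopology w u sequentially"
      using assms unfolding mcomplete_def by blast
    then have uE: "u \<in> carrier E" and "(\<lambda>n. norm_dist E (w n) u) \<longlonglongrightarrow> 0"
      by (auto simp: limitin_metric_dist_null)
    moreover from uE have "(\<lambda>n. dist (f n) (ext u)) = (\<lambda>n. norm_dist E (w n) u)"
      unfolding w(2) using w(1) by (intro HOL.ext dist_ext)
    ultimately have "(\<lambda>n. dist (f n) (ext u)) \<longlonglongrightarrow> 0" by (simp only:)
    then have "f \<longlonglongrightarrow> ext u" by (rule tendsto_dist_iff[THEN iffD2])
    with conjunct2[OF f] have "l = ext u" by (rule LIMSEQ_unique)
    then show "l \<in> ext ` carrier E" using \<open>u \<in> carrier E\<close> by blast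
  qed
  show "0 \<in> ext ` carrier E" using ext_zero zero_in by (metis imageI)
  show "u + w \<in> ext ` carrier E" if "u \<in> ext ` carrier E" "w \<in> ext ` carrier E" for u w
    using that ext_plus plus_in by (smt (verit) image_iff)
  show "scale C_cantor a u \<in> ext ` carrier E" if "u \<in> ext ` carrier E" for a u
    using that ext_scale scale_in by (smt (verit) image_iff)
qed

text \<open>The \<open>g n\<close> are dense in the image. When the fibre varies, hitting an open
  set thus becomes a countable condition on the generators.\<close>

lemma ext_image_Int_open_iff:
  assumes "open U"
  shows "ext ` carrier E \<inter> U \<noteq> {} \<longleftrightarrow> (\<exists>n. g n \<in> U)"
proof
  assume "ext ` carrier E \<inter> U \<noteq> {}"
  then obtain w where w: "w \<in> carrier E" "ext w \<in> U" by blast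
  then obtain r where r: "0 < r" "ball (ext w) r \<subseteq> U" using assms open_contains_ball by blast
  obtain n where "norm_dist E w (v n) < r" using v_dense[OF w(1) r(1)] by blast
  then have "g n \<in> ball (ext w) r" by (simp add: dist_ext_g w(1))
  then show "\<exists>n. g n \<in> U" using r(2) by blast
next
  assume "\<exists>n. g n \<in> U"
  then obtain n where "ext (v n) \<in> U" by (auto simp: ext_v)
  then show "ext ` carrier E \<inter> U \<noteq> {}" using v_in by blast
qed

end

section \<open>Linear combinations in a normed space on a carrier\<close>

text \<open>The operations are record fields, so finite sums are built by recursion. Starting with
  the term of index 0 and not with the zero vector means that measurability can start from a section
  instead of calling for a Borel zero section.\<close>

primrec partial_comb :: "'a normed_struct \<Rightarrow> (nat \<Rightarrow> 'a) \<Rightarrow> (nat \<Rightarrow> complex) \<Rightarrow> nat \<Rightarrow> 'a" where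
  "partial_comb E v c 0 = scale E (c 0) (v 0)"
| "partial_comb E v c (Suc n) = plus E (partial_comb E v c n) (scale E (c (Suc n)) (v (Suc n)))"

definition linear_comb :: "'a normed_struct \<Rightarrow> (nat \<Rightarrow> 'a) \<Rightarrow> complex poly \<Rightarrow> 'a" where
  "linear_comb E v p = partial_comb E v (coeff p) (degree p)"

context normed_carrier
begin

context
  fixes v :: "nat \<Rightarrow> 'a" assumes v: "\<And>n. v n \<in> carrier E"
begin

lemma partial_comb_in: "partial_comb E v c n \<in> carrier E"
  by (induction n) (simp_all add: v plus_in scale_in)

lemma partial_comb_add:
  "partial_comb E v (\<lambda>k. c k + d k) n = plus E (partial_comb E v c n) (partial_comb E v d n)"
proof (induction n)
  case (Suc n)
  have "plus E (plus E P Q) (plus E A B) = plus E (plus E P A) (plus E Q B)"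
    if "P \<in> carrier E" "Q \<in> carrier E" "A \<in> carrier E" "B \<in> carrier E" for P Q A B
    using that by (simp add: plus_assoc plus_left_commute[of Q] plus_in)
  then show ?case by (simp add: Suc scale_add v scale_in partial_comb_in)
qed (simp add: scale_add v)

lemma partial_comb_scale: "partial_comb E v (\<lambda>k. a * c k) n = scale E a (partial_comb E v c n)"
  by (induction n) (simp_all add: scale_mult v scale_plus scale_in partial_comb_in)

lemma partial_comb_zero: "(\<And>k. k \<le> n \<Longrightarrow> c k = 0) \<Longrightarrow> partial_comb E v c n = zero E"
  by (induction n) (simp_all add: scale_zero v zero_plus zero_in)

lemma linear_comb_eq: "degree p \<le> n \<Longrightarrow> linear_comb E v p = partial_comb E v (coeff p) n"
proof (induction n rule: dec_induct)
  case (step n)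
  then show ?case by (simp add: coeff_eq_0 scale_zero v plus_zero partial_comb_in)
qed (simp add: linear_comb_def)

lemma linear_comb_in: "linear_comb E v p \<in> carrier E"
  by (simp add: linear_comb_def partial_comb_in)

lemma linear_comb_add: "linear_comb E v (p + q) = plus E (linear_comb E v p) (linear_comb E v q)"
proof -
  let ?n = "max (degree p) (degree q)"
  have "coeff (p + q) = (\<lambda>k. coeff p k + coeff q k)" by (simp add: fun_eq_iff)
  then show ?thesis
    by (simp add: linear_comb_eq[of "p + q" ?n] linear_comb_eq[of p ?n] linear_comb_eq[of q ?n]
        degree_add_le partial_comb_add)
qed

lemma linear_comb_smult: "linear_comb E v (smult a p) = scale E a (linear_comb E v p)"
proof -
  have "coeff (smult a p) = (\<lambda>k. a * coeff p k)" by (simp add: fun_eq_iff)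
  then show ?thesis
    by (simp add: linear_comb_eq[of "smult a p" "degree p"] linear_comb_eq[of p "degree p"]
        degree_smult_le partial_comb_scale)
qed

lemma linear_comb_monom: "linear_comb E v (monom a k) = scale E a (v k)"
proof (cases k)
  case (Suc n)
  have "partial_comb E v (coeff (monom a k)) n = zero E" using Suc by (intro partial_comb_zero) simp
  then show ?thesis
    using linear_comb_eq[of "monom a k" k] Suc by (simp add: degree_monom_le zero_plus v scale_in)
qed (use linear_comb_eq[of "monom a k" k] degree_monom_le[of a k] in simp)

lemma seminorm_linear_comb: "poly.seminorm (\<lambda>p. nrm E (linear_comb E v p))"
  unfolding poly.seminorm_def
  by (simp add: linear_comb_add linear_comb_smult nrm_plus nrm_scale linear_comb_in)

text \<open>The difference between a generator and a combination of generators belongs to a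
  polynomial, and \<open>generator_isometric\<close> returns the norm of the corresponding
  combination of the \<open>v n\<close>. All three kinds of distances are instances.\<close>

lemma isometric_generators:
  assumes dense: "\<And>u r. u \<in> carrier E \<Longrightarrow> 0 < r \<Longrightarrow> \<exists>n. norm_dist E u (v n) < r"
  shows "isometric_generators E v (generator (\<lambda>p. nrm E (linear_comb E v p)))"
proof
  let ?g = "generator (\<lambda>p. nrm E (linear_comb E v p))"
  note isometric = generator_isometric[OF seminorm_linear_comb]
  have dist: "dist (?g k) u = norm_dist E (v k) w"
    if "\<And>b. apply_bcontfun u b = comb (\<lambda>k. apply_bcontfun (?g k) b) p" "linear_comb E v p = w" for k u p w
  proof -
    let ?p = "monom 1 k + smult (- 1) p"
    have "norm (?g k - u) = nrm E (linear_comb E v ?p)"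
      by (rule isometric) (simp only: minus_bcontfun.rep_eq that(1) comb_add comb_smult comb_monom, simp)
    also have "linear_comb E v ?p = plus E (v k) (scale E (- 1) w)"
      by (simp only: linear_comb_add linear_comb_smult linear_comb_monom that(2) scale_one[OF v])
    finally show ?thesis
      using linear_comb_in[of p] that(2) by (simp add: dist_norm norm_dist_eq v)
  qed
  show "dist (?g n) (?g m) = norm_dist E (v n) (v m)" for n m
    by (rule dist[of _ "monom 1 m"]) (simp_all add: comb_monom linear_comb_monom scale_one v)
  show "dist (?g k) (?g n + ?g m) = norm_dist E (v k) (plus E (v n) (v m))" for k n m
    by (rule dist[of _ "monom 1 n + monom 1 m"])
       (simp_all add: comb_add comb_monom linear_comb_add linear_comb_monom scale_one v)
  show "dist (?g k) (scale C_cantor a (?g n)) = norm_dist E (v k) (scale E a (v n))" for k a n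
    by (rule dist[of _ "monom a n"])
       (simp_all add: comb_monom linear_comb_monom apply_scale_C_cantor)
qed (use v dense in auto)

end

end

section \<open>Embedding Borel fields into the field of subspaces\<close>

locale sectioned_field =
  fixes W :: "('y, 'w) banach_field" and \<phi> :: "nat \<Rightarrow> 'y \<Rightarrow> 'y \<times> 'w"
  assumes W: "borel_banach_field W" and \<phi>: "dense_sections W \<phi>"
begin

abbreviation sec :: "'y \<Rightarrow> nat \<Rightarrow> 'w" where "sec y n \<equiv> snd (\<phi> n y)"

lemma space_total: "space (total_space W) = Sigma (space (base W)) (\<lambda>y. carrier (fibre W y))"
  and fst_total: "fst \<in> total_space W \<rightarrow>\<^sub>M base W"
  and nrm_total: "(\<lambda>(x, v). nrm (fibre W x) v) \<in> total_space W \<rightarrow>\<^sub>M restrict_space borel {0..}"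
  and plus_total: "(\<lambda>((x, v), (y, w)). (x, plus (fibre W x) v w)) \<in> fibre_product W \<rightarrow>\<^sub>M total_space W"
  and scale_total: "(\<lambda>(a, (x, v)). (x, scale (fibre W x) a v)) \<in> borel \<Otimes>\<^sub>M total_space W \<rightarrow>\<^sub>M total_space W"
  using W unfolding borel_banach_field_def by simp_all

lemma separable_banach_fibre: "y \<in> space (base W) \<Longrightarrow> separable_banach_space (fibre W y)"
  using W unfolding borel_banach_field_def by simp

lemma normed_carrier_fibre: "y \<in> space (base W) \<Longrightarrow> normed_carrier (fibre W y)"
  using separable_banach_fibre by (auto simp: separable_banach_space_def intro: normed_carrier.intro)

lemma section_in_total: "\<phi> n \<in> base W \<rightarrow>\<^sub>M total_space W"
  and fst_section: "y \<in> space (base W) \<Longrightarrow> fst (\<phi> n y) = y"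
  using \<phi> by (simp_all add: dense_sections_def borel_section_def)

lemma sec_in: "y \<in> space (base W) \<Longrightarrow> sec y n \<in> carrier (fibre W y)"
  using measurable_space[OF section_in_total[of n], of y] fst_section[of y n]
  by (auto simp: space_total)

lemma sec_dense:
  assumes "y \<in> space (base W)" "u \<in> carrier (fibre W y)" "0 < r"
  shows "\<exists>n. norm_dist (fibre W y) u (sec y n) < r"
proof -
  interpret normed_carrier "fibre W y" using assms(1) by (rule normed_carrier_fibre)
  have "norm_topology (fibre W y) closure_of range (sec y) = carrier (fibre W y)"
    using \<phi> assms(1) by (simp add: dense_sections_def)
  moreover have "range (sec y) \<subseteq> carrier (fibre W y)" using sec_in[OF assms(1)] by blast
  ultimately show ?thesis using closure_of_range_eq_carrier_iff[of "sec y"] assms(2,3) by simp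
qed

lemma measurable_plus_total:
  assumes h: "h \<in> M \<rightarrow>\<^sub>M total_space W" and k: "k \<in> M \<rightarrow>\<^sub>M total_space W"
    and eq: "\<And>z. z \<in> space M \<Longrightarrow> fst (h z) = fst (k z)"
  shows "(\<lambda>z. (fst (h z), plus (fibre W (fst (h z))) (snd (h z)) (snd (k z)))) \<in> M \<rightarrow>\<^sub>M total_space W"
proof -
  have "(\<lambda>z. (h z, k z)) \<in> M \<rightarrow>\<^sub>M fibre_product W"
    unfolding fibre_product_def using h k eq by (intro measurable_restrict_space2 measurable_Pair) auto
  from measurable_compose[OF this plus_total] show ?thesis by (simp add: case_prod_unfold)
qed

lemma measurable_scale_total:
  assumes h: "h \<in> M \<rightarrow>\<^sub>M total_space W"
  shows "(\<lambda>z. (fst (h z), scale (fibre W (fst (h z))) a (snd (h z)))) \<in> M \<rightarrow>\<^sub>M total_space W"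
proof -
  have "(\<lambda>z. (a, h z)) \<in> M \<rightarrow>\<^sub>M borel \<Otimes>\<^sub>M total_space W" using h by (intro measurable_Pair) auto
  from measurable_compose[OF this scale_total] show ?thesis by (simp add: case_prod_unfold)
qed

lemma measurable_nrm_total:
  assumes h: "h \<in> M \<rightarrow>\<^sub>M total_space W"
  shows "(\<lambda>z. nrm (fibre W (fst (h z))) (snd (h z))) \<in> borel_measurable M"
proof -
  have "(\<lambda>(x, v). nrm (fibre W x) v) \<in> borel_measurable (total_space W)"
    using nrm_total by (simp add: measurable_restrict_space2_iff)
  from measurable_compose[OF h this] show ?thesis by (simp add: case_prod_unfold)
qed

text \<open>The combination is built up inside the total space, one section at a time, by the Borel
  operations of the field; only at the end is the norm applied.\<close>

lemma measurable_nrm_linear_comb: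
  "(\<lambda>y. nrm (fibre W y) (linear_comb (fibre W y) (sec y) p)) \<in> borel_measurable (base W)"
proof -
  \<comment> \<open>The base point is written \<open>fst (\<phi> 0 y)\<close> to match the form in
    which the operations return it; on the base it equals y.\<close>
  have "(\<lambda>y. (fst (\<phi> 0 y), partial_comb (fibre W (fst (\<phi> 0 y))) (sec y) (coeff p) n)) \<in> base W \<rightarrow>\<^sub>M total_space W" for n
  proof (induction n)
    case 0
    show ?case using measurable_scale_total[OF section_in_total[of 0], of "coeff p 0"] by simp
  next
    case (Suc n)
    let ?k = "\<lambda>y. (fst (\<phi> (Suc n) y), scale (fibre W (fst (\<phi> (Suc n) y))) (coeff p (Suc n)) (snd (\<phi> (Suc n) y)))"
    have k: "?k \<in> base W \<rightarrow>\<^sub>M total_space W" by (rule measurable_scale_total[OF section_in_total])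
    have "(\<lambda>y. (fst (\<phi> 0 y), plus (fibre W (fst (\<phi> 0 y))) (partial_comb (fibre W (fst (\<phi> 0 y))) (sec y) (coeff p) n)
        (snd (?k y)))) \<in> base W \<rightarrow>\<^sub>M total_space W"
      using measurable_plus_total[OF Suc k] by (simp add: fst_section)
    then show ?case by (rule measurable_cong[THEN iffD1, rotated]) (simp add: fst_section)
  qed
  from measurable_nrm_total[OF this[of "degree p"]]
  show ?thesis by (rule measurable_cong[THEN iffD1, rotated]) (simp add: fst_section linear_comb_def)
qed

lemma measurable_norm_dist_sec:
  "(\<lambda>z. norm_dist (fibre W (fst z)) (snd z) (sec (fst z) n)) \<in> borel_measurable (total_space W)"
proof -
  have id: "(\<lambda>z. z) \<in> total_space W \<rightarrow>\<^sub>M total_space W" by simp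
  have "(\<lambda>z. \<phi> n (fst z)) \<in> total_space W \<rightarrow>\<^sub>M total_space W"
    by (rule measurable_compose[OF fst_total section_in_total])
  from measurable_scale_total[OF this, of "- 1"]
  have "(\<lambda>z. (fst z, scale (fibre W (fst z)) (- 1) (sec (fst z) n))) \<in> total_space W \<rightarrow>\<^sub>M total_space W"
    by (rule measurable_cong[THEN iffD1, rotated]) (auto simp: fst_section space_total)
  from measurable_nrm_total[OF measurable_plus_total[OF id this]]
  have "(\<lambda>z. nrm (fibre W (fst z)) (plus (fibre W (fst z)) (snd z) (scale (fibre W (fst z)) (- 1) (sec (fst z) n))))
      \<in> borel_measurable (total_space W)" by simp
  then show ?thesis
    by (rule measurable_cong[THEN iffD1, rotated]) (auto simp: norm_dist_def space_total sec_in)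
qed

definition gen :: "'y \<Rightarrow> nat \<Rightarrow> cantor \<Rightarrow>\<^sub>C complex" where
  "gen y = generator (\<lambda>p. nrm (fibre W y) (linear_comb (fibre W y) (sec y) p))"

definition embed :: "'y \<Rightarrow> 'w \<Rightarrow> cantor \<Rightarrow>\<^sub>C complex" where
  "embed y = extension (fibre W y) (sec y) (gen y)"

definition image_fibre :: "'y \<Rightarrow> (cantor \<Rightarrow>\<^sub>C complex) set" where
  "image_fibre y = embed y ` carrier (fibre W y)"

lemma isometric_generators_fibre:
  assumes "y \<in> space (base W)"
  shows "isometric_generators (fibre W y) (sec y) (gen y)"
  unfolding gen_def
  by (rule normed_carrier.isometric_generators[OF normed_carrier_fibre[OF assms]])
     (auto intro: sec_in sec_dense assms)

lemma measurable_gen: "(\<lambda>y. gen y n) \<in> borel_measurable (base W)"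
  unfolding gen_def by (rule measurable_generator[OF measurable_nrm_linear_comb])

lemma isometric_linear_iso_embed:
  "y \<in> space (base W) \<Longrightarrow> isometric_linear_iso (fibre W y) (C_cantor\<lparr>carrier := image_fibre y\<rparr>) (embed y)"
  unfolding image_fibre_def embed_def
  by (rule isometric_generators.isometric_linear_iso_ext[OF isometric_generators_fibre])

lemma image_fibre_closed_subspace:
  "y \<in> space (base W) \<Longrightarrow> image_fibre y \<in> closed_subspaces C_cantor"
  unfolding image_fibre_def embed_def
  using separable_banach_fibre[of y]
  by (intro isometric_generators.ext_image_closed_subspace[OF isometric_generators_fibre])
     (simp_all add: separable_banach_space_def)

lemma measurable_image_fibre: "image_fibre \<in> base W \<rightarrow>\<^sub>M effros C_cantor"
proof (rule measurable_effrosI)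
  fix U :: "(cantor \<Rightarrow>\<^sub>C complex) set" assume U: "open U"
  have "{y \<in> space (base W). image_fibre y \<inter> U \<noteq> {}} = (\<Union>n. (\<lambda>y. gen y n) -` U \<inter> space (base W))"
    using isometric_generators.ext_image_Int_open_iff[OF isometric_generators_fibre U]
    by (auto simp: image_fibre_def embed_def)
  also have "\<dots> \<in> sets (base W)"
    using U by (intro sets.countable_UN') (auto intro: measurable_sets[OF measurable_gen])
  finally show "{y \<in> space (base W). image_fibre y \<inter> U \<noteq> {}} \<in> sets (base W)" .
qed (rule image_fibre_closed_subspace)

text \<open>The embedding is a pointwise limit of generators whose index is chosen measurably from a
  countable set.\<close>

lemma measurable_embed: "(\<lambda>z. embed (fst z) (snd z)) \<in> borel_measurable (total_space W)"
proof -
  let ?i = "\<lambda>z. dense_index (fibre W (fst z)) (sec (fst z)) (snd z)"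
  note [measurable] = measurable_norm_dist_sec
  have "(\<lambda>z. ?i z j) \<in> total_space W \<rightarrow>\<^sub>M count_space UNIV" for j
    unfolding dense_index_def by measurable
  then have "(\<lambda>z. gen (fst z) (?i z j)) \<in> borel_measurable (total_space W)" for j
    by (rule measurable_compose_countable[OF measurable_compose[OF fst_total measurable_gen]])
  then show ?thesis
  proof (rule borel_measurable_LIMSEQ_metric)
    fix z assume "z \<in> space (total_space W)"
    then have "fst z \<in> space (base W)" "snd z \<in> carrier (fibre W (fst z))" by (auto simp: space_total)
    then show "(\<lambda>j. gen (fst z) (?i z j)) \<longlonglongrightarrow> embed (fst z) (snd z)"
      unfolding embed_def by (rule isometric_generators.ext_tendsto[OF isometric_generators_fibre])
  qed
qed

text \<open>Stated for an arbitrary target and reparametrization \<open>\<psi>\<close> of the base,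
  so that it serves both the field over the same base and the restricted tautological field.\<close>

lemma field_isomorphicI:
  assumes \<psi>: "\<psi> \<in> base W \<rightarrow>\<^sub>M base U" "bij_betw \<psi> (space (base W)) (space (base U))"
    and fib: "\<And>y. y \<in> space (base W) \<Longrightarrow> fibre U (\<psi> y) = C_cantor\<lparr>carrier := image_fibre y\<rparr>"
    and space: "space (total_space U) = Sigma (space (base U)) (\<lambda>x. carrier (fibre U x))"
    and \<theta>: "(\<lambda>z. (\<psi> (fst z), embed (fst z) (snd z))) \<in> total_space W \<rightarrow>\<^sub>M total_space U"
  shows "field_isomorphic W U"
proof -
  let ?\<theta> = "\<lambda>z. (\<psi> (fst z), embed (fst z) (snd z))"
  have bij: "bij_betw (embed y) (carrier (fibre W y)) (image_fibre y)" if "y \<in> space (base W)" for y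
    using isometric_linear_iso_embed[OF that] by (simp add: isometric_linear_iso_def)
  have "inj_on ?\<theta> (space (total_space W))"
  proof (rule inj_onI)
    fix a b assume *: "a \<in> space (total_space W)" "b \<in> space (total_space W)" "?\<theta> a = ?\<theta> b"
    then have ab: "fst a \<in> space (base W)" "fst b \<in> space (base W)"
      "snd a \<in> carrier (fibre W (fst a))" "snd b \<in> carrier (fibre W (fst b))" by (auto simp: space_total)
    have "fst a = fst b" using *(3) ab \<psi>(2) by (auto simp: bij_betw_def dest: inj_onD)
    moreover from this have "snd a = snd b"
      using *(3) ab bij[of "fst a"] by (auto simp: bij_betw_def dest: inj_onD)
    ultimately show "a = b" by (rule prod_eqI)
  qed
  moreover have "?\<theta> ` space (total_space W) = space (total_space U)"
  proof (rule subset_antisym)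
    show "?\<theta> ` space (total_space W) \<subseteq> space (total_space U)" using measurable_space[OF \<theta>] by blast
    show "space (total_space U) \<subseteq> ?\<theta> ` space (total_space W)"
    proof
      fix q assume q: "q \<in> space (total_space U)"
      then have "fst q \<in> space (base U)" by (auto simp: space)
      then obtain y where y: "y \<in> space (base W)" "fst q = \<psi> y"
        using \<psi>(2) by (auto simp: bij_betw_def)
      then have "snd q \<in> image_fibre y" using q fib[OF y(1)] by (auto simp: space)
      then obtain w where "w \<in> carrier (fibre W y)" "snd q = embed y w" by (auto simp: image_fibre_def)
      then show "q \<in> ?\<theta> ` space (total_space W)"
        using y by (intro image_eqI[of _ _ "(y, w)"]) (auto simp: space_total prod_eq_iff)
    qed
  qed
  ultimately have "bij_betw ?\<theta> (space (total_space W)) (space (total_space U))"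
    by (simp add: bij_betw_def)
  then show ?thesis
    unfolding field_isomorphic_def using \<psi> \<theta> isometric_linear_iso_embed fib
    by (intro exI[of _ \<psi>] exI[of _ ?\<theta>]) simp
qed

end

section \<open>Realization by fields of subspaces, and universality\<close>

lemma space_total_subspace_field:
  "space (total_space (subspace_field C_cantor Y \<gamma>)) = Sigma (space Y) \<gamma>"
  by (auto simp: borel_of_C_cantor space_restrict_space space_pair_measure)

lemma borel_field_isomorphic_subspace_field:
  assumes W: "borel_banach_field W"
  shows "\<exists>\<gamma>\<in>base W \<rightarrow>\<^sub>M effros C_cantor. field_isomorphic W (subspace_field C_cantor (base W) \<gamma>)"
proof -
  obtain \<phi> where "dense_sections W \<phi>" using W unfolding borel_banach_field_def by blast
  with W interpret sectioned_field W \<phi> by unfold_locales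
  have "field_isomorphic W (subspace_field C_cantor (base W) image_fibre)"
  proof (rule field_isomorphicI[of "\<lambda>y. y"])
    show "(\<lambda>z. (fst z, embed (fst z) (snd z))) \<in> total_space W \<rightarrow>\<^sub>M total_space (subspace_field C_cantor (base W) image_fibre)"
      unfolding subspace_field_simps borel_of_C_cantor
      using fst_total measurable_embed
      by (intro measurable_restrict_space2 measurable_Pair) (auto simp: space_total image_fibre_def)
  qed (simp_all add: space_total_subspace_field del: subspace_field_simps(3) add: bij_betw_def)
  then show ?thesis using measurable_image_fibre by blast
qed

lemma standard_borel_unit_interval: "standard_borel (restrict_space (borel :: real measure) {0..1})"
  by (intro standard_borel_restrict_space standard_borel_real) simp

text \<open>The logistic function embeds the line into the open unit interval. Its inverse formula
  is also applied at the endpoints, where only measurability matters.\<close>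

lemma borel_retract_unit_interval:
  "borel_retract (borel :: real measure) (restrict_space (borel :: real measure) {0..1})"
proof (rule borel_retractI)
  show "(\<lambda>r :: real. 1 / (1 + exp (- r))) \<in> borel \<rightarrow>\<^sub>M restrict_space borel {0..1}"
    by (intro measurable_restrict_space2) (auto simp: divide_le_eq add_pos_pos less_imp_le)
  show "(\<lambda>t :: real. ln (t / (1 - t))) \<in> restrict_space borel {0..1} \<rightarrow>\<^sub>M borel"
    by (intro measurable_restrict_space1) measurable
  show "ln (1 / (1 + exp (- r)) / (1 - 1 / (1 + exp (- r)))) = r" for r :: real
  proof -
    have "1 + exp (- r) \<noteq> 0" using exp_gt_zero[of "- r"] by linarith
    then have "1 / (1 + exp (- r)) / (1 - 1 / (1 + exp (- r))) = exp r"
      by (simp add: field_simps exp_minus)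
    then show ?thesis by simp
  qed
qed

text \<open>Different fibres may have the same image, so the first coordinate of
  \<open>\<psi>\<close> keeps the base points apart, while the second selects the fibre. A left
  inverse that reads the first coordinate alone makes the image of \<open>\<psi>\<close>
  Borel.\<close>

lemma borel_field_isomorphic_tautological:
  assumes W: "borel_banach_field W"
  defines "X \<equiv> restrict_space (borel :: real measure) {0..1} \<Otimes>\<^sub>M effros C_cantor"
  shows "\<exists>X0\<in>sets X. field_isomorphic W (restrict_field (subspace_field C_cantor X (\<lambda>(t, A). A)) X0)"
proof -
  obtain \<phi> where "dense_sections W \<phi>" using W unfolding borel_banach_field_def by blast
  with W interpret sectioned_field W \<phi> by unfold_locales
  have X: "standard_borel X"
    unfolding X_def by (intro standard_borel_pair standard_borel_unit_interval standard_borel_effros)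
  have base: "standard_borel (base W)" using W unfolding borel_banach_field_def by blast
  have "\<exists>\<psi>\<in>base W \<rightarrow>\<^sub>M X. inj_on \<psi> (space (base W)) \<and> \<psi> ` space (base W) \<in> sets X \<and>
      (\<forall>y. snd (\<psi> y) = image_fibre y)"
  proof (cases "space (base W) = {}")
    case True
    \<comment> \<open>There is no map from the interval to an empty base. Any first component will
      do here; 0 is arbitrary.\<close>
    then show ?thesis by (intro bexI[of _ "\<lambda>y. (0, image_fibre y)"]) (auto simp: measurable_def)
  next
    case False
    then have "borel_retract (base W) (restrict_space (borel :: real measure) {0..1})"
      using base borel_retract_trans[OF _ borel_retract_unit_interval] by (auto simp: standard_borel_iff_retract)
    then obtain j k where j: "j \<in> base W \<rightarrow>\<^sub>M restrict_space (borel :: real measure) {0..1}"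
      and k: "k \<in> restrict_space (borel :: real measure) {0..1} \<rightarrow>\<^sub>M base W"
      and kj: "\<forall>y\<in>space (base W). k (j y) = y"
      unfolding borel_retract_def by (elim bexE)
    let ?\<psi> = "\<lambda>y. (j y, image_fibre y)"
    have 1: "?\<psi> \<in> base W \<rightarrow>\<^sub>M X" unfolding X_def using j measurable_image_fibre by (rule measurable_Pair)
    have 2: "(\<lambda>z. k (fst z)) \<in> X \<rightarrow>\<^sub>M base W" unfolding X_def by (rule measurable_compose[OF measurable_fst k])
    have "?\<psi> ` space (base W) \<in> sets X" by (rule sets_retract_image[OF X 1 2]) (use kj in simp)
    moreover have "inj_on ?\<psi> (space (base W))" using kj by (intro inj_on_inverseI[of _ "\<lambda>z. k (fst z)"]) simp
    ultimately show ?thesis using 1 by (intro bexI[of _ ?\<psi>]) auto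
  qed
  then obtain \<psi> where \<psi>: "\<psi> \<in> base W \<rightarrow>\<^sub>M X" "inj_on \<psi> (space (base W))" "\<psi> ` space (base W) \<in> sets X"
    and snd_\<psi>: "\<And>y. snd (\<psi> y) = image_fibre y" by blast
  let ?X0 = "\<psi> ` space (base W)"
  let ?U = "restrict_field (subspace_field C_cantor X (\<lambda>(t, A). A)) ?X0"
  have base_U: "space (base ?U) = ?X0"
    using sets.sets_into_space[OF \<psi>(3)] by (auto simp: restrict_field_def space_restrict_space)
  have total_U: "total_space ?U = restrict_space (restrict_space (X \<Otimes>\<^sub>M borel) {(x, u). u \<in> (case x of (t, A) \<Rightarrow> A)})
      {p. fst p \<in> ?X0}"
    by (simp add: restrict_field_def borel_of_C_cantor)
  have fibre_U: "fibre ?U x = C_cantor\<lparr>carrier := snd x\<rparr>" for x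
    by (simp add: restrict_field_def case_prod_unfold)
  have "field_isomorphic W ?U"
  proof (rule field_isomorphicI[of \<psi>])
    show "\<psi> \<in> base W \<rightarrow>\<^sub>M base ?U"
      using \<psi>(1) by (auto simp: restrict_field_def intro!: measurable_restrict_space2)
    show "bij_betw \<psi> (space (base W)) (space (base ?U))"
      unfolding base_U using \<psi>(2) by (rule inj_on_imp_bij_betw)
    show "fibre ?U (\<psi> y) = C_cantor\<lparr>carrier := image_fibre y\<rparr>" for y
      by (simp add: fibre_U snd_\<psi>)
    show "space (total_space ?U) = Sigma (space (base ?U)) (\<lambda>x. carrier (fibre ?U x))"
      unfolding total_U base_U fibre_U using sets.sets_into_space[OF \<psi>(3)]
      by (auto simp: space_restrict_space space_pair_measure case_prod_unfold)
    show "(\<lambda>z. (\<psi> (fst z), embed (fst z) (snd z))) \<in> total_space W \<rightarrow>\<^sub>M total_space ?U"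
      unfolding total_U
      using measurable_compose[OF fst_total \<psi>(1)] measurable_embed
      by (intro measurable_restrict_space2 measurable_Pair)
         (auto simp: space_total image_fibre_def case_prod_unfold snd_\<psi>)
  qed
  then show ?thesis using \<psi>(3) by blast
qed

theorem proposition12p4:
  shows "(\<forall>W :: ('y, 'w) banach_field. borel_banach_field W \<longrightarrow>
            (\<exists>\<gamma> \<in> base W \<rightarrow>\<^sub>M effros C_cantor.
               borel_banach_field (subspace_field C_cantor (base W) \<gamma>) \<and>
               field_isomorphic W (subspace_field C_cantor (base W) \<gamma>)))
         \<and> (let X = restrict_space (borel :: real measure) {0..1} \<Otimes>\<^sub>M effros C_cantor
            in standard_borel X \<and>
               (\<lambda>(t, A). A) \<in> X \<rightarrow>\<^sub>M effros C_cantor \<and>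
               universal_banach_field TYPE(('y, 'w) banach_field)
                 (subspace_field C_cantor X (\<lambda>(t, A). A)))"
proof -
  let ?X = "restrict_space (borel :: real measure) {0..1} \<Otimes>\<^sub>M effros C_cantor"
  have X: "standard_borel ?X"
    by (intro standard_borel_pair standard_borel_unit_interval standard_borel_effros)
  have \<gamma>: "(\<lambda>(t, A). A) \<in> ?X \<rightarrow>\<^sub>M effros C_cantor"
    by (simp add: case_prod_unfold)
  have universal: "universal_banach_field TYPE(('y, 'w) banach_field) (subspace_field C_cantor ?X (\<lambda>(t, A). A))"
    unfolding universal_banach_field_def
    by (intro conjI allI impI borel_banach_field_subspace_field X \<gamma>)
       (simp add: borel_field_isomorphic_tautological)
  have embeddable: "\<exists>\<gamma>\<in>base W \<rightarrow>\<^sub>M effros C_cantor. borel_banach_field (subspace_field C_cantor (base W) \<gamma>) \<and>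
      field_isomorphic W (subspace_field C_cantor (base W) \<gamma>)"
    if W: "borel_banach_field W" for W :: "('y, 'w) banach_field"
  proof -
    have "standard_borel (base W)" using W unfolding borel_banach_field_def by blast
    then show ?thesis
      using borel_field_isomorphic_subspace_field[OF W] borel_banach_field_subspace_field by blast
  qed
  show ?thesis
    unfolding Let_def by (intro conjI allI impI embeddable X \<gamma> universal)
qed

end
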